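(* Let $\Delta$ be a simplicial complex on the product of projective spaces $\mathbb{P}^{\vec n}=\mathbb{P}^{n_1}\times\cdots\times\mathbb{P}^{n_r}$ over a field $\Bbbk$, where $\vec n=(n_1,\dots,n_r)$. Let $F=[F_0\leftarrow F_1\leftarrow\cdots\leftarrow F_p\leftarrow 0]$ be a virtual resolution of $S/I_\Delta$ such that $p=|\vec n|-\dim V(I_\Delta)$. If $Q$ is an associated prime of $I_\Delta$ that does not contain the irrelevant ideal $B$, then $\operatorname{codim} Q=p$.
   Context: Setting: $r\ge 1$, $n_i\ge 0$ are integers, $|\vec n|=n_1+\cdots+n_r$, and $S=\Bbbk[x_{i,j}\mid 1\le i\le r,\ 0\le j\le n_i]$ is the Cox ring of $\mathbb{P}^{\vec n}$ over the field $\Bbbk$, with the $\mathbb{Z}^r$-grading $\deg(x_{i,j})=\mathbf{e}_i$ (the $i$-th standard basis vector). The irrelevant ideal is $B=\bigcap_{i=1}^r\langle x_{i,0},\dots,x_{i,n_i}\rangle$. Each $\mathbb{Z}^r$-graded $S$-module $M$ has an associated quasi-coherent sheaf $\widetilde M$ on $\mathbb{P}^{\vec n}$, and for a homogeneous ideal $I$, $V(I)\subseteq\mathbb{P}^{\vec n}$ denotes its variety. A simplicial complex on $\mathbb{P}^{\vec n}$ is a nonempty collection of subsets of $\{x_{i,j}\mid 1\le i\le r,\ 0\le j\le n_i\}$ closed under taking subsets (not every $x_{i,j}$ need be a vertex). $I_\Delta\subseteq S$ is its Stanley--Reisner ideal, generated by the squarefree monomials corresponding to non-faces. For an associated prime $Q$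 of $I_\Delta$ not containing $B$, $\operatorname{codim} Q=|\vec n|-\dim V(Q)$, which coincides with the height of $Q$ in $S$. Virtual resolutions: for a homogeneous ideal $I\subseteq S$, a virtual resolution of $S/I$ is a complex $[F_0\leftarrow F_1\leftarrow\cdots\leftarrow F_k\leftarrow 0]$ of finitely generated $\mathbb{Z}^r$-graded free $S$-modules (with degree-preserving maps) such that the associated complex of sheaves on $\mathbb{P}^{\vec n}$ is a locally free resolution of the sheaf $(S/I)^\sim$. *)

theory Defs
  imports
    "HOL-Library.Poly_Mapping"
    "HOL-Library.Extended_Real"
    "HOL-Analysis.Abstract_Topology"
    "HOL-Algebra.QuotRing"
    "HOL-Algebra.Module"
begin

section \<open>The Cox ring of a product of projective spaces\<close>

text \<open>A pair \<open>(i, j)\<close> stands for the variable \<open>x\<^sub>i\<^sub>,\<^sub>j\<close>. The multigraded objects below depend on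
  \<open>r\<close> and on \<open>n i\<close> for \<open>1 \<le> i \<le> r\<close> only.\<close>

type_synonym 'k mpoly = "((nat \<times> nat) \<Rightarrow>\<^sub>0 nat) \<Rightarrow>\<^sub>0 'k"

definition cox_vars :: "nat \<Rightarrow> (nat \<Rightarrow> nat) \<Rightarrow> (nat \<times> nat) set" where
  "cox_vars r n = (SIGMA i:{1..r}. {0..n i})"

definition cox_var :: "nat \<times> nat \<Rightarrow> 'k::field mpoly" where
  "cox_var v = Poly_Mapping.single (Poly_Mapping.single v 1) 1"

definition cox_ring :: "nat \<Rightarrow> (nat \<Rightarrow> nat) \<Rightarrow> 'k::field mpoly ring" where
  "cox_ring r n =
    \<lparr>carrier = {f. \<forall>m\<in>Poly_Mapping.keys f. Poly_Mapping.keys m \<subseteq> cox_vars r n},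
     mult = (*), one = 1, zero = 0, add = (+)\<rparr>"

text \<open>\<open>\<int>\<^sup>r\<close> is the set of functions \<open>nat \<Rightarrow> int\<close> that vanish outside \<open>{1..r}\<close>.\<close>

definition degrees :: "nat \<Rightarrow> (nat \<Rightarrow> int) set" where
  "degrees r = {a. \<forall>i. i \<notin> {1..r} \<longrightarrow> a i = 0}"

definition mdeg :: "(nat \<Rightarrow> nat) \<Rightarrow> ((nat \<times> nat) \<Rightarrow>\<^sub>0 nat) \<Rightarrow> nat \<Rightarrow> int" where
  "mdeg n m = (\<lambda>i. \<Sum>j\<le>n i. int (Poly_Mapping.lookup m (i, j)))"

definition cox_part :: "nat \<Rightarrow> (nat \<Rightarrow> nat) \<Rightarrow> (nat \<Rightarrow> int) \<Rightarrow> 'k::field mpoly set" where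
  "cox_part r n a = {f \<in> carrier (cox_ring r n). \<forall>m\<in>Poly_Mapping.keys f. mdeg n m = a}"

definition homogeneous :: "nat \<Rightarrow> (nat \<Rightarrow> nat) \<Rightarrow> 'k::field mpoly set" where
  "homogeneous r n = (\<Union>a\<in>degrees r. cox_part r n a)"

definition homogeneous_ideal :: "nat \<Rightarrow> (nat \<Rightarrow> nat) \<Rightarrow> 'k::field mpoly set \<Rightarrow> bool" where
  "homogeneous_ideal r n I \<longleftrightarrow>
    ideal I (cox_ring r n) \<and> I = Idl\<^bsub>cox_ring r n\<^esub> (I \<inter> homogeneous r n)"

definition irrelevant_ideal :: "nat \<Rightarrow> (nat \<Rightarrow> nat) \<Rightarrow> 'k::field mpoly set" where
  "irrelevant_ideal r n = (\<Inter>i\<in>{1..r}. Idl\<^bsub>cox_ring r n\<^esub> ((\<lambda>j. cox_var (i, j)) ` {0..n i}))"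

definition associated_prime ::
    "nat \<Rightarrow> (nat \<Rightarrow> nat) \<Rightarrow> 'k::field mpoly set \<Rightarrow> 'k mpoly set \<Rightarrow> bool" where
  "associated_prime r n I Q \<longleftrightarrow> primeideal Q (cox_ring r n) \<and>
    (\<exists>f\<in>carrier (cox_ring r n). Q = {g \<in> carrier (cox_ring r n). g * f \<in> I})"

section \<open>Simplicial complexes\<close>

definition simplicial_complex_on :: "nat \<Rightarrow> (nat \<Rightarrow> nat) \<Rightarrow> (nat \<times> nat) set set \<Rightarrow> bool" where
  "simplicial_complex_on r n \<Delta> \<longleftrightarrow>
    \<Delta> \<noteq> {} \<and> \<Delta> \<subseteq> Pow (cox_vars r n) \<and> (\<forall>\<sigma>\<in>\<Delta>. \<forall>\<tau>\<subseteq>\<sigma>. \<tau> \<in> \<Delta>)"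

definition stanley_reisner_ideal ::
    "nat \<Rightarrow> (nat \<Rightarrow> nat) \<Rightarrow> (nat \<times> nat) set set \<Rightarrow> 'k::field mpoly set" where
  "stanley_reisner_ideal r n \<Delta> =
    Idl\<^bsub>cox_ring r n\<^esub> ((\<lambda>\<sigma>. \<Prod>v\<in>\<sigma>. cox_var v) ` {\<sigma>. \<sigma> \<subseteq> cox_vars r n \<and> \<sigma> \<notin> \<Delta>})"

section \<open>The underlying space and dimension\<close>

text \<open>The points of the scheme \<open>\<P>\<^sup>n\<^sup>1 \<times> \<dots> \<times> \<P>\<^sup>n\<^sup>r\<close> (over an arbitrary field, hence not just the rational
  points): the multihomogeneous primes of the Cox ring that do not contain the irrelevant ideal.\<close>

definition points :: "nat \<Rightarrow> (nat \<Rightarrow> nat) \<Rightarrow> 'k::field mpoly set set" where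
  "points r n = {P. primeideal P (cox_ring r n) \<and> homogeneous_ideal r n P
                  \<and> \<not> irrelevant_ideal r n \<subseteq> P}"

definition zariski :: "nat \<Rightarrow> (nat \<Rightarrow> nat) \<Rightarrow> 'k::field mpoly set topology" where
  "zariski r n = topology_generated_by {{P \<in> points r n. f \<notin> P} | f. f \<in> homogeneous r n}"

definition variety :: "nat \<Rightarrow> (nat \<Rightarrow> nat) \<Rightarrow> 'k::field mpoly set \<Rightarrow> 'k mpoly set set" where
  "variety r n I = {P \<in> points r n. I \<subseteq> P}"

definition irreducible_closed :: "'a topology \<Rightarrow> 'a set \<Rightarrow> bool" where
  "irreducible_closed T Z \<longleftrightarrow> closedin T Z \<and> Z \<noteq> {} \<and>
    (\<forall>Z1 Z2. closedin T Z1 \<and> closedin T Z2 \<and> Z = Z1 \<union> Z2 \<longrightarrow> Z = Z1 \<or> Z = Z2)"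

text \<open>Krull dimension; the empty space has dimension \<open>-\<infinity>\<close>.\<close>

definition topological_dim :: "'a topology \<Rightarrow> ereal" where
  "topological_dim T = Sup {ereal (real l) | l. \<exists>Z :: nat \<Rightarrow> 'a set.
     (\<forall>i\<le>l. irreducible_closed T (Z i)) \<and> (\<forall>i<l. Z i \<subset> Z (Suc i))}"

definition dim_V :: "nat \<Rightarrow> (nat \<Rightarrow> nat) \<Rightarrow> 'k::field mpoly set \<Rightarrow> ereal" where
  "dim_V r n I = topological_dim (subtopology (zariski r n) (variety r n I))"

definition total_dim :: "nat \<Rightarrow> (nat \<Rightarrow> nat) \<Rightarrow> nat" where
  "total_dim r n = (\<Sum>i=1..r. n i)"

definition codim :: "nat \<Rightarrow> (nat \<Rightarrow> nat) \<Rightarrow> 'k::field mpoly set \<Rightarrow> ereal" where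
  "codim r n Q = ereal (real (total_dim r n)) - dim_V r n Q"

section \<open>Graded modules\<close>

text \<open>The fields \<^const>\<open>mult\<close> and \<^const>\<open>one\<close> that module records inherit from ring records
  carry no information in this section and the next.\<close>

record ('a, 'm) graded_module = "('a, 'm) module" +
  hpart :: "(nat \<Rightarrow> int) \<Rightarrow> 'm set"

definition cox_module :: "nat \<Rightarrow> (nat \<Rightarrow> nat) \<Rightarrow> ('k::field mpoly, 'k mpoly) graded_module" where
  "cox_module r n =
    \<lparr>carrier = carrier (cox_ring r n), mult = (*), one = 1, zero = 0, add = (+),
     smult = (*), hpart = cox_part r n\<rparr>"

text \<open>The free module \<open>S(-a\<^sub>0) \<oplus> \<dots> \<oplus> S(-a\<^sub>m)\<close> for a list \<open>as = [a\<^sub>0, \<dots>, a\<^sub>m]\<close> of degrees, where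
  \<open>S(-a)\<^sub>b = S\<^bsub>b-a\<^esub>\<close>.\<close>

definition free_module ::
    "nat \<Rightarrow> (nat \<Rightarrow> nat) \<Rightarrow> (nat \<Rightarrow> int) list \<Rightarrow> ('k::field mpoly, nat \<Rightarrow> 'k mpoly) graded_module" where
  "free_module r n as =
    \<lparr>carrier = {..<length as} \<rightarrow>\<^sub>E carrier (cox_ring r n),
     mult = undefined, one = undefined,
     zero = (\<lambda>k\<in>{..<length as}. 0),
     add = (\<lambda>u v. \<lambda>k\<in>{..<length as}. u k + v k),
     smult = (\<lambda>f u. \<lambda>k\<in>{..<length as}. f * u k),
     hpart = (\<lambda>b. \<Pi>\<^sub>E k\<in>{..<length as}. cox_part r n (\<lambda>i. b i - (as ! k) i))\<rparr>"

definition quotient_module ::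
    "nat \<Rightarrow> (nat \<Rightarrow> nat) \<Rightarrow> 'k::field mpoly set \<Rightarrow> ('k mpoly, 'k mpoly set) graded_module" where
  "quotient_module r n I =
    (let S = cox_ring r n in
     \<lparr>carrier = carrier (S Quot I), mult = mult (S Quot I), one = one (S Quot I),
      zero = zero (S Quot I), add = add (S Quot I),
      smult = (\<lambda>f c. (I +>\<^bsub>S\<^esub> f) \<otimes>\<^bsub>S Quot I\<^esub> c),
      hpart = (\<lambda>a. (\<lambda>f. I +>\<^bsub>S\<^esub> f) ` cox_part r n a)\<rparr>)"

definition graded_hom ::
    "nat \<Rightarrow> (nat \<Rightarrow> nat) \<Rightarrow> ('k::field mpoly, 'a) graded_module \<Rightarrow> ('k mpoly, 'b) graded_module
      \<Rightarrow> ('a \<Rightarrow> 'b) \<Rightarrow> bool" where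
  "graded_hom r n M N d \<longleftrightarrow>
    d \<in> carrier M \<rightarrow> carrier N \<and>
    (\<forall>u\<in>carrier M. \<forall>v\<in>carrier M. d (u \<oplus>\<^bsub>M\<^esub> v) = d u \<oplus>\<^bsub>N\<^esub> d v) \<and>
    (\<forall>f\<in>carrier (cox_ring r n). \<forall>u\<in>carrier M. d (f \<odot>\<^bsub>M\<^esub> u) = f \<odot>\<^bsub>N\<^esub> d u) \<and>
    (\<forall>a\<in>degrees r. d ` hpart M a \<subseteq> hpart N a)"

section \<open>The sheaf of a graded module\<close>

text \<open>\<open>hfrac r n M P m f\<close> is the class of the fraction \<open>m/f\<close> in the degree-zero part \<open>M\<^bsub>(P)\<^esub>\<close> of the
  homogeneous localization of \<open>M\<close> at \<open>P\<close>, as a set of pairs.\<close>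

definition hfrac ::
    "nat \<Rightarrow> (nat \<Rightarrow> nat) \<Rightarrow> ('k::field mpoly, 'm) graded_module \<Rightarrow> 'k mpoly set
      \<Rightarrow> 'm \<Rightarrow> 'k mpoly \<Rightarrow> ('m \<times> 'k mpoly) set" where
  "hfrac r n M P m f =
    {(m', f'). \<exists>b\<in>degrees r. m' \<in> hpart M b \<and> f' \<in> cox_part r n b - P \<and>
       (\<exists>t\<in>homogeneous r n - P. t \<odot>\<^bsub>M\<^esub> (f' \<odot>\<^bsub>M\<^esub> m) = t \<odot>\<^bsub>M\<^esub> (f \<odot>\<^bsub>M\<^esub> m'))}"

definition stalk ::
    "nat \<Rightarrow> (nat \<Rightarrow> nat) \<Rightarrow> ('k::field mpoly, 'm) graded_module \<Rightarrow> 'k mpoly set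
      \<Rightarrow> (('k mpoly \<times> 'k mpoly) set, ('m \<times> 'k mpoly) set) module" where
  "stalk r n M P =
    \<lparr>carrier = {hfrac r n M P m f | m f. \<exists>a\<in>degrees r. m \<in> hpart M a \<and> f \<in> cox_part r n a - P},
     mult = undefined, one = undefined,
     zero = hfrac r n M P \<zero>\<^bsub>M\<^esub> 1,
     add = (\<lambda>c c'. \<Union>(m, f)\<in>c. \<Union>(m', f')\<in>c'.
              hfrac r n M P ((f' \<odot>\<^bsub>M\<^esub> m) \<oplus>\<^bsub>M\<^esub> (f \<odot>\<^bsub>M\<^esub> m')) (f * f')),
     smult = (\<lambda>c c'. \<Union>(g, h)\<in>c. \<Union>(m, f)\<in>c'. hfrac r n M P (g \<odot>\<^bsub>M\<^esub> m) (h * f))\<rparr>"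

text \<open>Sections over an open set \<open>U\<close> are functions from \<open>U\<close> to the stalks which are locally given by
  one fraction; the restriction maps of the sheaf are the restrictions of functions.\<close>

definition tilde ::
    "nat \<Rightarrow> (nat \<Rightarrow> nat) \<Rightarrow> ('k::field mpoly, 'm) graded_module \<Rightarrow> 'k mpoly set set
      \<Rightarrow> ('k mpoly set \<Rightarrow> ('k mpoly \<times> 'k mpoly) set, 'k mpoly set \<Rightarrow> ('m \<times> 'k mpoly) set) module" where
  "tilde r n M U =
    \<lparr>carrier = {s \<in> extensional U. \<forall>P\<in>U. \<exists>W. openin (zariski r n) W \<and> P \<in> W \<and> W \<subseteq> U \<and>
        (\<exists>a\<in>degrees r. \<exists>m\<in>hpart M a. \<exists>f\<in>cox_part r n a.
          \<forall>P'\<in>W. f \<notin> P' \<and> s P' = hfrac r n M P' m f)},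
     mult = undefined, one = undefined,
     zero = (\<lambda>P\<in>U. \<zero>\<^bsub>stalk r n M P\<^esub>),
     add = (\<lambda>s t. \<lambda>P\<in>U. s P \<oplus>\<^bsub>stalk r n M P\<^esub> t P),
     smult = (\<lambda>c s. \<lambda>P\<in>U. c P \<odot>\<^bsub>stalk r n M P\<^esub> s P)\<rparr>"

abbreviation structure_sheaf ::
    "nat \<Rightarrow> (nat \<Rightarrow> nat) \<Rightarrow> 'k::field mpoly set set
      \<Rightarrow> ('k mpoly set \<Rightarrow> ('k mpoly \<times> 'k mpoly) set, 'k mpoly set \<Rightarrow> ('k mpoly \<times> 'k mpoly) set) module" where
  "structure_sheaf r n \<equiv> tilde r n (cox_module r n)"

text \<open>The map \<open>m/f \<mapsto> d(m)/f\<close> on sections induced by a homomorphism \<open>d\<close> into \<open>N\<close>.\<close>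

definition tilde_map ::
    "nat \<Rightarrow> (nat \<Rightarrow> nat) \<Rightarrow> ('k::field mpoly, 'b) graded_module \<Rightarrow> ('a \<Rightarrow> 'b) \<Rightarrow> 'k mpoly set set
      \<Rightarrow> ('k mpoly set \<Rightarrow> ('a \<times> 'k mpoly) set) \<Rightarrow> 'k mpoly set \<Rightarrow> ('b \<times> 'k mpoly) set" where
  "tilde_map r n N d U s = (\<lambda>P\<in>U. \<Union>(m, f)\<in>s P. hfrac r n N P (d m) f)"

section \<open>Sheaves of modules\<close>

text \<open>A sheaf of modules on \<open>T\<close> is a function assigning to each open set the module of sections; sections
  are functions on that open set, and restriction is restriction of functions.\<close>

definition sheaf_hom ::
    "'p topology \<Rightarrow> ('p set \<Rightarrow> ('q, 'o) module) \<Rightarrow> ('p set \<Rightarrow> ('o, 'p \<Rightarrow> 'a) module)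
      \<Rightarrow> ('p set \<Rightarrow> ('o, 'p \<Rightarrow> 'b) module) \<Rightarrow> ('p set \<Rightarrow> ('p \<Rightarrow> 'a) \<Rightarrow> ('p \<Rightarrow> 'b)) \<Rightarrow> bool" where
  "sheaf_hom T \<O> F G \<phi> \<longleftrightarrow> (\<forall>U. openin T U \<longrightarrow>
    \<phi> U \<in> carrier (F U) \<rightarrow> carrier (G U) \<and>
    (\<forall>s\<in>carrier (F U). \<forall>t\<in>carrier (F U). \<phi> U (s \<oplus>\<^bsub>F U\<^esub> t) = \<phi> U s \<oplus>\<^bsub>G U\<^esub> \<phi> U t) \<and>
    (\<forall>c\<in>carrier (\<O> U). \<forall>s\<in>carrier (F U). \<phi> U (c \<odot>\<^bsub>F U\<^esub> s) = c \<odot>\<^bsub>G U\<^esub> \<phi> U s) \<and>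
    (\<forall>W. openin T W \<and> W \<subseteq> U \<longrightarrow>
      (\<forall>s\<in>carrier (F U). \<phi> W (restrict s W) = restrict (\<phi> U s) W)))"

definition locally_in_image ::
    "'p topology \<Rightarrow> ('p set \<Rightarrow> ('o, 'p \<Rightarrow> 'a) module) \<Rightarrow> ('p set \<Rightarrow> ('p \<Rightarrow> 'a) \<Rightarrow> ('p \<Rightarrow> 'b))
      \<Rightarrow> 'p set \<Rightarrow> ('p \<Rightarrow> 'b) \<Rightarrow> bool" where
  "locally_in_image T F \<phi> U s \<longleftrightarrow>
    (\<forall>P\<in>U. \<exists>W. openin T W \<and> P \<in> W \<and> W \<subseteq> U \<and> restrict s W \<in> \<phi> W ` carrier (F W))"

text \<open>Exactness of \<open>F \<rightarrow> G \<rightarrow> H\<close> at \<open>G\<close>: the kernel of \<open>\<psi>\<close> is the image sheaf of \<open>\<phi>\<close>.\<close>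

definition sheaf_exact ::
    "'p topology \<Rightarrow> ('p set \<Rightarrow> ('o, 'p \<Rightarrow> 'a) module) \<Rightarrow> ('p set \<Rightarrow> ('o, 'p \<Rightarrow> 'b) module)
      \<Rightarrow> ('p set \<Rightarrow> ('o, 'p \<Rightarrow> 'c) module) \<Rightarrow> ('p set \<Rightarrow> ('p \<Rightarrow> 'a) \<Rightarrow> ('p \<Rightarrow> 'b))
      \<Rightarrow> ('p set \<Rightarrow> ('p \<Rightarrow> 'b) \<Rightarrow> ('p \<Rightarrow> 'c)) \<Rightarrow> bool" where
  "sheaf_exact T F G H \<phi> \<psi> \<longleftrightarrow> (\<forall>U. openin T U \<longrightarrow> (\<forall>s\<in>carrier (G U).
     \<psi> U s = \<zero>\<^bsub>H U\<^esub> \<longleftrightarrow> locally_in_image T F \<phi> U s))"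

definition sheaf_surjective ::
    "'p topology \<Rightarrow> ('p set \<Rightarrow> ('o, 'p \<Rightarrow> 'a) module) \<Rightarrow> ('p set \<Rightarrow> ('o, 'p \<Rightarrow> 'b) module)
      \<Rightarrow> ('p set \<Rightarrow> ('p \<Rightarrow> 'a) \<Rightarrow> ('p \<Rightarrow> 'b)) \<Rightarrow> bool" where
  "sheaf_surjective T F G \<phi> \<longleftrightarrow> (\<forall>U. openin T U \<longrightarrow>
     (\<forall>s\<in>carrier (G U). locally_in_image T F \<phi> U s))"

text \<open>Locally free of finite rank: near each point there are sections \<open>e\<^sub>0, \<dots>, e\<^bsub>N-1\<^esub>\<close> which induce an
  isomorphism from the \<open>N\<close>-fold direct sum of \<open>\<O>\<close>.\<close>

definition locally_free ::
    "'p topology \<Rightarrow> ('p set \<Rightarrow> ('q, 'o) module) \<Rightarrow> ('p set \<Rightarrow> ('o, 'p \<Rightarrow> 'a) module) \<Rightarrow> bool" where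
  "locally_free T \<O> F \<longleftrightarrow> (\<forall>P\<in>topspace T. \<exists>U N. \<exists>e :: nat \<Rightarrow> 'p \<Rightarrow> 'a.
     openin T U \<and> P \<in> U \<and> (\<forall>k<N. e k \<in> carrier (F U)) \<and>
     (\<forall>W. openin T W \<and> W \<subseteq> U \<longrightarrow> (\<forall>s\<in>carrier (F W).
       \<exists>!c. c \<in> {..<N} \<rightarrow>\<^sub>E carrier (\<O> W) \<and>
            s = finsum (F W) (\<lambda>k. c k \<odot>\<^bsub>F W\<^esub> restrict (e k) W) {..<N})))"

section \<open>Virtual resolutions\<close>

text \<open>The complex \<open>F\<^sub>0 \<leftarrow> F\<^sub>1 \<leftarrow> \<dots> \<leftarrow> F\<^sub>p \<leftarrow> 0\<close> is given by the twists \<open>a i\<close> of \<open>F\<^sub>i\<close> (empty for \<open>i > p\<close>, so that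
  \<open>F\<^sub>i = 0\<close>) and the differentials \<open>d i : F\<^bsub>i+1\<^esub> \<rightarrow> F\<^sub>i\<close>. The augmentation \<open>\<epsilon>\<close> is a morphism of sheaves,
  not required to come from a map of \<open>F\<^sub>0\<close> to \<open>S/I\<close>.\<close>

definition virtual_resolution ::
    "nat \<Rightarrow> (nat \<Rightarrow> nat) \<Rightarrow> 'k::field mpoly set \<Rightarrow> nat \<Rightarrow> (nat \<Rightarrow> (nat \<Rightarrow> int) list)
      \<Rightarrow> (nat \<Rightarrow> (nat \<Rightarrow> 'k mpoly) \<Rightarrow> (nat \<Rightarrow> 'k mpoly)) \<Rightarrow> bool" where
  "virtual_resolution r n I p a d \<longleftrightarrow>
    (let T = zariski r n; \<O> = structure_sheaf r n;
         F = (\<lambda>i. free_module r n (a i) :: ('k mpoly, nat \<Rightarrow> 'k mpoly) graded_module);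
         F\<^sub>s = (\<lambda>i. tilde r n (F i)); d\<^sub>s = (\<lambda>i. tilde_map r n (F i) (d i));
         Q\<^sub>s = tilde r n (quotient_module r n I)
     in (\<forall>i. set (a i) \<subseteq> degrees r) \<and> (\<forall>i>p. a i = []) \<and>
        (\<forall>i. graded_hom r n (F (Suc i)) (F i) (d i)) \<and>
        (\<forall>i. \<forall>v\<in>carrier (F (Suc (Suc i))). d i (d (Suc i) v) = \<zero>\<^bsub>F i\<^esub>) \<and>
        (\<forall>i. locally_free T \<O> (F\<^sub>s i)) \<and>
        (\<forall>i. sheaf_exact T (F\<^sub>s (Suc (Suc i))) (F\<^sub>s (Suc i)) (F\<^sub>s i) (d\<^sub>s (Suc i)) (d\<^sub>s i)) \<and>
        (\<exists>\<epsilon>. sheaf_hom T \<O> (F\<^sub>s 0) Q\<^sub>s \<epsilon> \<and> sheaf_surjective T (F\<^sub>s 0) Q\<^sub>s \<epsilon> \<and>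
             sheaf_exact T (F\<^sub>s (Suc 0)) (F\<^sub>s 0) Q\<^sub>s (d\<^sub>s 0) \<epsilon>))"

end

theory Submission
  imports Defs "HOL-Library.Product_Lexorder" "HOL-Library.Function_Algebras"
begin

text \<open>
  The proof compares the length of the resolution with the height of \<open>Q\<close>. Since \<open>I\<close> is a squarefree
  monomial ideal, \<open>Q\<close> is generated by the set \<open>X\<close> of variables that it contains, and some
  homogeneous element outside \<open>Q\<close> (the product of all the other variables) multiplies each variable
  of \<open>X\<close> into \<open>I\<close> (\<open>associated_prime_stanley_reisner\<close>). As \<open>Q\<close> does not contain the irrelevant ideal,
  it is a point of the product of projective spaces, and the stalk of \<open>(S/I)\<^sup>~\<close> at this point is the
  residue field: the variables in \<open>X\<close> kill it.

  The sheaf complex is exact at the point \<open>Q\<close>, so it gives there a free resolution of length \<open>p\<close>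
  of a nonzero module that is killed by a regular sequence with \<open>card X\<close> members. Such a resolution has
  length at least \<open>card X\<close> (\<open>length_ge\<close>), whence \<open>card X \<le> p\<close> (\<open>card_le_length\<close>). This is the
  statement that the residue field of a regular local ring has projective dimension at least the
  dimension of the ring. The argument for it divides out the members of the sequence one after the
  other, and each time passes to the next syzygy.

  For the passage from sheaves to modules, no localization is formed. A statement about stalks is
  replaced by the same statement up to multiplication by a homogeneous element outside \<open>Q\<close>
  (\<open>stalk_exact\<close>, \<open>augmentation_generator\<close>), and it is extended from homogeneous elements to all
  elements by splitting them into homogeneous components (\<open>virtual_resolution_stalk\<close>).

  On the side of dimensions, \<open>V(Q) \<subseteq> V(I)\<close> gives \<open>dim V(Q) \<le> dim V(I)\<close>. Adding to \<open>X\<close> one variable at a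
  time, as long as one variable of each factor is left out, gives a chain of irreducible closed
  subsets that shows \<open>dim V(Q) \<ge> |n| - card X\<close> (\<open>dim_V_var_ideal_ge\<close>). Together
  \<open>|n| - p \<le> |n| - card X \<le> dim V(Q) \<le> dim V(I) = |n| - p\<close>.
\<close>

section \<open>The length of a resolution of a module killed by a regular sequence\<close>

text \<open>In the application, \<open>C\<close> is the Cox ring inside the ring of polynomials in infinitely many variables,
  the \<open>F i\<close> are free modules over it, and \<open>S\<close> consists of the homogeneous elements outside a prime ideal.
  Statements about the localization at \<open>S\<close> are expressed by allowing a multiplier from \<open>S\<close>.\<close>

locale localized_complex =
  Modules.module scale for scale :: "'a::comm_ring_1 \<Rightarrow> 'm::ab_group_add \<Rightarrow> 'm" (infixr \<open>*s\<close> 75) +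
  fixes C S :: "'a set" and F :: "nat \<Rightarrow> 'm set" and d :: "nat \<Rightarrow> 'm \<Rightarrow> 'm"
    and h :: nat and x :: "nat \<Rightarrow> 'a"
  assumes ring_add: "\<And>f g. f \<in> C \<Longrightarrow> g \<in> C \<Longrightarrow> f + g \<in> C"
    and ring_uminus: "\<And>f. f \<in> C \<Longrightarrow> - f \<in> C"
    and denominators: "S \<subseteq> C" "1 \<in> S" "\<And>s t. s \<in> S \<Longrightarrow> t \<in> S \<Longrightarrow> s * t \<in> S"
    and x_in: "\<And>k. k < h \<Longrightarrow> x k \<in> C"
    and F_zero: "\<And>i. 0 \<in> F i"
    and F_add: "\<And>i u v. u \<in> F i \<Longrightarrow> v \<in> F i \<Longrightarrow> u + v \<in> F i"
    and F_scale: "\<And>i f u. f \<in> C \<Longrightarrow> u \<in> F i \<Longrightarrow> f *s u \<in> F i"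
    and d_in: "\<And>i u. u \<in> F (Suc i) \<Longrightarrow> d i u \<in> F i"
    and d_add: "\<And>i u v. u \<in> F (Suc i) \<Longrightarrow> v \<in> F (Suc i) \<Longrightarrow> d i (u + v) = d i u + d i v"
    and d_scale: "\<And>i f u. f \<in> C \<Longrightarrow> u \<in> F (Suc i) \<Longrightarrow> d i (f *s u) = f *s d i u"
    and d_d: "\<And>i u. u \<in> F (Suc (Suc i)) \<Longrightarrow> d i (d (Suc i) u) = 0"
begin

text \<open>\<open>J k i\<close> is the submodule \<open>(x 0, \<dots>, x (k - 1)) F i\<close>.\<close>

primrec J :: "nat \<Rightarrow> nat \<Rightarrow> 'm set" where
  "J 0 i = {0}"
| "J (Suc k) i = {x k *s g + v | g v. g \<in> F i \<and> v \<in> J k i}"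

text \<open>\<open>L k i\<close> contains the elements whose class in \<open>F i / J k i\<close> becomes a boundary after localization at \<open>S\<close>.\<close>

definition L :: "nat \<Rightarrow> nat \<Rightarrow> 'm set" where
  "L k i = {u. \<exists>s\<in>S. \<exists>w\<in>F (Suc i). \<exists>v\<in>J k i. s *s u = d i w + v}"

lemma F_uminus: "u \<in> F i \<Longrightarrow> - u \<in> F i"
  using F_scale[of "- 1" u i] ring_uminus denominators by auto

lemma F_diff: "u \<in> F i \<Longrightarrow> v \<in> F i \<Longrightarrow> u - v \<in> F i"
  using F_add[of u i "- v"] F_uminus by simp

lemma d_diff: "u \<in> F (Suc i) \<Longrightarrow> v \<in> F (Suc i) \<Longrightarrow> d i (u - v) = d i u - d i v"
  by (metis F_diff d_add diff_add_cancel eq_diff_eq)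

lemma d_zero: "d i 0 = 0"
  using d_diff[OF F_zero F_zero, of i] by simp

lemma J_subset: "k \<le> h \<Longrightarrow> J k i \<subseteq> F i"
  by (induction k) (auto simp: F_zero intro!: F_add F_scale x_in)

lemma J_SucI: "u = x k *s g + v \<Longrightarrow> g \<in> F i \<Longrightarrow> v \<in> J k i \<Longrightarrow> u \<in> J (Suc k) i"
  by auto

lemma J_zero: "0 \<in> J k i"
  by (induction k) (auto simp del: J.simps(2) intro: J_SucI[where g = 0] simp: F_zero)

lemma J_add: "u \<in> J k i \<Longrightarrow> v \<in> J k i \<Longrightarrow> u + v \<in> J k i"
proof (induction k arbitrary: u v)
  case (Suc k)
  then obtain g a g' a' where *: "u = x k *s g + a" "v = x k *s g' + a'" "g \<in> F i" "g' \<in> F i"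
    "a \<in> J k i" "a' \<in> J k i" by auto
  then have "u + v = x k *s (g + g') + (a + a')" by (simp add: scale_right_distrib)
  from J_SucI[OF this] show ?case using * Suc.IH F_add by auto
qed simp

lemma J_scale: "f \<in> C \<Longrightarrow> v \<in> J k i \<Longrightarrow> f *s v \<in> J k i"
proof (induction k arbitrary: v)
  case (Suc k)
  then obtain g a where *: "v = x k *s g + a" "g \<in> F i" "a \<in> J k i" by auto
  then have "f *s v = x k *s (f *s g) + f *s a" by (simp add: scale_right_distrib mult.commute)
  from J_SucI[OF this] show ?case using * Suc.IH Suc.prems F_scale by auto
qed simp

lemma J_uminus: "v \<in> J k i \<Longrightarrow> - v \<in> J k i"
  using J_scale[of "- 1" v k i] ring_uminus denominators by auto

lemma J_diff: "u \<in> J k i \<Longrightarrow> v \<in> J k i \<Longrightarrow> u - v \<in> J k i"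
  using J_add[of u k i "- v"] J_uminus by simp

lemma d_J: "k \<le> h \<Longrightarrow> v \<in> J k (Suc i) \<Longrightarrow> d i v \<in> J k i"
proof (induction k arbitrary: v)
  case 0 then show ?case by (simp add: d_zero)
next
  case (Suc k)
  then obtain g a where *: "v = x k *s g + a" "g \<in> F (Suc i)" "a \<in> J k (Suc i)" by auto
  then have "d i v = x k *s d i g + d i a"
    using Suc.prems J_subset[of k "Suc i"] by (subst *(1), subst d_add) (auto simp: d_scale x_in F_scale)
  from J_SucI[OF this] show ?case using * Suc.IH Suc.prems d_in by auto
qed

lemma L_I: "s \<in> S \<Longrightarrow> w \<in> F (Suc i) \<Longrightarrow> v \<in> J k i \<Longrightarrow> s *s u = d i w + v \<Longrightarrow> u \<in> L k i"
  unfolding L_def by blast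

text \<open>Let \<open>M\<close> be the localized cokernel of \<open>d 0\<close>. By \<open>socle\<close> it has a nonzero element that is killed by the
  regular sequence \<open>x 0, \<dots>, x (h - 1)\<close>. Dividing the complex by \<open>x 0\<close> and removing \<open>F 0\<close> gives a
  resolution of \<open>K / x 0 K\<close>, where \<open>K\<close> is the image of \<open>d 0\<close>; if \<open>u\<close> represents the given element of
  \<open>M\<close>, then \<open>x 0 u\<close> lies in \<open>K\<close>, is nonzero modulo \<open>x 0 K\<close>, and the rest of the sequence kills it there.
  Iteration gives, for each \<open>k \<le> h\<close>, an element of \<open>F k\<close> that is not zero modulo \<open>J k k\<close>
  and boundaries. So \<open>F h\<close> is not zero.\<close>

lemma length_ge:
  assumes regular: "\<And>i k u. k < h \<Longrightarrow> u \<in> F i \<Longrightarrow> x k *s u \<in> J k i \<Longrightarrow> u \<in> J k i"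
    and exact: "\<And>i u. u \<in> F (Suc i) \<Longrightarrow> d i u = 0 \<Longrightarrow> u \<in> L 0 (Suc i)"
    and socle: "u\<^sub>0 \<in> F 0" "u\<^sub>0 \<notin> L 0 0" "\<And>k. k < h \<Longrightarrow> x k *s u\<^sub>0 \<in> L 0 0"
    and bounded: "\<And>i. i > p \<Longrightarrow> F i = {0}"
  shows "h \<le> p"
proof -
  \<comment> \<open>Modulo the first k members of the sequence, the complex stays exact from F (k + 1) on.\<close>
  have ex: "u \<in> L k (Suc i)" if "k \<le> h" "k \<le> i" "u \<in> F (Suc i)" "d i u \<in> J k i" for k i u
    using that
  proof (induction k arbitrary: i u)
    case 0 then show ?case using exact by simp
  next
    case (Suc k)
    then obtain i' where i: "i = Suc i'" "k \<le> i'" by (cases i) auto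
    from Suc.prems obtain g j where g: "d i u = x k *s g + j" "g \<in> F i" "j \<in> J k i" by auto
    have xk: "x k \<in> C" and kh: "k < h" "k \<le> h" using x_in Suc.prems by auto
    have jF: "j \<in> F i" using g J_subset[OF kh(2)] by auto
    \<comment> \<open>Regularity of x k moves the cycle condition from x k g to g, and exactness modulo J k applies to g.\<close>
    have "0 = d i' (d i u)" using d_d Suc.prems i by simp
    also have "\<dots> = x k *s d i' g + d i' j"
      unfolding g(1) using g jF xk by (simp add: i d_add d_scale F_scale)
    finally have "x k *s d i' g = - d i' j" by (simp add: eq_neg_iff_add_eq_0)
    then have "x k *s d i' g \<in> J k i'" using d_J[OF kh(2)] g i J_uminus by auto
    then have "d i' g \<in> J k i'" using regular[OF kh(1)] d_in g i by simp
    then have "g \<in> L k i" using Suc.IH[OF kh(2) i(2)] g i by simp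
    then obtain s w j2 where s: "s \<in> S" "w \<in> F (Suc i)" "j2 \<in> J k i" "s *s g = d i w + j2"
      by (auto simp: L_def)
    have sC: "s \<in> C" using s denominators by auto
    \<comment> \<open>Subtracting the lift w of g turns s u into a cycle modulo J k.\<close>
    let ?z = "s *s u - x k *s w"
    have z: "?z \<in> F (Suc i)" using s sC xk Suc.prems by (simp add: F_diff F_scale)
    have "d i ?z = s *s d i u - x k *s d i w"
      using s sC xk Suc.prems by (simp add: d_diff d_scale F_scale)
    also have "\<dots> = x k *s (s *s g - d i w) + s *s j"
      by (simp add: g(1) scale_right_distrib scale_right_diff_distrib mult.commute)
    also have "\<dots> = x k *s j2 + s *s j" by (simp add: s)
    finally have "d i ?z \<in> J k i" using s g sC xk by (simp add: J_add J_scale)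
    then have "?z \<in> L k (Suc i)" using Suc.IH[OF kh(2) _ z] Suc.prems by simp
    then obtain t w2 j3 where t: "t \<in> S" "w2 \<in> F (Suc (Suc i))" "j3 \<in> J k (Suc i)"
      "t *s ?z = d (Suc i) w2 + j3" by (auto simp: L_def)
    have tC: "t \<in> C" using t denominators by auto
    have "(t * s) *s u = t *s ?z + x k *s (t *s w)"
      by (simp add: scale_right_diff_distrib mult.commute)
    also have "\<dots> = d (Suc i) w2 + (x k *s (t *s w) + j3)" by (simp add: t)
    finally show ?case
      by (rule L_I[OF denominators(3)[OF t(1) s(1)] t(2) J_SucI[OF refl F_scale[OF tC s(2)] t(3)]])
  qed
  \<comment> \<open>The next element w is a lift of x k u through d k.\<close>
  have "\<exists>u\<in>F k. u \<notin> L k k \<and> (\<forall>v. k \<le> v \<and> v < h \<longrightarrow> x v *s u \<in> L k k)" if "k \<le> h" for k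
    using that
  proof (induction k)
    case 0 then show ?case using socle by auto
  next
    case (Suc k)
    then obtain u where u: "u \<in> F k" "u \<notin> L k k" "\<And>v. k \<le> v \<Longrightarrow> v < h \<Longrightarrow> x v *s u \<in> L k k"
      by auto
    have xk: "x k \<in> C" and kh: "k < h" "k \<le> h" using x_in Suc.prems by auto
    from u(3)[of k] kh obtain s w j where
      s: "s \<in> S" "w \<in> F (Suc k)" "j \<in> J k k" "s *s x k *s u = d k w + j" by (auto simp: L_def)
    have sC: "s \<in> C" using s denominators by auto
    have dw: "d k w = x k *s s *s u - j" using s(4) by (simp add: eq_diff_eq mult.commute)
    \<comment> \<open>If w were a boundary modulo J (k + 1), then x k could be cancelled and u would be a boundary modulo J k.\<close>
    have "w \<notin> L (Suc k) (Suc k)"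
    proof
      assume "w \<in> L (Suc k) (Suc k)"
      then obtain t w' g j' where t: "t \<in> S" "w' \<in> F (Suc (Suc k))" "g \<in> F (Suc k)"
        "j' \<in> J k (Suc k)" "t *s w = d (Suc k) w' + (x k *s g + j')" by (auto simp: L_def)
      have tC: "t \<in> C" using t denominators by auto
      have j'F: "j' \<in> F (Suc k)" using t J_subset[OF kh(2)] by auto
      have "t *s d k w = d k (t *s w)" using s tC by (simp add: d_scale)
      also have "\<dots> = x k *s d k g + d k j'"
        using t j'F xk d_in by (simp add: d_add d_scale F_scale F_add d_d)
      finally have "t *s (x k *s s *s u - j) = x k *s d k g + d k j'"
        unfolding dw .
      then have "x k *s (t *s s *s u) - t *s j = x k *s d k g + d k j'"
        by (simp only: scale_right_diff_distrib scale_left_commute)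
      then have "x k *s (t *s s *s u - d k g) = t *s j + d k j'"
        by (simp only: scale_right_diff_distrib) (simp add: algebra_simps del: scale_scale)
      also have "\<dots> \<in> J k k" using s t tC kh by (simp add: J_add J_scale d_J)
      finally have "t *s s *s u - d k g \<in> J k k"
        by (rule regular[OF kh(1) F_diff[OF F_scale[OF tC F_scale[OF sC u(1)]] d_in[OF t(3)]]])
      then have "u \<in> L k k"
        using s t denominators by (intro L_I[of "t * s" g k "t *s s *s u - d k g"]) auto
      then show False using u by simp
    qed
    moreover have "x v *s w \<in> L (Suc k) (Suc k)" if v: "Suc k \<le> v" "v < h" for v
    proof -
      obtain t wv jv where t: "t \<in> S" "wv \<in> F (Suc k)" "jv \<in> J k k" "t *s x v *s u = d k wv + jv"
        using u(3)[of v] v by (auto simp: L_def)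
      have tC: "t \<in> C" and xv: "x v \<in> C" using t denominators x_in v by auto
      \<comment> \<open>Both x v w and x k wv are lifts of x v x k u, up to multipliers, so they differ by a cycle modulo J k.\<close>
      let ?z = "(t * x v) *s w - (s * x k) *s wv"
      have z1: "t *s x v *s w \<in> F (Suc k)" "s *s x k *s wv \<in> F (Suc k)"
        by (intro F_scale tC sC xk xv s(2) t(2))+
      then have z: "?z \<in> F (Suc k)" using F_diff by simp
      have "d k ?z = t *s x v *s d k w - s *s x k *s d k wv"
        using z1 tC sC xk xv s t by (simp add: d_diff d_scale F_scale flip: scale_scale)
      also have "d k wv = t *s x v *s u - jv" using t by simp
      also have "t *s x v *s d k w - s *s x k *s (t *s x v *s u - jv) = s *s x k *s jv - t *s x v *s j"
        by (simp add: dw scale_right_diff_distrib ac_simps)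
      also have "\<dots> \<in> J k k" by (intro J_diff J_scale sC xk tC xv s t)
      finally have "?z \<in> L k (Suc k)" using ex[OF kh(2) _ z] by simp
      then obtain q w2 j3 where q: "q \<in> S" "w2 \<in> F (Suc (Suc k))" "j3 \<in> J k (Suc k)"
        "q *s ?z = d (Suc k) w2 + j3" by (auto simp: L_def)
      have qC: "q \<in> C" using q denominators by auto
      have "(q * t) *s x v *s w = q *s ?z + x k *s (q *s s *s wv)"
        by (simp add: scale_right_diff_distrib ac_simps)
      also have "\<dots> = d (Suc k) w2 + (x k *s (q *s s *s wv) + j3)" by (simp add: q)
      finally show ?thesis
        by (rule L_I[OF denominators(3)[OF q(1) t(1)] q(2)
              J_SucI[OF refl F_scale[OF qC F_scale[OF sC t(2)]] q(3)]])
    qed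
    ultimately show ?case using s by blast
  qed
  from this[of h] obtain u where u: "u \<in> F h" "u \<notin> L h h" by auto
  moreover have "0 \<in> L h h" 
    using denominators F_zero J_zero by (intro L_I[of 1 0 h 0]) (auto simp: d_zero)
  ultimately have "F h \<noteq> {0}" by auto
  then show ?thesis using bounded not_le by blast
qed
end

section \<open>Polynomials in the Cox ring\<close>

lemma keys_add_nat: "Poly_Mapping.keys (m + m' :: 'v \<Rightarrow>\<^sub>0 nat) = Poly_Mapping.keys m \<union> Poly_Mapping.keys m'"
  by (auto simp: in_keys_iff lookup_add)

lemma lookup_single_times:
  fixes f :: "('v \<Rightarrow>\<^sub>0 nat) \<Rightarrow>\<^sub>0 'k::field"
  shows "Poly_Mapping.lookup (Poly_Mapping.single m c * f) (m + k) = c * Poly_Mapping.lookup f k"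
  by (simp add: lookup_mult lookup_single when_mult)

lemma keys_single_times:
  fixes f :: "('v \<Rightarrow>\<^sub>0 nat) \<Rightarrow>\<^sub>0 'k::field"
  assumes "c \<noteq> 0"
  shows "Poly_Mapping.keys (Poly_Mapping.single m c * f) = (+) m ` Poly_Mapping.keys f"
proof
  show "Poly_Mapping.keys (Poly_Mapping.single m c * f) \<subseteq> (+) m ` Poly_Mapping.keys f"
    using keys_mult[of "Poly_Mapping.single m c" f] by (auto split: if_splits)
  show "(+) m ` Poly_Mapping.keys f \<subseteq> Poly_Mapping.keys (Poly_Mapping.single m c * f)"
    using assms by (auto simp: in_keys_iff lookup_single_times)
qed

text \<open>The sum of the terms of \<open>f\<close> whose monomials lie in \<open>A\<close>.\<close>

definition mon_part :: "'m set \<Rightarrow> ('m \<Rightarrow>\<^sub>0 'k::zero) \<Rightarrow> 'm \<Rightarrow>\<^sub>0 'k" where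
  "mon_part A f = Poly_Mapping.mapp (\<lambda>m c. if m \<in> A then c else 0) f"

lemma lookup_mon_part: "Poly_Mapping.lookup (mon_part A f) m = (if m \<in> A then Poly_Mapping.lookup f m else 0)"
  by (auto simp: mon_part_def lookup_mapp when_def in_keys_iff)

lemma keys_mon_part: "Poly_Mapping.keys (mon_part A f) = Poly_Mapping.keys f \<inter> A"
  by (auto simp: in_keys_iff lookup_mon_part split: if_splits)

lemma mon_part_add: "mon_part A (f + g) = mon_part A f + mon_part A (g :: 'm \<Rightarrow>\<^sub>0 'k::monoid_add)"
  by (rule poly_mapping_eqI) (simp add: lookup_mon_part lookup_add)

lemma mon_part_0: "mon_part A 0 = 0"
  by (rule poly_mapping_eqI) (simp add: lookup_mon_part)

lemma mon_part_Compl: "mon_part A f + mon_part (- A) f = (f :: 'm \<Rightarrow>\<^sub>0 'k::monoid_add)"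
  by (rule poly_mapping_eqI) (simp add: lookup_mon_part lookup_add)

lemma sum_monomials:
  "f = (\<Sum>m\<in>Poly_Mapping.keys f. Poly_Mapping.single m (Poly_Mapping.lookup f m))"
  by (rule poly_mapping_eqI)
    (simp add: lookup_sum lookup_single when_def in_keys_iff sum.delta)

lemma in_cox_ring:
  "f \<in> carrier (cox_ring r n) \<longleftrightarrow> (\<forall>m\<in>Poly_Mapping.keys f. Poly_Mapping.keys m \<subseteq> cox_vars r n)"
  by (simp add: cox_ring_def)

lemma cox_ring_simps [simp]:
  "mult (cox_ring r n) = (*)" "one (cox_ring r n) = 1" "zero (cox_ring r n) = 0"
  "add (cox_ring r n) = (+)"
  by (simp_all add: cox_ring_def)

lemma finite_cox_vars: "finite (cox_vars r n)"
  by (simp add: cox_vars_def)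

lemma cox_ring_closed:
  "0 \<in> carrier (cox_ring r n)" "1 \<in> carrier (cox_ring r n)"
  "f \<in> carrier (cox_ring r n) \<Longrightarrow> g \<in> carrier (cox_ring r n) \<Longrightarrow> f + g \<in> carrier (cox_ring r n)"
  "f \<in> carrier (cox_ring r n) \<Longrightarrow> g \<in> carrier (cox_ring r n) \<Longrightarrow> f * g \<in> carrier (cox_ring r n)"
  "f \<in> carrier (cox_ring r n) \<Longrightarrow> - f \<in> carrier (cox_ring r n)"
  "f \<in> carrier (cox_ring r n) \<Longrightarrow> mon_part A f \<in> carrier (cox_ring r n)"
  "Poly_Mapping.keys m \<subseteq> cox_vars r n \<Longrightarrow> Poly_Mapping.single m c \<in> carrier (cox_ring r n)"
  subgoal by (simp add: in_cox_ring)
  subgoal by (simp add: in_cox_ring)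
  subgoal using keys_add[of f g] by (fastforce simp: in_cox_ring)
  subgoal using keys_mult[of f g] by (fastforce simp: in_cox_ring keys_add_nat)
  subgoal by (simp add: in_cox_ring in_keys_iff)
  subgoal by (auto simp: in_cox_ring keys_mon_part)
  subgoal by (auto simp: in_cox_ring)
  done

lemma cox_var_closed: "v \<in> cox_vars r n \<Longrightarrow> cox_var v \<in> carrier (cox_ring r n)"
  by (simp add: cox_var_def cox_ring_closed)

lemma keys_cox_var: "Poly_Mapping.keys (cox_var v :: 'k::field mpoly) = {Poly_Mapping.single v 1}"
  by (simp add: cox_var_def)

lemma cring_cox_ring: "cring (cox_ring r n :: 'k::field mpoly ring)"
proof (rule cringI)
  show "abelian_group (cox_ring r n :: 'k mpoly ring)"
    by (rule abelian_groupI) (auto simp: cox_ring_closed ac_simps intro: exI[of _ "- _"] bexI[of _ "- _"])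
  show "Group.comm_monoid (cox_ring r n :: 'k mpoly ring)"
    by (rule comm_monoidI) (auto simp: cox_ring_closed ac_simps)
qed (simp add: cox_ring_closed distrib_right)

lemma ring_cox_ring: "ring (cox_ring r n :: 'k::field mpoly ring)"
  using cring_cox_ring cring.axioms(1) by blast

lemma ideal_closed:
  assumes "ideal I (cox_ring r n)"
  shows "I \<subseteq> carrier (cox_ring r n)" "0 \<in> I"
    "f \<in> I \<Longrightarrow> g \<in> I \<Longrightarrow> f + g \<in> I"
    "f \<in> I \<Longrightarrow> g \<in> carrier (cox_ring r n) \<Longrightarrow> g * f \<in> I"
    "f \<in> I \<Longrightarrow> g \<in> carrier (cox_ring r n) \<Longrightarrow> f * g \<in> I"
proof -
  interpret ideal I "cox_ring r n" by fact
  show "I \<subseteq> carrier (cox_ring r n)" by (rule a_subset)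
  show "0 \<in> I" using additive_subgroup.zero_closed[OF additive_subgroup_axioms] by simp
  show "f \<in> I \<Longrightarrow> g \<in> I \<Longrightarrow> f + g \<in> I" using additive_subgroup.a_closed[OF additive_subgroup_axioms] by simp
  show "f \<in> I \<Longrightarrow> g \<in> carrier (cox_ring r n) \<Longrightarrow> g * f \<in> I" using I_l_closed by simp
  show "f \<in> I \<Longrightarrow> g \<in> carrier (cox_ring r n) \<Longrightarrow> f * g \<in> I" using I_r_closed by simp
qed

lemma ideal_sum:
  assumes "ideal I (cox_ring r n)" "\<And>a. a \<in> A \<Longrightarrow> f a \<in> I"
  shows "sum f A \<in> I"
  using assms(2) by (induction A rule: infinite_finite_induct) (auto simp: ideal_closed[OF assms(1)])

text \<open>Ideals of interest here are generated by monomials, so membership is often decided term by term.\<close>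

lemma ideal_memI:
  assumes "ideal I (cox_ring r n)"
    "\<And>m. m \<in> Poly_Mapping.keys f \<Longrightarrow> Poly_Mapping.single m (Poly_Mapping.lookup f m) \<in> I"
  shows "f \<in> I"
  by (subst sum_monomials, rule ideal_sum[OF assms(1)]) (rule assms(2))

lemma cox_ring_idealI:
  fixes I :: "'k::field mpoly set"
  assumes "I \<subseteq> carrier (cox_ring r n)" "0 \<in> I" "\<And>f g. f \<in> I \<Longrightarrow> g \<in> I \<Longrightarrow> f + g \<in> I"
    "\<And>f g. f \<in> carrier (cox_ring r n) \<Longrightarrow> g \<in> I \<Longrightarrow> f * g \<in> I"
  shows "ideal I (cox_ring r n)"
proof -
  interpret cring "cox_ring r n :: 'k mpoly ring" by (rule cring_cox_ring)
  have uminus: "- f \<in> I" if "f \<in> I" for f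
    using assms(4)[of "- 1" f] that cox_ring_closed by (metis mult_minus1)
  show ?thesis
  proof (rule idealI[OF ring_axioms])
    show "subgroup I (add_monoid (cox_ring r n))"
    proof (rule add.subgroupI)
      fix f assume f: "f \<in> I"
      then have "\<ominus>\<^bsub>cox_ring r n\<^esub> f = - f"
        using assms(1) cox_ring_closed(5) by (intro minus_equality) auto
      then show "\<ominus>\<^bsub>cox_ring r n\<^esub> f \<in> I" using uminus[OF f] by simp
    qed (use assms in auto)
  next
    fix a x :: "'k mpoly" assume "a \<in> I" "x \<in> carrier (cox_ring r n)"
    then show "x \<otimes>\<^bsub>cox_ring r n\<^esub> a \<in> I" "a \<otimes>\<^bsub>cox_ring r n\<^esub> x \<in> I"
      using assms(4)[of x a] by (simp_all add: mult.commute[of a])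
  qed
qed

section \<open>Prime ideals generated by variables\<close>

text \<open>The ideal generated by the variables in \<open>X\<close> (see \<open>var_ideal_subset_iff\<close>), given by
  the condition on monomials that decides membership.\<close>

definition var_ideal :: "nat \<Rightarrow> (nat \<Rightarrow> nat) \<Rightarrow> (nat \<times> nat) set \<Rightarrow> 'k::field mpoly set" where
  "var_ideal r n X =
    {f \<in> carrier (cox_ring r n). \<forall>m\<in>Poly_Mapping.keys f. Poly_Mapping.keys m \<inter> X \<noteq> {}}"

lemma ideal_var_ideal: "ideal (var_ideal r n X :: 'k::field mpoly set) (cox_ring r n)"
proof (rule cox_ring_idealI)
  fix f g :: "'k mpoly"
  show "f + g \<in> var_ideal r n X" if "f \<in> var_ideal r n X" "g \<in> var_ideal r n X"
    using that keys_add[of f g] by (auto simp: var_ideal_def cox_ring_closed)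
  show "f * g \<in> var_ideal r n X" if "f \<in> carrier (cox_ring r n)" "g \<in> var_ideal r n X"
    using that keys_mult[of f g] by (fastforce simp: var_ideal_def cox_ring_closed keys_add_nat)
qed (auto simp: var_ideal_def cox_ring_closed)

text \<open>The parts of \<open>f\<close> and \<open>g\<close> that are free of the variables in \<open>X\<close> have a product that is again free of
  them and lies in the ideal, so this product is zero. Polynomials have no zero divisors, as a monomial order
  shows; it comes from the lexicographic order on the pairs that name the variables.\<close>

lemma primeideal_var_ideal: "primeideal (var_ideal r n X :: 'k::field mpoly set) (cox_ring r n)"
proof (rule primeidealI[OF ideal_var_ideal cring_cox_ring])
  have "1 \<in> carrier (cox_ring r n)" "1 \<notin> var_ideal r n X"
    by (simp_all add: cox_ring_closed var_ideal_def)
  then show "carrier (cox_ring r n) \<noteq> (var_ideal r n X :: 'k mpoly set)" by metis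
next
  fix f g :: "'k mpoly"
  assume f: "f \<in> carrier (cox_ring r n)" and g: "g \<in> carrier (cox_ring r n)"
    and fg: "f \<otimes>\<^bsub>cox_ring r n\<^esub> g \<in> var_ideal r n X"
  define A where "A = {m :: (nat \<times> nat) \<Rightarrow>\<^sub>0 nat. Poly_Mapping.keys m \<inter> X \<noteq> {}}"
  let ?J = "var_ideal r n X :: 'k mpoly set"
  note J = ideal_closed[OF ideal_var_ideal[of r n X]]
  have in_J: "h \<in> ?J \<longleftrightarrow> mon_part (- A) h = 0" if "h \<in> carrier (cox_ring r n)" for h
    using that by (auto simp: var_ideal_def A_def poly_mapping_eq_iff fun_eq_iff lookup_mon_part in_keys_iff)
  have A_in: "mon_part A h \<in> ?J" if "h \<in> carrier (cox_ring r n)" for h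
    using that by (auto simp: var_ideal_def A_def keys_mon_part in_cox_ring)
  let ?p = "mon_part (- A) f * mon_part (- A) g"
  have split: "mon_part (- A) u = u - mon_part A u" for u :: "'k mpoly"
    using mon_part_Compl[of A u] by (simp add: eq_diff_eq add.commute)
  have "?p = f * g + (mon_part A f * - g + - mon_part (- A) f * mon_part A g)"
    by (simp add: split algebra_simps)
  also have "\<dots> \<in> ?J"
    using fg f g by (intro J(3) J(4)[OF A_in[of g]] J(5)[OF A_in[of f]]) (auto intro: cox_ring_closed)
  finally have "?p \<in> ?J" .
  moreover have "Poly_Mapping.keys ?p \<subseteq> - A"
  proof
    fix m assume "m \<in> Poly_Mapping.keys ?p"
    then obtain a b where "m = a + b" "a \<notin> A" "b \<notin> A"
      using keys_mult[of "mon_part (- A) f" "mon_part (- A) g"] unfolding keys_mon_part by blast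
    then show "m \<in> - A" by (simp add: A_def keys_add_nat Int_Un_distrib2)
  qed
  ultimately have "m \<notin> Poly_Mapping.keys ?p" for m unfolding var_ideal_def A_def by blast
  then have "Poly_Mapping.lookup ?p m = Poly_Mapping.lookup 0 m" for m
    unfolding in_keys_iff lookup_zero by blast
  then have "?p = 0" by (rule poly_mapping_eqI)
  then have "mon_part (- A) f = 0 \<or> mon_part (- A) g = 0" by (simp only: mult_eq_0_iff)
  then show "f \<in> ?J \<or> g \<in> ?J" using in_J[OF f] in_J[OF g] by blast
qed

lemma primeideal_closed:
  assumes "primeideal P (cox_ring r n)"
  shows "ideal P (cox_ring r n)" "1 \<notin> P"
    "f \<in> carrier (cox_ring r n) \<Longrightarrow> g \<in> carrier (cox_ring r n) \<Longrightarrow> f * g \<in> P \<Longrightarrow> f \<in> P \<or> g \<in> P"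
proof -
  interpret primeideal P "cox_ring r n" by fact
  show "ideal P (cox_ring r n)" by (rule ideal_axioms)
  show "1 \<notin> P" using I_notcarr one_imp_carrier by (metis cox_ring_simps(2))
  show "f \<in> carrier (cox_ring r n) \<Longrightarrow> g \<in> carrier (cox_ring r n) \<Longrightarrow> f * g \<in> P \<Longrightarrow> f \<in> P \<or> g \<in> P"
    using I_prime by (metis cox_ring_simps(1))
qed

lemma Idl_self: "M \<subseteq> carrier (cox_ring r n) \<Longrightarrow> f \<in> M \<Longrightarrow> f \<in> Idl\<^bsub>cox_ring r n\<^esub> M"
  using ring.genideal_self[OF ring_cox_ring] by blast

lemma Idl_minimal: "ideal I (cox_ring r n) \<Longrightarrow> M \<subseteq> I \<Longrightarrow> Idl\<^bsub>cox_ring r n\<^esub> M \<subseteq> I"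
  by (rule ring.genideal_minimal[OF ring_cox_ring])

lemma ideal_Idl: "M \<subseteq> carrier (cox_ring r n) \<Longrightarrow> ideal (Idl\<^bsub>cox_ring r n\<^esub> M) (cox_ring r n)"
  by (rule ring.genideal_ideal[OF ring_cox_ring])

section \<open>Homogeneous elements\<close>

lemma mdeg_degrees:
  assumes "Poly_Mapping.keys m \<subseteq> cox_vars r n" shows "mdeg n m \<in> degrees r"
proof -
  have "Poly_Mapping.lookup m (i, j) = 0" if "i \<notin> {1..r}" for i j
    using assms that by (auto simp: cox_vars_def in_keys_iff)
  then show ?thesis by (simp add: mdeg_def degrees_def)
qed

lemma mdeg_add: "mdeg n (m + m') = (\<lambda>i. mdeg n m i + mdeg n m' i)"
  by (simp add: mdeg_def lookup_add sum.distrib)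

lemma mdeg_0: "mdeg n 0 = (\<lambda>_. 0)"
  by (simp add: mdeg_def)

lemma mdeg_single:
  "j \<le> n i \<Longrightarrow> mdeg n (Poly_Mapping.single (i, j) 1) = (\<lambda>k. if k = i then 1 else 0)"
proof (rule ext)
  fix k assume j: "j \<le> n i"
  have "mdeg n (Poly_Mapping.single (i, j) 1) k = (\<Sum>j'\<le>n k. if j' = j then if k = i then 1 else 0 else 0)"
    unfolding mdeg_def by (rule sum.cong) (auto simp: lookup_single when_def)
  also have "\<dots> = (if k = i then 1 else 0)" using j by simp
  finally show "mdeg n (Poly_Mapping.single (i, j) 1) k = (if k = i then 1 else 0)" .
qed

lemma cox_part_closed:
  "cox_part r n a \<subseteq> carrier (cox_ring r n)"
  "0 \<in> cox_part r n a"
  "1 \<in> cox_part r n (\<lambda>_. 0)"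
  "f \<in> cox_part r n a \<Longrightarrow> g \<in> cox_part r n b \<Longrightarrow> f * g \<in> cox_part r n (\<lambda>i. a i + b i)"
  "v \<in> cox_vars r n \<Longrightarrow> cox_var v \<in> cox_part r n (\<lambda>k. if k = fst v then 1 else 0)"
  "Poly_Mapping.keys m \<subseteq> cox_vars r n \<Longrightarrow> Poly_Mapping.single m c \<in> cox_part r n (mdeg n m)"
  subgoal by (auto simp: cox_part_def)
  subgoal by (auto simp: cox_part_def cox_ring_closed)
  subgoal by (auto simp: cox_part_def cox_ring_closed mdeg_0)
  subgoal using keys_mult[of f g] by (fastforce simp: cox_part_def cox_ring_closed mdeg_add)
  subgoal by (cases v) (auto simp: cox_part_def cox_var_closed cox_var_def cox_vars_def mdeg_single[unfolded One_nat_def]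
      intro!: cox_ring_closed)
  subgoal by (auto simp: cox_part_def cox_ring_closed)
  done

lemma degrees_closed:
  "(\<lambda>_. 0) \<in> degrees r"
  "a \<in> degrees r \<Longrightarrow> b \<in> degrees r \<Longrightarrow> (\<lambda>i. a i + b i) \<in> degrees r"
  "i \<in> {1..r} \<Longrightarrow> (\<lambda>k. if k = i then 1 else 0) \<in> degrees r"
  by (auto simp: degrees_def)

lemma homogeneousI: "f \<in> cox_part r n a \<Longrightarrow> a \<in> degrees r \<Longrightarrow> f \<in> homogeneous r n"
  by (auto simp: homogeneous_def)

lemma homogeneous_closed:
  "homogeneous r n \<subseteq> carrier (cox_ring r n)"
  "1 \<in> homogeneous r n"
  "f \<in> homogeneous r n \<Longrightarrow> g \<in> homogeneous r n \<Longrightarrow> f * g \<in> homogeneous r n"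
  "v \<in> cox_vars r n \<Longrightarrow> cox_var v \<in> homogeneous r n"
  "Poly_Mapping.keys m \<subseteq> cox_vars r n \<Longrightarrow> Poly_Mapping.single m c \<in> homogeneous r n"
  subgoal using cox_part_closed(1) by (fastforce simp: homogeneous_def)
  subgoal by (rule homogeneousI[OF cox_part_closed(3) degrees_closed(1)])
  subgoal
    unfolding homogeneous_def UN_iff
    by (elim bexE) (rule bexI[of _ "\<lambda>i. _ i + _ i"], (rule cox_part_closed degrees_closed; assumption)+)
  subgoal by (rule homogeneousI[OF cox_part_closed(5)]) (auto simp: cox_vars_def degrees_def)
  subgoal by (rule homogeneousI[OF cox_part_closed(6) mdeg_degrees])
  done

text \<open>The homogeneous elements outside a prime ideal are the denominators of the stalks.\<close>

lemma homogeneous_diff_mult: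
  assumes "primeideal P (cox_ring r n)" "s \<in> homogeneous r n - P" "t \<in> homogeneous r n - P"
  shows "s * t \<in> homogeneous r n - P"
  using assms(2,3) primeideal_closed(3)[OF assms(1), of s t] homogeneous_closed by blast

lemma homogeneous_diff_one: "primeideal P (cox_ring r n) \<Longrightarrow> 1 \<in> homogeneous r n - P"
  using primeideal_closed(2) homogeneous_closed(2) by blast

lemma homogeneous_var_ideal: "homogeneous_ideal r n (var_ideal r n X :: 'k::field mpoly set)"
proof -
  let ?J = "var_ideal r n X :: 'k mpoly set"
  have sub: "?J \<inter> homogeneous r n \<subseteq> carrier (cox_ring r n)" by (auto simp: var_ideal_def)
  have "?J \<subseteq> Idl\<^bsub>cox_ring r n\<^esub> (?J \<inter> homogeneous r n)"
  proof
    fix f assume f: "f \<in> ?J"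
    show "f \<in> Idl\<^bsub>cox_ring r n\<^esub> (?J \<inter> homogeneous r n)"
    proof (rule ideal_memI[OF ideal_Idl[OF sub]], rule Idl_self[OF sub], rule IntI)
      fix m assume "m \<in> Poly_Mapping.keys f"
      then have "Poly_Mapping.keys m \<subseteq> cox_vars r n" "Poly_Mapping.keys m \<inter> X \<noteq> {}"
        using f by (auto simp: var_ideal_def in_cox_ring)
      then show "Poly_Mapping.single m (Poly_Mapping.lookup f m) \<in> ?J"
        "Poly_Mapping.single m (Poly_Mapping.lookup f m) \<in> homogeneous r n"
        by (auto simp: var_ideal_def cox_ring_closed homogeneous_closed)
    qed
  qed
  moreover have "Idl\<^bsub>cox_ring r n\<^esub> (?J \<inter> homogeneous r n) \<subseteq> ?J"
    by (rule Idl_minimal[OF ideal_var_ideal]) auto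
  ultimately show ?thesis using ideal_var_ideal by (auto simp: homogeneous_ideal_def)
qed

lemma single_split_var:
  assumes "v \<in> Poly_Mapping.keys m"
  shows "Poly_Mapping.single m c =
    cox_var v * Poly_Mapping.single (m - Poly_Mapping.single v 1) (c :: 'k::field)"
proof -
  have "Poly_Mapping.single v 1 + (m - Poly_Mapping.single v 1) = m"
  proof (rule poly_mapping_eqI)
    fix w
    show "Poly_Mapping.lookup (Poly_Mapping.single v 1 + (m - Poly_Mapping.single v 1)) w = Poly_Mapping.lookup m w"
      using assms by (cases "v = w") (simp_all add: lookup_add lookup_minus lookup_single in_keys_iff)
  qed
  then show ?thesis by (simp only: cox_var_def mult_single mult_1)
qed

lemma keys_minus_nat: "Poly_Mapping.keys (m - m' :: 'v \<Rightarrow>\<^sub>0 nat) \<subseteq> Poly_Mapping.keys m"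
  by (auto simp: in_keys_iff lookup_minus)

lemma var_ideal_subset_iff:
  assumes "ideal I (cox_ring r n)" "X \<subseteq> cox_vars r n"
  shows "var_ideal r n X \<subseteq> (I :: 'k::field mpoly set) \<longleftrightarrow> (\<forall>v\<in>X. cox_var v \<in> I)"
proof
  assume "var_ideal r n X \<subseteq> I"
  moreover have "cox_var v \<in> (var_ideal r n X :: 'k mpoly set)" if "v \<in> X" for v
    using that assms(2) cox_var_closed[of v r n] by (auto simp: var_ideal_def keys_cox_var)
  ultimately show "\<forall>v\<in>X. cox_var v \<in> I" by blast
next
  assume *: "\<forall>v\<in>X. cox_var v \<in> I"
  show "var_ideal r n X \<subseteq> I"
  proof
    fix f :: "'k mpoly" assume f: "f \<in> var_ideal r n X"
    show "f \<in> I"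
    proof (rule ideal_memI[OF assms(1)])
      fix m assume "m \<in> Poly_Mapping.keys f"
      then obtain v where v: "v \<in> X" "v \<in> Poly_Mapping.keys m" "Poly_Mapping.keys m \<subseteq> cox_vars r n"
        using f by (fastforce simp: var_ideal_def in_cox_ring)
      then show "Poly_Mapping.single m (Poly_Mapping.lookup f m) \<in> I"
        unfolding single_split_var[OF v(2)] using * keys_minus_nat[of m "Poly_Mapping.single v 1"]
        by (intro ideal_closed(5)[OF assms(1) _ cox_ring_closed(7)]) (blast+)
    qed
  qed
qed

section \<open>Associated primes of Stanley-Reisner ideals\<close>

definition squarefree_exponent :: "(nat \<times> nat) set \<Rightarrow> (nat \<times> nat) \<Rightarrow>\<^sub>0 nat" where
  "squarefree_exponent \<sigma> = (\<Sum>v\<in>\<sigma>. Poly_Mapping.single v 1)"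

lemma lookup_squarefree_exponent: "finite \<sigma> \<Longrightarrow> Poly_Mapping.lookup (squarefree_exponent \<sigma>) v = (if v \<in> \<sigma> then 1 else 0)"
  by (simp add: squarefree_exponent_def lookup_sum lookup_single when_def)

lemma keys_squarefree_exponent: "finite \<sigma> \<Longrightarrow> Poly_Mapping.keys (squarefree_exponent \<sigma>) = \<sigma>"
  by (auto simp: in_keys_iff lookup_squarefree_exponent split: if_splits)

lemma prod_cox_var: "(\<Prod>v\<in>\<sigma>. cox_var v) = (Poly_Mapping.single (squarefree_exponent \<sigma>) 1 :: 'k::field mpoly)"
  by (induction \<sigma> rule: infinite_finite_induct) (simp_all add: squarefree_exponent_def cox_var_def mult_single)

context
  fixes r n \<Delta> and I :: "'k::field mpoly set"
  assumes \<Delta>: "simplicial_complex_on r n \<Delta>" and I: "I = stanley_reisner_ideal r n \<Delta>"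
begin

lemma stanley_reisner_generators: "(\<lambda>\<sigma>. \<Prod>v\<in>\<sigma>. cox_var v) ` {\<sigma>. \<sigma> \<subseteq> cox_vars r n \<and> \<sigma> \<notin> \<Delta>} \<subseteq> (carrier (cox_ring r n) :: 'k mpoly set)"
  using finite_subset[OF _ finite_cox_vars]
  by (auto simp: prod_cox_var keys_squarefree_exponent intro!: cox_ring_closed)

lemma ideal_stanley_reisner: "ideal I (cox_ring r n)"
  unfolding I stanley_reisner_ideal_def by (rule ideal_Idl[OF stanley_reisner_generators])

text \<open>The monomials outside the Stanley-Reisner ideal are those supported on a face.\<close>

lemma stanley_reisner_iff: "f \<in> I \<longleftrightarrow> f \<in> carrier (cox_ring r n) \<and> (\<forall>m\<in>Poly_Mapping.keys f. Poly_Mapping.keys m \<notin> \<Delta>)"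
proof -
  define N where "N = {f :: 'k mpoly. f \<in> carrier (cox_ring r n) \<and> (\<forall>m\<in>Poly_Mapping.keys f. Poly_Mapping.keys m \<notin> \<Delta>)}"
  have down: "\<tau> \<in> \<Delta>" if "\<sigma> \<in> \<Delta>" "\<tau> \<subseteq> \<sigma>" for \<sigma> \<tau>
    using \<Delta> that by (auto simp: simplicial_complex_on_def)
  have N: "ideal N (cox_ring r n)"
  proof (rule cox_ring_idealI)
    fix f g :: "'k mpoly"
    show "f + g \<in> N" if "f \<in> N" "g \<in> N"
      using that keys_add[of f g] by (auto simp: N_def cox_ring_closed)
    show "f * g \<in> N" if f: "f \<in> carrier (cox_ring r n)" and g: "g \<in> N"
    proof -
      have "Poly_Mapping.keys m \<notin> \<Delta>" if m: "m \<in> Poly_Mapping.keys (f * g)" for m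
      proof -
        obtain b c where "m = b + c" "c \<in> Poly_Mapping.keys g" using keys_mult[of f g] m by blast
        then show ?thesis using g down[of "Poly_Mapping.keys m" "Poly_Mapping.keys c"]
          by (auto simp: N_def keys_add_nat)
      qed
      then show ?thesis using f g by (simp add: N_def cox_ring_closed)
    qed
  qed (auto simp: N_def cox_ring_closed)
  have "I \<subseteq> N" unfolding I stanley_reisner_ideal_def
    using finite_subset[OF _ finite_cox_vars]
    by (intro Idl_minimal[OF N]) (auto simp: N_def prod_cox_var keys_squarefree_exponent in_cox_ring)
  moreover have "f \<in> I" if f: "f \<in> N" for f
  proof (rule ideal_memI[OF ideal_stanley_reisner])
    fix m assume m: "m \<in> Poly_Mapping.keys f"
    let ?\<sigma> = "Poly_Mapping.keys m" and ?c = "Poly_Mapping.lookup f m"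
    have \<sigma>: "?\<sigma> \<subseteq> cox_vars r n" "?\<sigma> \<notin> \<Delta>" using m f by (auto simp: N_def in_cox_ring)
    then have "(\<Prod>v\<in>?\<sigma>. cox_var v) \<in> I" unfolding I stanley_reisner_ideal_def
      by (intro Idl_self[OF stanley_reisner_generators]) auto
    moreover have "Poly_Mapping.single (m - squarefree_exponent ?\<sigma>) ?c \<in> carrier (cox_ring r n)"
      using \<sigma> keys_minus_nat[of m "squarefree_exponent ?\<sigma>"] by (intro cox_ring_closed) auto
    moreover have "squarefree_exponent ?\<sigma> + (m - squarefree_exponent ?\<sigma>) = m"
      by (rule poly_mapping_eqI) (auto simp: lookup_add lookup_minus lookup_squarefree_exponent in_keys_iff)
    then have "Poly_Mapping.single m ?c = (\<Prod>v\<in>?\<sigma>. cox_var v) * Poly_Mapping.single (m - squarefree_exponent ?\<sigma>) ?c"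
      by (simp add: prod_cox_var mult_single)
    ultimately show "Poly_Mapping.single m ?c \<in> I" using ideal_closed(5)[OF ideal_stanley_reisner] by metis
  qed
  ultimately show ?thesis by (auto simp: N_def)
qed

text \<open>Let \<open>Q = (I : f)\<close>. As \<open>f \<notin> I\<close>, some monomial \<open>m\<close> of \<open>f\<close> is supported on a face. For \<open>v \<in> X\<close> the monomial
  \<open>x\<^sub>v m\<close> lies in \<open>I\<close>, so \<open>m\<close> involves no variable of \<open>X\<close>, and the complement of \<open>X\<close> together with \<open>v\<close> is
  not a face. This proves the last claim. The first one follows because \<open>I\<close> is contained in the prime
  ideal generated by \<open>X\<close> while \<open>f\<close> is not, so \<open>g f \<in> I\<close> forces \<open>g\<close> into it.\<close>

lemma associated_prime_stanley_reisner:
  assumes Q: "associated_prime r n I Q"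
  defines "X \<equiv> {v \<in> cox_vars r n. cox_var v \<in> Q}"
  shows "Q = var_ideal r n X" "I \<subseteq> Q"
    "\<And>v. v \<in> X \<Longrightarrow> (\<Prod>w\<in>cox_vars r n - X. cox_var w) * cox_var v \<in> I"
proof -
  obtain f where f: "f \<in> carrier (cox_ring r n)" "Q = {g \<in> carrier (cox_ring r n). g * f \<in> I}"
    and prime: "primeideal Q (cox_ring r n)" using Q by (auto simp: associated_prime_def)
  note idQ = primeideal_closed(1)[OF prime]
  have "f \<notin> I"
  proof
    assume "f \<in> I"
    then have "1 \<in> Q" using f cox_ring_closed(2) by auto
    then show False using primeideal_closed(2)[OF prime] by simp
  qed
  then obtain m where m: "m \<in> Poly_Mapping.keys f" "Poly_Mapping.keys m \<in> \<Delta>"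
    using f by (auto simp: stanley_reisner_iff)
  have notin: "Poly_Mapping.keys m \<union> {v} \<notin> \<Delta>" if "v \<in> X" for v
  proof -
    have "cox_var v * f \<in> I" using that f by (simp add: X_def)
    moreover have "Poly_Mapping.single v 1 + m \<in> Poly_Mapping.keys (cox_var v * f)"
      using m by (simp add: cox_var_def keys_single_times)
    ultimately show ?thesis by (auto simp: stanley_reisner_iff keys_add_nat Un_commute)
  qed
  have "Poly_Mapping.keys m \<subseteq> cox_vars r n" using m f by (auto simp: in_cox_ring)
  then have mX: "Poly_Mapping.keys m \<subseteq> cox_vars r n - X" 
  proof (intro subsetI DiffI notI)
    fix v assume "v \<in> Poly_Mapping.keys m" "v \<in> X"
    then show False using notin[of v] m(2) by (simp add: insert_absorb)
  qed auto
  have down: "\<tau> \<in> \<Delta>" if "\<sigma> \<in> \<Delta>" "\<tau> \<subseteq> \<sigma>" for \<sigma> \<tau>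
    using \<Delta> that by (auto simp: simplicial_complex_on_def)
  show "(\<Prod>w\<in>cox_vars r n - X. cox_var w) * cox_var v \<in> I" if "v \<in> X" for v
  proof -
    have "Poly_Mapping.keys (squarefree_exponent (cox_vars r n - X) + Poly_Mapping.single v 1) \<notin> \<Delta>"
      using notin[OF that] mX down[of _ "Poly_Mapping.keys m \<union> {v}"]
      by (auto simp: keys_add_nat keys_squarefree_exponent finite_cox_vars)
    moreover have "v \<in> cox_vars r n" using that by (simp add: X_def)
    moreover have "(\<Prod>w\<in>cox_vars r n - X. cox_var w) * cox_var v
        = (Poly_Mapping.single (squarefree_exponent (cox_vars r n - X) + Poly_Mapping.single v 1) 1 :: 'k mpoly)"
      unfolding prod_cox_var unfolding cox_var_def by (simp add: mult_single)
    ultimately show ?thesis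
      by (auto simp: stanley_reisner_iff in_cox_ring keys_add_nat keys_squarefree_exponent finite_cox_vars)
  qed
  show IQ: "I \<subseteq> Q"
    using f(1) ideal_closed(1)[OF ideal_stanley_reisner] ideal_closed(5)[OF ideal_stanley_reisner] unfolding f(2) by blast
  let ?J = "var_ideal r n X :: 'k mpoly set"
  have XQ: "?J \<subseteq> Q" using var_ideal_subset_iff[OF idQ, of X] by (auto simp: X_def)
  have IJ: "I \<subseteq> ?J"
  proof
    fix g assume g: "g \<in> I"
    have "Poly_Mapping.keys l \<inter> X \<noteq> {}" if l: "l \<in> Poly_Mapping.keys g" for l
    proof -
      let ?\<sigma> = "Poly_Mapping.keys l"
      have \<sigma>: "?\<sigma> \<notin> \<Delta>" "?\<sigma> \<subseteq> cox_vars r n" using g l by (auto simp: stanley_reisner_iff in_cox_ring)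
      have "(\<Prod>v\<in>?\<sigma>. cox_var v) \<in> Q"
        using \<sigma> IQ by (auto simp: stanley_reisner_iff prod_cox_var keys_squarefree_exponent in_cox_ring)
      moreover have "\<exists>v\<in>A. cox_var v \<in> Q"
        if "finite A" "A \<subseteq> cox_vars r n" "(\<Prod>v\<in>A. cox_var v) \<in> Q" for A
        using that
      proof (induction A)
        case empty
        then show ?case using primeideal_closed(2)[OF prime] by simp
      next
        case (insert v A)
        have "(\<Prod>v\<in>A. cox_var v :: 'k mpoly) \<in> carrier (cox_ring r n)"
          using insert by (auto simp: prod_cox_var in_cox_ring keys_squarefree_exponent)
        then show ?case using insert primeideal_closed(3)[OF prime, of "cox_var v" "\<Prod>v\<in>A. cox_var v"]
          by (auto simp: cox_var_closed)
      qed
      ultimately have "\<exists>v\<in>?\<sigma>. cox_var v \<in> Q" using \<sigma>(2) finite_keys by blast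
      then show ?thesis using \<sigma>(2) by (auto simp: X_def)
    qed
    then show "g \<in> ?J" using g by (auto simp: var_ideal_def stanley_reisner_iff)
  qed
  have "g \<in> ?J" if "g \<in> Q" for g
  proof -
    have g: "g \<in> carrier (cox_ring r n)" "g * f \<in> ?J" using that IJ unfolding f(2) by auto
    have "f \<notin> ?J" using m mX by (auto simp: var_ideal_def)
    then show ?thesis using primeideal_closed(3)[OF primeideal_var_ideal g(1) f(1) g(2)] by auto
  qed
  then show "Q = ?J" using XQ by blast
qed

end

section \<open>Stalks of graded modules\<close>

text \<open>The part of the axioms of a graded module that fractions depend on: addition does not occur in the
  definition of their equality.\<close>

locale graded_scaling =
  fixes r :: nat and n :: "nat \<Rightarrow> nat" and M :: "('k::field mpoly, 'm) graded_module"
  assumes hpart_carrier: "hpart M a \<subseteq> carrier M"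
    and smult_closed: "f \<in> carrier (cox_ring r n) \<Longrightarrow> u \<in> carrier M \<Longrightarrow> f \<odot>\<^bsub>M\<^esub> u \<in> carrier M"
    and smult_smult: "f \<in> carrier (cox_ring r n) \<Longrightarrow> g \<in> carrier (cox_ring r n) \<Longrightarrow> u \<in> carrier M \<Longrightarrow>
      f \<odot>\<^bsub>M\<^esub> (g \<odot>\<^bsub>M\<^esub> u) = (f * g) \<odot>\<^bsub>M\<^esub> u"
    and smult_hpart: "f \<in> cox_part r n a \<Longrightarrow> u \<in> hpart M b \<Longrightarrow> f \<odot>\<^bsub>M\<^esub> u \<in> hpart M (\<lambda>i. a i + b i)"
    and zero_hpart: "\<zero>\<^bsub>M\<^esub> \<in> hpart M a"
    and smult_zero: "f \<in> carrier (cox_ring r n) \<Longrightarrow> f \<odot>\<^bsub>M\<^esub> \<zero>\<^bsub>M\<^esub> = \<zero>\<^bsub>M\<^esub>"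
begin

definition frac :: "'k mpoly set \<Rightarrow> 'm \<Rightarrow> 'k mpoly \<Rightarrow> bool" where
  "frac P m f \<longleftrightarrow> (\<exists>a\<in>degrees r. m \<in> hpart M a \<and> f \<in> cox_part r n a - P)"

lemma fracI: "a \<in> degrees r \<Longrightarrow> m \<in> hpart M a \<Longrightarrow> f \<in> cox_part r n a \<Longrightarrow> f \<notin> P \<Longrightarrow> frac P m f"
  by (auto simp: frac_def)

lemma fracD: "frac P m f \<Longrightarrow> m \<in> carrier M" "frac P m f \<Longrightarrow> f \<in> carrier (cox_ring r n)"
  using hpart_carrier cox_part_closed(1) by (fastforce simp: frac_def)+

lemma in_hfrac:
  "(m', f') \<in> hfrac r n M P m f \<longleftrightarrow> frac P m' f' \<and>
    (\<exists>t\<in>homogeneous r n - P. t \<odot>\<^bsub>M\<^esub> (f' \<odot>\<^bsub>M\<^esub> m) = t \<odot>\<^bsub>M\<^esub> (f \<odot>\<^bsub>M\<^esub> m'))"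
  by (auto simp: hfrac_def frac_def)

context
  fixes P :: "'k mpoly set" assumes P: "primeideal P (cox_ring r n)"
begin

lemma hfrac_self: "frac P m f \<Longrightarrow> (m, f) \<in> hfrac r n M P m f"
  unfolding in_hfrac using homogeneous_diff_one[OF P] by blast

text \<open>As for fractions over any ring, the middle denominator \<open>f'\<close> is absorbed into the multiplier.\<close>

lemma hfrac_trans:
  assumes m: "frac P m f" and m': "(m', f') \<in> hfrac r n M P m f"
    and m'': "(m'', f'') \<in> hfrac r n M P m' f'"
  shows "(m'', f'') \<in> hfrac r n M P m f"
proof -
  from m' obtain t where t: "t \<in> homogeneous r n - P" and frac': "frac P m' f'"
    and 1: "t \<odot>\<^bsub>M\<^esub> (f' \<odot>\<^bsub>M\<^esub> m) = t \<odot>\<^bsub>M\<^esub> (f \<odot>\<^bsub>M\<^esub> m')" by (auto simp: in_hfrac)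
  from m'' obtain s where s: "s \<in> homogeneous r n - P" and frac'': "frac P m'' f''"
    and 2: "s \<odot>\<^bsub>M\<^esub> (f'' \<odot>\<^bsub>M\<^esub> m') = s \<odot>\<^bsub>M\<^esub> (f' \<odot>\<^bsub>M\<^esub> m'')" by (auto simp: in_hfrac)
  from t s have C: "t \<in> carrier (cox_ring r n)" "s \<in> carrier (cox_ring r n)"
    using homogeneous_closed(1) by auto
  note C = C fracD[OF m] fracD[OF frac'] fracD[OF frac'']
  have f': "f' \<in> homogeneous r n - P" using frac' by (auto simp: frac_def homogeneous_def)
  let ?t = "t * s * f'"
  have "?t \<odot>\<^bsub>M\<^esub> (f'' \<odot>\<^bsub>M\<^esub> m) = (s * f'') \<odot>\<^bsub>M\<^esub> (t \<odot>\<^bsub>M\<^esub> (f' \<odot>\<^bsub>M\<^esub> m))"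
    by (simp add: C smult_smult smult_closed cox_ring_closed) (simp add: ac_simps)
  also have "\<dots> = (t * f) \<odot>\<^bsub>M\<^esub> (s \<odot>\<^bsub>M\<^esub> (f'' \<odot>\<^bsub>M\<^esub> m'))"
    unfolding 1 by (simp add: C smult_smult smult_closed cox_ring_closed) (simp add: ac_simps)
  also have "\<dots> = ?t \<odot>\<^bsub>M\<^esub> (f \<odot>\<^bsub>M\<^esub> m'')"
    unfolding 2 by (simp add: C smult_smult smult_closed cox_ring_closed) (simp add: ac_simps)
  finally show ?thesis using frac'' homogeneous_diff_mult[OF P homogeneous_diff_mult[OF P t s] f'] by (auto simp: in_hfrac)
qed

lemma hfrac_sym:
  "frac P m f \<Longrightarrow> (m', f') \<in> hfrac r n M P m f \<Longrightarrow> (m, f) \<in> hfrac r n M P m' f'"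
  unfolding in_hfrac by metis

lemma hfrac_eqI:
  assumes "frac P m f" "frac P m' f'" "t \<in> homogeneous r n - P"
    "t \<odot>\<^bsub>M\<^esub> (f' \<odot>\<^bsub>M\<^esub> m) = t \<odot>\<^bsub>M\<^esub> (f \<odot>\<^bsub>M\<^esub> m')"
  shows "hfrac r n M P m f = hfrac r n M P m' f'"
proof -
  have 1: "(m', f') \<in> hfrac r n M P m f" using assms by (auto simp: in_hfrac)
  note 2 = hfrac_sym[OF assms(1) this]
  show ?thesis
    using hfrac_trans[OF assms(1) 1] hfrac_trans[OF assms(2) 2] by auto
qed

lemma hfrac_eqD:
  assumes "frac P m' f'" "hfrac r n M P m f = hfrac r n M P m' f'"
  obtains t where "t \<in> homogeneous r n - P" "t \<odot>\<^bsub>M\<^esub> (f' \<odot>\<^bsub>M\<^esub> m) = t \<odot>\<^bsub>M\<^esub> (f \<odot>\<^bsub>M\<^esub> m')"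
  using hfrac_self[OF assms(1)] unfolding assms(2)[symmetric] in_hfrac by blast

lemma hfrac_zero:
  assumes "f \<in> cox_part r n a - P" "a \<in> degrees r"
  shows "hfrac r n M P \<zero>\<^bsub>M\<^esub> f = hfrac r n M P \<zero>\<^bsub>M\<^esub> 1"
proof (rule hfrac_eqI)
  show "frac P \<zero>\<^bsub>M\<^esub> f" using assms zero_hpart by (auto intro: fracI)
  show "frac P \<zero>\<^bsub>M\<^esub> 1"
    by (rule fracI[OF degrees_closed(1) zero_hpart cox_part_closed(3) primeideal_closed(2)[OF P]])
  show "1 \<odot>\<^bsub>M\<^esub> (1 \<odot>\<^bsub>M\<^esub> \<zero>\<^bsub>M\<^esub>) = 1 \<odot>\<^bsub>M\<^esub> (f \<odot>\<^bsub>M\<^esub> \<zero>\<^bsub>M\<^esub>)"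
    using assms cox_part_closed(1)[of r n a] by (auto simp: smult_zero cox_ring_closed)
qed (rule homogeneous_diff_one[OF P])

end

lemma frac_section:
  assumes "openin (zariski r n) U" "a \<in> degrees r" "m \<in> hpart M a" "f \<in> cox_part r n a"
    "\<And>P. P \<in> U \<Longrightarrow> f \<notin> P"
  shows "(\<lambda>P\<in>U. hfrac r n M P m f) \<in> carrier (tilde r n M U)"
  unfolding tilde_def partial_object.simps mem_Collect_eq
proof (intro conjI ballI)
  fix P assume "P \<in> U"
  then show "\<exists>W. openin (zariski r n) W \<and> P \<in> W \<and> W \<subseteq> U \<and> (\<exists>a\<in>degrees r. \<exists>m'\<in>hpart M a.
      \<exists>f'\<in>cox_part r n a. \<forall>P'\<in>W. f' \<notin> P' \<and> (\<lambda>P\<in>U. hfrac r n M P m f) P' = hfrac r n M P' m' f')"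
    using assms by (intro exI[of _ U] conjI bexI[of _ a] bexI[of _ m] bexI[of _ f]) auto
qed simp

lemma section_germ:
  assumes "s \<in> carrier (tilde r n M U)" "P \<in> U"
  obtains W a m f where "openin (zariski r n) W" "P \<in> W" "W \<subseteq> U" "a \<in> degrees r" "m \<in> hpart M a"
    "f \<in> cox_part r n a" "\<And>P'. P' \<in> W \<Longrightarrow> f \<notin> P'" "\<And>P'. P' \<in> W \<Longrightarrow> s P' = hfrac r n M P' m f"
  using assms unfolding tilde_def by (simp, meson)

end

lemma cox_module_simps:
  "carrier (cox_module r n) = carrier (cox_ring r n)" "smult (cox_module r n) = (*)"
  "zero (cox_module r n) = 0" "hpart (cox_module r n) = cox_part r n"
  by (simp_all add: cox_module_def)

lemma cox_module_graded_scaling: "graded_scaling r n (cox_module r n)"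
proof (unfold_locales, goal_cases)
  case (4 f a u b)
  then show ?case using cox_part_closed(4) by (auto simp: cox_module_def)
qed (use cox_part_closed(1,2) in \<open>auto simp: cox_module_def cox_ring_closed mult.assoc\<close>)

lemma free_module_graded_scaling: "graded_scaling r n (free_module r n as)"
proof (unfold_locales, goal_cases)
  case (1 a)
  then show ?case unfolding free_module_def by (auto intro!: PiE_mono cox_part_closed)
next
  case (4 f a u b)
  have "(\<lambda>i. a i + b i - (as ! k) i) = (\<lambda>i. a i + (b i - (as ! k) i))" for k by (simp add: algebra_simps)
  with 4 cox_part_closed(4)[of f r n a _ "\<lambda>i. b i - _ i"] show ?case
    by (auto simp: free_module_def PiE_iff)
qed (auto simp: free_module_def cox_ring_closed cox_part_closed mult.assoc PiE_iff fun_eq_iff extensional_def)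

lemma quotient_module_graded_scaling:
  fixes I :: "'k::field mpoly set"
  assumes "ideal I (cox_ring r n)"
  shows "graded_scaling r n (quotient_module r n I)"
    "\<And>f g. f \<in> carrier (cox_ring r n) \<Longrightarrow> g \<in> carrier (cox_ring r n) \<Longrightarrow>
      f \<odot>\<^bsub>quotient_module r n I\<^esub> (I +>\<^bsub>cox_ring r n\<^esub> g) = I +>\<^bsub>cox_ring r n\<^esub> (f * g)"
    "\<zero>\<^bsub>quotient_module r n I\<^esub> = I +>\<^bsub>cox_ring r n\<^esub> 0"
proof -
  interpret I: ideal I "cox_ring r n" by fact
  interpret cring "cox_ring r n :: 'k mpoly ring" by (rule cring_cox_ring)
  show *: "f \<odot>\<^bsub>quotient_module r n I\<^esub> (I +>\<^bsub>cox_ring r n\<^esub> g) = I +>\<^bsub>cox_ring r n\<^esub> (f * g)"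
    if "f \<in> carrier (cox_ring r n)" "g \<in> carrier (cox_ring r n)" for f g
    using I.rcoset_mult_add[OF that] by (simp add: quotient_module_def Let_def FactRing_def)
  have z: "I +>\<^bsub>cox_ring r n\<^esub> 0 = I"
    using I.a_rcos_const[of 0] ideal_closed(2)[OF assms] by simp
  show z': "\<zero>\<^bsub>quotient_module r n I\<^esub> = I +>\<^bsub>cox_ring r n\<^esub> 0"
    unfolding z by (simp add: quotient_module_def Let_def FactRing_def)
  have c: "carrier (quotient_module r n I) = (\<lambda>f. I +>\<^bsub>cox_ring r n\<^esub> f) ` carrier (cox_ring r n)"
    by (auto simp: quotient_module_def Let_def FactRing_def A_RCOSETS_def')
  have h: "hpart (quotient_module r n I) a = (\<lambda>f. I +>\<^bsub>cox_ring r n\<^esub> f) ` cox_part r n a" for a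
    by (simp add: quotient_module_def Let_def)
  show "graded_scaling r n (quotient_module r n I)"
  proof (unfold_locales, goal_cases)
    case (1 a)
    show ?case unfolding c h by (rule image_mono[OF cox_part_closed(1)])
  next
    case (2 f u)
    then obtain g where "u = I +>\<^bsub>cox_ring r n\<^esub> g" "g \<in> carrier (cox_ring r n)" unfolding c by (elim imageE)
    then show ?case unfolding c using 2 by (simp only: *) (intro imageI cox_ring_closed)
  next
    case (3 f f' u)
    then obtain g where "u = I +>\<^bsub>cox_ring r n\<^esub> g" "g \<in> carrier (cox_ring r n)" unfolding c by (elim imageE)
    then show ?case using 3 by (simp only: * cox_ring_closed mult.assoc)
  next
    case (4 f a u b)
    then obtain g where g: "u = I +>\<^bsub>cox_ring r n\<^esub> g" "g \<in> cox_part r n b" unfolding h by (elim imageE)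
    have "f \<in> carrier (cox_ring r n)" "g \<in> carrier (cox_ring r n)" using 4 g cox_part_closed(1) by blast+
    then show ?case unfolding h g(1) using cox_part_closed(4)[OF 4(1) g(2)] by (simp only: *) (rule imageI)
  next
    case (5 a)
    show ?case unfolding h z' by (rule imageI[OF cox_part_closed(2)])
  next
    case (6 f)
    then show ?case unfolding z' by (simp only: * cox_ring_closed mult_zero_right)
  qed
qed

lemma UN_pair_const:
  assumes "(a, b) \<in> A" "\<And>a b. (a, b) \<in> A \<Longrightarrow> F a b = c"
  shows "(\<Union>(a, b)\<in>A. F a b) = c"
  using assms by fast

text \<open>The union over all representatives that defines the product in the stalk is a union of equal
  sets, because the class of a product of fractions does not depend on the representatives.\<close>

lemma smult_frac:
  fixes M :: "('k::field mpoly, 'm) graded_module"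
  assumes M: "graded_scaling r n M" and P: "primeideal P (cox_ring r n)"
    and g: "e \<in> degrees r" "g \<in> cox_part r n e" "h \<in> cox_part r n e - P"
    and m: "graded_scaling.frac r n M P m f"
  shows "hfrac r n (cox_module r n) P g h \<odot>\<^bsub>stalk r n M P\<^esub> hfrac r n M P m f
    = hfrac r n M P (g \<odot>\<^bsub>M\<^esub> m) (h * f)"
proof -
  interpret M: graded_scaling r n M by fact
  interpret O: graded_scaling r n "cox_module r n :: ('k mpoly, 'k mpoly) graded_module"
    by (rule cox_module_graded_scaling)
  have frac_mult: "M.frac P (g \<odot>\<^bsub>M\<^esub> m) (h * f)" if gh: "O.frac P g h" and m: "M.frac P m f" for g h m f
  proof -
    obtain e where e: "e \<in> degrees r" "g \<in> cox_part r n e" "h \<in> cox_part r n e" "h \<notin> P"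
      using gh by (auto simp: O.frac_def cox_module_simps)
    obtain a where a: "a \<in> degrees r" "m \<in> hpart M a" "f \<in> cox_part r n a" "f \<notin> P"
      using m by (auto simp: M.frac_def)
    show ?thesis
      using e a M.smult_hpart primeideal_closed(3)[OF P, of h f] cox_part_closed(1)[of r n]
      by (intro M.fracI[OF degrees_closed(2)[OF e(1) a(1)]]) (blast intro: cox_part_closed(4))+
  qed
  have gh: "O.frac P g h" using g by (intro O.fracI[of e]) (auto simp: cox_module_simps)
  have const: "hfrac r n M P (g' \<odot>\<^bsub>M\<^esub> m') (h' * f') = hfrac r n M P (g \<odot>\<^bsub>M\<^esub> m) (h * f)"
    if g': "(g', h') \<in> hfrac r n (cox_module r n) P g h" and m': "(m', f') \<in> hfrac r n M P m f"
    for g' h' m' f'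
  proof -
    obtain t where t: "t \<in> homogeneous r n - P" and 1: "O.frac P g' h'" "t * (h' * g) = t * (h * g')"
      using g' unfolding O.in_hfrac cox_module_simps by blast
    obtain s where s: "s \<in> homogeneous r n - P"
      and 2: "M.frac P m' f'" "s \<odot>\<^bsub>M\<^esub> (f' \<odot>\<^bsub>M\<^esub> m) = s \<odot>\<^bsub>M\<^esub> (f \<odot>\<^bsub>M\<^esub> m')"
      using m' unfolding M.in_hfrac by blast
    have C: "t \<in> carrier (cox_ring r n)" "s \<in> carrier (cox_ring r n)"
      using s t homogeneous_closed(1) by auto
    have C': "g \<in> carrier (cox_ring r n)" "g' \<in> carrier (cox_ring r n)"
      using O.fracD(1)[OF gh] O.fracD(1)[OF 1(1)] by (auto simp: cox_module_simps)
    note C = C C' M.fracD[OF m] M.fracD[OF 2(1)] O.fracD(2)[OF gh] O.fracD(2)[OF 1(1)]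
    have "(t * s) \<odot>\<^bsub>M\<^esub> ((h' * f') \<odot>\<^bsub>M\<^esub> (g \<odot>\<^bsub>M\<^esub> m)) = (t * (h' * g)) \<odot>\<^bsub>M\<^esub> (s \<odot>\<^bsub>M\<^esub> (f' \<odot>\<^bsub>M\<^esub> m))"
      by (simp add: C M.smult_smult M.smult_closed cox_ring_closed) (simp add: ac_simps)
    also have "\<dots> = (t * s) \<odot>\<^bsub>M\<^esub> ((h * f) \<odot>\<^bsub>M\<^esub> (g' \<odot>\<^bsub>M\<^esub> m'))"
      unfolding 1(2) 2(2)
      by (simp add: C M.smult_smult M.smult_closed cox_ring_closed) (simp add: ac_simps)
    finally show ?thesis
      by (intro M.hfrac_eqI[OF P frac_mult[OF 1(1) 2(1)] frac_mult[OF gh m] homogeneous_diff_mult[OF P t s]]) simp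
  qed
  have inner: "(\<Union>(m', f')\<in>hfrac r n M P m f. hfrac r n M P (g' \<odot>\<^bsub>M\<^esub> m') (h' * f')) =
      hfrac r n M P (g \<odot>\<^bsub>M\<^esub> m) (h * f)" if "(g', h') \<in> hfrac r n (cox_module r n) P g h" for g' h'
    by (rule UN_pair_const[OF M.hfrac_self[OF P m]]) (rule const[OF that])
  have "(\<Union>(g', h')\<in>hfrac r n (cox_module r n) P g h. \<Union>(m', f')\<in>hfrac r n M P m f.
      hfrac r n M P (g' \<odot>\<^bsub>M\<^esub> m') (h' * f')) = hfrac r n M P (g \<odot>\<^bsub>M\<^esub> m) (h * f)"
    by (rule UN_pair_const[OF O.hfrac_self[OF P gh]]) (rule inner)
  then show ?thesis by (simp add: stalk_def)
qed

lemma tilde_map_frac: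
  fixes M :: "('k::field mpoly, 'm) graded_module" and N :: "('k mpoly, 'l) graded_module"
  assumes M: "graded_scaling r n M" and N: "graded_scaling r n N" and \<phi>: "graded_hom r n M N \<phi>"
    and P: "primeideal P (cox_ring r n)" and m: "graded_scaling.frac r n M P m f"
  shows "(\<Union>(m', f')\<in>hfrac r n M P m f. hfrac r n N P (\<phi> m') f') = hfrac r n N P (\<phi> m) f"
proof -
  interpret M: graded_scaling r n M by fact
  interpret N: graded_scaling r n N by fact
  have frac: "N.frac P (\<phi> m) f" if m: "M.frac P m f" for m f
  proof -
    obtain a where a: "a \<in> degrees r" "m \<in> hpart M a" "f \<in> cox_part r n a" "f \<notin> P"
      using m by (auto simp: M.frac_def)
    moreover have "\<phi> m \<in> hpart N a" using \<phi> a unfolding graded_hom_def by blast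
    ultimately show ?thesis using N.fracI by blast
  qed
  have lin: "\<phi> (g \<odot>\<^bsub>M\<^esub> u) = g \<odot>\<^bsub>N\<^esub> \<phi> u" if "g \<in> carrier (cox_ring r n)" "u \<in> carrier M" for g u
    using that \<phi> unfolding graded_hom_def by blast
  have const: "hfrac r n N P (\<phi> m') f' = hfrac r n N P (\<phi> m) f" if m': "(m', f') \<in> hfrac r n M P m f" for m' f'
  proof -
    obtain t where t: "t \<in> homogeneous r n - P"
      and 1: "M.frac P m' f'" "t \<odot>\<^bsub>M\<^esub> (f' \<odot>\<^bsub>M\<^esub> m) = t \<odot>\<^bsub>M\<^esub> (f \<odot>\<^bsub>M\<^esub> m')"
      using m' by (auto simp: M.in_hfrac)
    have C: "t \<in> carrier (cox_ring r n)" using t homogeneous_closed(1) by auto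
    note C = C M.fracD[OF m] M.fracD[OF 1(1)]
    have "t \<odot>\<^bsub>N\<^esub> (f \<odot>\<^bsub>N\<^esub> \<phi> m') = \<phi> (t \<odot>\<^bsub>M\<^esub> (f \<odot>\<^bsub>M\<^esub> m'))"
      by (simp only: lin C M.smult_closed)
    also have "\<dots> = \<phi> (t \<odot>\<^bsub>M\<^esub> (f' \<odot>\<^bsub>M\<^esub> m))" by (simp only: 1(2))
    also have "\<dots> = t \<odot>\<^bsub>N\<^esub> (f' \<odot>\<^bsub>N\<^esub> \<phi> m)" by (simp only: lin C M.smult_closed)
    finally show ?thesis by (rule N.hfrac_eqI[OF P frac[OF 1(1)] frac[OF m] t])
  qed
  show ?thesis by (rule UN_pair_const[OF M.hfrac_self[OF P m]]) (rule const)
qed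

section \<open>Exactness at a point\<close>

lemma openin_zariski_basic:
  "f \<in> homogeneous r n \<Longrightarrow> openin (zariski r n) {P \<in> points r n. f \<notin> P}"
  unfolding zariski_def by (rule topology_generated_by_Basis) auto

lemma openin_zariski_subset: "openin (zariski r n) W \<Longrightarrow> W \<subseteq> points r n"
proof -
  assume "openin (zariski r n) W"
  then have "W \<subseteq> topspace (zariski r n)" by (rule openin_subset)
  then show ?thesis unfolding zariski_def topology_generated_by_topspace by blast
qed

lemma points_prime: "P \<in> points r n \<Longrightarrow> primeideal P (cox_ring r n)"
  by (simp add: points_def)

lemma not_irrelevant_subset:
  assumes "ideal P (cox_ring r n)" "\<not> irrelevant_ideal r n \<subseteq> P" "i \<in> {1..r}"
  shows "\<exists>j\<le>n i. cox_var (i, j) \<notin> P"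
proof (rule ccontr)
  assume "\<not> ?thesis"
  then have "Idl\<^bsub>cox_ring r n\<^esub> ((\<lambda>j. cox_var (i, j)) ` {0..n i}) \<subseteq> P"
    by (intro Idl_minimal[OF assms(1)]) auto
  then show False using assms(2,3) by (auto simp: irrelevant_ideal_def)
qed

text \<open>Every degree is the difference of the degrees of two elements outside \<open>P\<close>: as \<open>P\<close> does not contain the
  irrelevant ideal, each factor has a variable outside \<open>P\<close>, and monomials in these variables can be used. This makes a
  section out of an element of any degree.\<close>

lemma degree_shift:
  fixes P :: "'k::field mpoly set"
  assumes P: "P \<in> points r n" and b: "b \<in> degrees r"
  shows "\<exists>e\<in>degrees r. \<exists>g\<in>cox_part r n e - P. cox_part r n (\<lambda>i. e i + b i) - P \<noteq> {}"
proof -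
  note prime = points_prime[OF P]
  have "\<forall>i\<in>{1..r}. \<exists>j. j \<le> n i \<and> cox_var (i, j) \<notin> P"
    using not_irrelevant_subset[OF primeideal_closed(1)[OF prime]] P by (auto simp: points_def)
  then obtain y where y: "\<And>i. i \<in> {1..r} \<Longrightarrow> y i \<le> n i" "\<And>i. i \<in> {1..r} \<Longrightarrow> cox_var (i, y i) \<notin> P"
    by metis
  define D where "D b = (cox_part r n b - P :: 'k mpoly set)" for b
  have mult: "f * g \<in> D (\<lambda>i. a i + b i)" if "f \<in> D a" "g \<in> D b" for f g a b
    using that primeideal_closed(3)[OF prime, of f g] cox_part_closed(1) cox_part_closed(4)[of f r n a g b]
    unfolding D_def by blast
  have one: "1 \<in> D (\<lambda>_. 0)"
    using cox_part_closed(3) primeideal_closed(2)[OF prime] by (simp add: D_def)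
  have power: "cox_var (i, y i) ^ k \<in> D (\<lambda>l. if l = i then int k else 0)" if i: "i \<in> {1..r}" for i k
  proof (induction k)
    case 0
    show ?case using one by (simp cong: if_cong)
  next
    case (Suc k)
    have "cox_var (i, y i) \<in> D (\<lambda>l. if l = i then 1 else 0)"
      using cox_part_closed(5)[of "(i, y i)" r n] y[OF i] i by (simp add: D_def cox_vars_def)
    from mult[OF this Suc] show ?case by (simp add: if_distrib if_distribR add.commute cong: if_cong)
  qed
  have prod: "(\<Prod>i\<in>A. cox_var (i, y i) ^ k i) \<in> D (\<lambda>l. if l \<in> A then int (k l) else 0)"
    if "finite A" "A \<subseteq> {1..r}" for A k
    using that
  proof (induction A)
    case empty
    show ?case using one by simp
  next
    case (insert i A)
    have deg: "(\<lambda>l. (if l = i then int (k i) else 0) + (if l \<in> A then int (k l) else 0))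
      = (\<lambda>l. if l \<in> insert i A then int (k l) else 0)"
      using insert by (auto simp: fun_eq_iff)
    have "(\<Prod>i\<in>A. cox_var (i, y i) ^ k i) \<in> D (\<lambda>l. if l \<in> A then int (k l) else 0)"
      and "i \<in> {1..r}" using insert by auto
    from mult[OF power[OF this(2), of "k i"] this(1)] show ?case
      unfolding deg prod.insert[OF insert(1,2)] .
  qed
  define e where "e = (\<lambda>l. if l \<in> {1..r} then int (nat (- b l)) else 0)"
  have "(\<lambda>l. if l \<in> {1..r} then int (nat (b l)) else 0) = (\<lambda>i. e i + b i)"
    using b by (auto simp: e_def degrees_def fun_eq_iff)
  then have "(\<Prod>i\<in>{1..r}. cox_var (i, y i) ^ nat (b i)) \<in> D (\<lambda>i. e i + b i)"
    using prod[of "{1..r}" "\<lambda>i. nat (b i)"] by simp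
  moreover have "(\<Prod>i\<in>{1..r}. cox_var (i, y i) ^ nat (- b i)) \<in> D e"
    using prod[of "{1..r}" "\<lambda>i. nat (- b i)"] by (simp add: e_def)
  moreover have "e \<in> degrees r" by (auto simp: e_def degrees_def)
  ultimately show ?thesis unfolding D_def by blast
qed

text \<open>If a section that starts as \<open>u / f\<close> at \<open>P\<close> lifts locally through \<open>\<phi>\<close>, then the element \<open>u\<close> itself lifts
  up to a multiplier outside \<open>P\<close>.\<close>

lemma germ_in_image:
  fixes M :: "('k::field mpoly, 'm) graded_module" and N :: "('k mpoly, 'l) graded_module"
  assumes M: "graded_scaling r n M" and N: "graded_scaling r n N" and \<phi>: "graded_hom r n M N \<phi>"
    and P: "P \<in> points r n" "P \<in> U" and u: "graded_scaling.frac r n N P u f"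
    and s: "s P = hfrac r n N P u f" "locally_in_image (zariski r n) (tilde r n M) (tilde_map r n N \<phi>) U s"
  shows "\<exists>t\<in>homogeneous r n - P. \<exists>w\<in>carrier M. t \<odot>\<^bsub>N\<^esub> u = \<phi> w"
proof -
  interpret M: graded_scaling r n M by fact
  interpret N: graded_scaling r n N by fact
  note prime = points_prime[OF P(1)]
  obtain W where W: "P \<in> W" "restrict s W \<in> tilde_map r n N \<phi> W ` carrier (tilde r n M W)"
    using s(2) P(2) unfolding locally_in_image_def by blast
  obtain s' where s': "s' \<in> carrier (tilde r n M W)" "restrict s W = tilde_map r n N \<phi> W s'"
    using W(2) by (elim imageE)
  obtain a w g where w: "a \<in> degrees r" "w \<in> hpart M a" "g \<in> cox_part r n a" "g \<notin> P"
    "s' P = hfrac r n M P w g"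
    using M.section_germ[OF s'(1) W(1)] by metis
  have frac: "M.frac P w g" using w by (intro M.fracI)
  have "\<phi> w \<in> hpart N a" using \<phi> w unfolding graded_hom_def by blast
  then have frac': "N.frac P (\<phi> w) g" using w by (intro N.fracI)
  have "s P = tilde_map r n N \<phi> W s' P" using fun_cong[OF s'(2), of P] W(1) by simp
  also have "\<dots> = (\<Union>(m, f)\<in>hfrac r n M P w g. hfrac r n N P (\<phi> m) f)"
    using W(1) by (simp add: tilde_map_def w(5))
  also have "\<dots> = hfrac r n N P (\<phi> w) g" by (rule tilde_map_frac[OF M N \<phi> prime frac])
  finally have "hfrac r n N P u f = hfrac r n N P (\<phi> w) g" unfolding s(1) .
  then obtain t where t: "t \<in> homogeneous r n - P" "t \<odot>\<^bsub>N\<^esub> (g \<odot>\<^bsub>N\<^esub> u) = t \<odot>\<^bsub>N\<^esub> (f \<odot>\<^bsub>N\<^esub> \<phi> w)"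
    by (rule N.hfrac_eqD[OF prime frac'])
  have C: "t \<in> carrier (cox_ring r n)" using t homogeneous_closed(1) by auto
  note C = C N.fracD[OF u] N.fracD[OF frac'] M.fracD[OF frac]
  have g: "g \<in> homogeneous r n - P" using w by (auto simp: homogeneous_def)
  have "(t * g) \<odot>\<^bsub>N\<^esub> u = t \<odot>\<^bsub>N\<^esub> (f \<odot>\<^bsub>N\<^esub> \<phi> w)" using t(2) by (simp only: C N.smult_smult)
  also have "\<dots> = \<phi> (t \<odot>\<^bsub>M\<^esub> (f \<odot>\<^bsub>M\<^esub> w))"
    using \<phi> C M.smult_closed unfolding graded_hom_def by simp
  finally show ?thesis using homogeneous_diff_mult[OF prime t(1) g] M.smult_closed C by blast
qed

lemma stalk_exact:
  fixes M :: "('k::field mpoly, 'm) graded_module" and N :: "('k mpoly, 'l) graded_module"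
    and K :: "('k mpoly, 'o) graded_module"
  assumes M: "graded_scaling r n M" and N: "graded_scaling r n N" and K: "graded_scaling r n K"
    and \<phi>: "graded_hom r n M N \<phi>" and \<psi>: "graded_hom r n N K \<psi>"
    and exact: "sheaf_exact (zariski r n) (tilde r n M) (tilde r n N) (tilde r n K)
      (tilde_map r n N \<phi>) (tilde_map r n K \<psi>)"
    and P: "P \<in> points r n" and u: "b \<in> degrees r" "u \<in> hpart N b" "\<psi> u = \<zero>\<^bsub>K\<^esub>"
  shows "\<exists>t\<in>homogeneous r n - P. \<exists>w\<in>carrier M. t \<odot>\<^bsub>N\<^esub> u = \<phi> w"
proof -
  interpret N: graded_scaling r n N by fact
  interpret K: graded_scaling r n K by fact
  \<comment> \<open>A section u / f needs a denominator of the degree of u; after multiplication of u by g there is one.\<close>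
  obtain e g f where e: "e \<in> degrees r" and g: "g \<in> cox_part r n e - P"
    and f: "f \<in> cox_part r n (\<lambda>i. e i + b i) - P"
    using degree_shift[OF P u(1)] by blast
  let ?c = "\<lambda>i. e i + b i"
  define v where "v = g \<odot>\<^bsub>N\<^esub> u"
  have c: "?c \<in> degrees r" by (rule degrees_closed(2)[OF e u(1)])
  have gC: "g \<in> carrier (cox_ring r n)" using g cox_part_closed(1) by blast
  have v: "v \<in> hpart N ?c" unfolding v_def using g u by (intro N.smult_hpart) auto
  have "\<psi> v = g \<odot>\<^bsub>K\<^esub> \<psi> u" unfolding v_def using gC u N.hpart_carrier \<psi> unfolding graded_hom_def by blast
  then have \<psi>v: "\<psi> v = \<zero>\<^bsub>K\<^esub>" by (simp only: u(3) K.smult_zero[OF gC])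
  define U where "U = {P \<in> points r n. f \<notin> P}"
  have fh: "f \<in> homogeneous r n" using f homogeneousI[OF _ c] by blast
  have U: "openin (zariski r n) U" "P \<in> U"
    using openin_zariski_basic[OF fh] P f by (auto simp: U_def)
  define s where "s = (\<lambda>P\<in>U. hfrac r n N P v f)"
  have s: "s \<in> carrier (tilde r n N U)"
    unfolding s_def using f by (intro N.frac_section[OF U(1) c v]) (auto simp: U_def)
  have "tilde_map r n K \<psi> U s P = hfrac r n K P \<zero>\<^bsub>K\<^esub> 1" if P: "P \<in> U" for P
  proof -
    have prime: "primeideal P (cox_ring r n)" and fP: "f \<notin> P" using P points_prime by (auto simp: U_def)
    have frac: "N.frac P v f" using f by (intro N.fracI[OF c v _ fP]) auto
    have "tilde_map r n K \<psi> U s P = (\<Union>(m, f)\<in>hfrac r n N P v f. hfrac r n K P (\<psi> m) f)"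
      using P by (simp add: tilde_map_def s_def)
    also have "\<dots> = hfrac r n K P (\<psi> v) f" by (rule tilde_map_frac[OF N K \<psi> prime frac])
    also have "\<dots> = hfrac r n K P \<zero>\<^bsub>K\<^esub> 1" unfolding \<psi>v using f fP by (intro K.hfrac_zero[OF prime _ c]) auto
    finally show ?thesis .
  qed
  then have "tilde_map r n K \<psi> U s = \<zero>\<^bsub>tilde r n K U\<^esub>"
    by (auto simp: fun_eq_iff tilde_def stalk_def tilde_map_def)
  then have "locally_in_image (zariski r n) (tilde r n M) (tilde_map r n N \<phi>) U s"
    using exact U s unfolding sheaf_exact_def by blast
  moreover have "N.frac P v f" using f by (intro N.fracI[OF c v]) auto
  moreover have "s P = hfrac r n N P v f" using U by (simp add: s_def)
  ultimately obtain t w where t: "t \<in> homogeneous r n - P" "w \<in> carrier M" "t \<odot>\<^bsub>N\<^esub> v = \<phi> w"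
    using germ_in_image[OF M N \<phi> P U(2)] by blast
  have "t \<odot>\<^bsub>N\<^esub> v = (t * g) \<odot>\<^bsub>N\<^esub> u"
    unfolding v_def using t gC u N.hpart_carrier homogeneous_closed(1)
    by (intro N.smult_smult) blast+
  moreover have "g \<in> homogeneous r n - P" using g e by (auto simp: homogeneous_def)
  ultimately show ?thesis using t homogeneous_diff_mult[OF points_prime[OF P] t(1)] by metis
qed


text \<open>Locally at \<open>P\<close>, let \<open>u / f\<close> be a section of \<open>N\<^sup>~\<close> that \<open>\<epsilon>\<close> maps to the section \<open>1\<close> of \<open>(S/I)\<^sup>~\<close>. It is not in
  the image of \<open>\<phi>\<close>, because \<open>1\<close> is not zero in the stalk at \<open>P \<supseteq> I\<close>. If a variable becomes an element of \<open>I\<close> after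
  multiplication by an element outside \<open>P\<close>, then it kills the section \<open>1\<close> near \<open>P\<close>, hence maps \<open>u\<close> into the image
  of \<open>\<phi>\<close>. Since \<open>\<epsilon>\<close> is a map of sheaves only, all this takes place on small open sets.\<close>

lemma augmentation_generator:
  fixes M :: "('k::field mpoly, 'm) graded_module" and N :: "('k mpoly, 'l) graded_module"
  assumes M: "graded_scaling r n M" and N: "graded_scaling r n N" and \<phi>: "graded_hom r n M N \<phi>"
    and I: "ideal I (cox_ring r n)" "I \<subseteq> P" and P: "P \<in> points r n"
    and hom: "sheaf_hom (zariski r n) (structure_sheaf r n) (tilde r n N)
      (tilde r n (quotient_module r n I)) \<epsilon>"
    and surj: "sheaf_surjective (zariski r n) (tilde r n N) (tilde r n (quotient_module r n I)) \<epsilon>"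
    and exact: "sheaf_exact (zariski r n) (tilde r n M) (tilde r n N)
      (tilde r n (quotient_module r n I)) (tilde_map r n N \<phi>) \<epsilon>"
  shows "\<exists>a\<in>degrees r. \<exists>u\<in>hpart N a.
    (\<forall>c\<in>degrees r. \<forall>t\<in>cox_part r n c - P. \<forall>w\<in>hpart M (\<lambda>i. c i + a i). t \<odot>\<^bsub>N\<^esub> u \<noteq> \<phi> w) \<and>
    (\<forall>v\<in>cox_vars r n. (\<exists>t\<in>homogeneous r n - P. t * cox_var v \<in> I) \<longrightarrow>
      (\<exists>t\<in>homogeneous r n - P. \<exists>w\<in>carrier M. t \<odot>\<^bsub>N\<^esub> (cox_var v \<odot>\<^bsub>N\<^esub> u) = \<phi> w))"
proof -
  interpret M: graded_scaling r n M by fact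
  interpret N: graded_scaling r n N by fact
  let ?Q = "quotient_module r n I" and ?T = "zariski r n" and ?C = "carrier (cox_ring r n) :: 'k mpoly set"
  interpret Q: graded_scaling r n ?Q by (rule quotient_module_graded_scaling(1)[OF I(1)])
  note Q_smult = quotient_module_graded_scaling(2)[OF I(1)]
    and Q_zero = quotient_module_graded_scaling(3)[OF I(1)]
  let ?cl = "\<lambda>g. I +>\<^bsub>cox_ring r n\<^esub> g"
  have cl_hpart: "?cl g \<in> hpart ?Q a" if "g \<in> cox_part r n a" for g a
    using that by (simp add: quotient_module_def Let_def)
  have cl_zero: "?cl g = ?cl 0 \<longleftrightarrow> g \<in> I" if "g \<in> ?C" for g
  proof -
    interpret ideal I "cox_ring r n" by fact
    have z: "I +>\<^bsub>cox_ring r n\<^esub> 0 = I" using a_rcos_const[of 0] ideal_closed(2)[OF I(1)] by simp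
    show ?thesis using a_rcos_const[of g] a_rcos_self[of g] that unfolding z by auto
  qed
  define one where "one = (\<lambda>U. \<lambda>P\<in>U. hfrac r n ?Q P (?cl 1) 1)"
  have one_sec: "one U \<in> carrier (tilde r n ?Q U)" if U: "openin ?T U" for U
    unfolding one_def
    using primeideal_closed(2)[OF points_prime] openin_zariski_subset[OF U]
    by (intro Q.frac_section[OF U degrees_closed(1) cl_hpart[OF cox_part_closed(3)] cox_part_closed(3)]) blast
  define U\<^sub>0 where "U\<^sub>0 = {P \<in> points r n. (1 :: 'k mpoly) \<notin> P}"
  have U\<^sub>0: "openin ?T U\<^sub>0" "P \<in> U\<^sub>0"
    using openin_zariski_basic[OF homogeneous_closed(2)] P primeideal_closed(2)[OF points_prime[OF P]]
    by (auto simp: U\<^sub>0_def)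
  have "locally_in_image ?T (tilde r n N) \<epsilon> U\<^sub>0 (one U\<^sub>0)"
    using surj[unfolded sheaf_surjective_def, rule_format, OF U\<^sub>0(1) one_sec[OF U\<^sub>0(1)]] .
  then obtain W\<^sub>1 where W\<^sub>1: "openin ?T W\<^sub>1" "P \<in> W\<^sub>1" "W\<^sub>1 \<subseteq> U\<^sub>0"
    "restrict (one U\<^sub>0) W\<^sub>1 \<in> \<epsilon> W\<^sub>1 ` carrier (tilde r n N W\<^sub>1)"
    unfolding locally_in_image_def using U\<^sub>0(2) by metis
  from W\<^sub>1(4) obtain s\<^sub>1 where s\<^sub>1_sec: "s\<^sub>1 \<in> carrier (tilde r n N W\<^sub>1)"
    "restrict (one U\<^sub>0) W\<^sub>1 = \<epsilon> W\<^sub>1 s\<^sub>1" by (elim imageE)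
  obtain W a u f where W: "openin ?T W" "P \<in> W" "W \<subseteq> W\<^sub>1"
    and a: "a \<in> degrees r" "u \<in> hpart N a" "f \<in> cox_part r n a"
    and f: "\<And>P. P \<in> W \<Longrightarrow> f \<notin> P" and s\<^sub>1: "\<And>P. P \<in> W \<Longrightarrow> s\<^sub>1 P = hfrac r n N P u f"
    using N.section_germ[OF s\<^sub>1_sec(1) W\<^sub>1(2)] by metis
  \<comment> \<open>A map of sheaves commutes with restriction, so u / f is a preimage of 1 on every smaller open set.\<close>
  have lift: "\<epsilon> V (\<lambda>P\<in>V. hfrac r n N P u f) = one V" if V: "openin ?T V" "V \<subseteq> W" for V
  proof -
    have "V \<subseteq> W\<^sub>1" using V W by blast
    have eq: "(\<lambda>P\<in>V. hfrac r n N P u f) = restrict s\<^sub>1 V"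
      using V s\<^sub>1 by (auto simp: fun_eq_iff)
    have "\<epsilon> V (restrict s\<^sub>1 V) = restrict (\<epsilon> W\<^sub>1 s\<^sub>1) V"
      using hom[unfolded sheaf_hom_def, rule_format, OF W\<^sub>1(1)] V(1) s\<^sub>1_sec(1) \<open>V \<subseteq> W\<^sub>1\<close> by blast
    also have "\<dots> = restrict (restrict (one U\<^sub>0) W\<^sub>1) V" by (simp only: s\<^sub>1_sec(2))
    also have "\<dots> = one V" using \<open>V \<subseteq> W\<^sub>1\<close> W\<^sub>1(3) unfolding one_def by (auto simp: fun_eq_iff)
    finally show ?thesis unfolding eq .
  qed
  have uC: "u \<in> carrier N" and fC: "f \<in> ?C" using a N.hpart_carrier cox_part_closed(1) by blast+
  have fr: "N.frac P u f" if "P \<in> W" for P by (rule N.fracI[OF a f[OF that]])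
  have sec: "(\<lambda>P\<in>V. hfrac r n N P u f) \<in> carrier (tilde r n N V)" if V: "openin ?T V" "V \<subseteq> W" for V
    using V f by (intro N.frac_section[OF V(1) a]) auto
  have zero_tilde: "\<zero>\<^bsub>tilde r n ?Q V\<^esub> = (\<lambda>P\<in>V. hfrac r n ?Q P \<zero>\<^bsub>?Q\<^esub> 1)" for V
    by (simp add: tilde_def stalk_def)
  have not_image: "t \<odot>\<^bsub>N\<^esub> u \<noteq> \<phi> w"
    if c: "c \<in> degrees r" and t: "t \<in> cox_part r n c - P" and w: "w \<in> hpart M (\<lambda>i. c i + a i)" for c t w
  proof
    assume eq: "t \<odot>\<^bsub>N\<^esub> u = \<phi> w"
    have th: "t \<in> homogeneous r n" and tC: "t \<in> ?C" using t c cox_part_closed(1) by (auto simp: homogeneous_def)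
    \<comment> \<open>On V the fraction u / f can be written as (t u) / (t f), which is in the image of \<phi>.\<close>
    define V where "V = W \<inter> {P \<in> points r n. t \<notin> P}"
    have V: "openin ?T V" "P \<in> V" "V \<subseteq> W" "V \<subseteq> points r n"
      using W t P openin_zariski_basic[OF th] by (auto simp: V_def)
    have tf: "t * f \<in> cox_part r n (\<lambda>i. c i + a i)" using t a cox_part_closed(4) by blast
    have ca: "(\<lambda>i. c i + a i) \<in> degrees r" by (rule degrees_closed(2)[OF c a(1)])
    have tfP: "t * f \<notin> P" if "P \<in> V" for P
      using primeideal_closed(3)[OF points_prime _ _, of P r n t f] that V f tC fC by (auto simp: V_def)
    define s where "s = (\<lambda>P\<in>V. hfrac r n M P w (t * f))"
    have s: "s \<in> carrier (tilde r n M V)" unfolding s_def by (rule M.frac_section[OF V(1) ca w tf tfP])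
    have \<phi>w: "\<phi> w \<in> hpart N (\<lambda>i. c i + a i)" using \<phi> w ca unfolding graded_hom_def by blast
    have "tilde_map r n N \<phi> V s P = hfrac r n N P u f" if P: "P \<in> V" for P
    proof -
      have prime: "primeideal P (cox_ring r n)" using P V points_prime by blast
      have "tilde_map r n N \<phi> V s P = hfrac r n N P (\<phi> w) (t * f)"
        using tilde_map_frac[OF M N \<phi> prime M.fracI[OF ca w tf tfP[OF P]]] P
        by (simp add: tilde_map_def s_def)
      also have "\<dots> = hfrac r n N P u f"
      proof (rule N.hfrac_eqI[OF prime])
        show "N.frac P (\<phi> w) (t * f)" by (rule N.fracI[OF ca \<phi>w tf tfP[OF P]])
        show "N.frac P u f" using P V by (intro fr) auto
        show "1 \<in> homogeneous r n - P" by (rule homogeneous_diff_one[OF prime])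
        show "1 \<odot>\<^bsub>N\<^esub> (f \<odot>\<^bsub>N\<^esub> \<phi> w) = 1 \<odot>\<^bsub>N\<^esub> ((t * f) \<odot>\<^bsub>N\<^esub> u)"
          unfolding eq[symmetric] by (simp add: N.smult_smult fC tC uC mult.commute)
      qed
      finally show ?thesis .
    qed
    then have "tilde_map r n N \<phi> V s = (\<lambda>P\<in>V. hfrac r n N P u f)"
      by (auto simp: fun_eq_iff tilde_map_def)
    then have "restrict (\<lambda>P\<in>V. hfrac r n N P u f) V \<in> tilde_map r n N \<phi> V ` carrier (tilde r n M V)"
      by (intro image_eqI[OF _ s]) simp
    then have "locally_in_image ?T (tilde r n M) (tilde_map r n N \<phi>) V (\<lambda>P\<in>V. hfrac r n N P u f)"
      using V(1) unfolding locally_in_image_def by blast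
    then have "\<epsilon> V (\<lambda>P\<in>V. hfrac r n N P u f) = \<zero>\<^bsub>tilde r n ?Q V\<^esub>"
      using exact V sec[OF V(1,3)] unfolding sheaf_exact_def by blast
    then have "one V = \<zero>\<^bsub>tilde r n ?Q V\<^esub>" by (simp only: lift[OF V(1,3)])
    from fun_cong[OF this, of P] have eq: "hfrac r n ?Q P (?cl 1) 1 = hfrac r n ?Q P \<zero>\<^bsub>?Q\<^esub> 1"
      using V(2) by (simp add: one_def zero_tilde)
    note prime = points_prime[OF P]
    have "Q.frac P \<zero>\<^bsub>?Q\<^esub> 1"
      by (rule Q.fracI[OF degrees_closed(1) Q.zero_hpart cox_part_closed(3) primeideal_closed(2)[OF prime]])
    then obtain q where q: "q \<in> homogeneous r n - P"
      "q \<odot>\<^bsub>?Q\<^esub> (1 \<odot>\<^bsub>?Q\<^esub> ?cl 1) = q \<odot>\<^bsub>?Q\<^esub> (1 \<odot>\<^bsub>?Q\<^esub> \<zero>\<^bsub>?Q\<^esub>)"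
      using Q.hfrac_eqD[OF prime _ eq] by blast
    have qC: "q \<in> ?C" using q homogeneous_closed(1) by blast
    have "?cl q = ?cl 0" using q(2) by (simp add: Q_zero Q_smult qC cox_ring_closed)
    then show False using cl_zero[OF qC] q I by blast
  qed
  have killed: "\<exists>t\<in>homogeneous r n - P. \<exists>w\<in>carrier M. t \<odot>\<^bsub>N\<^esub> (cox_var v \<odot>\<^bsub>N\<^esub> u) = \<phi> w"
    if v: "v \<in> cox_vars r n" and t: "t \<in> homogeneous r n - P" "t * cox_var v \<in> I" for v t
  proof -
    let ?x = "cox_var v :: 'k mpoly" and ?e = "\<lambda>k. if k = fst v then 1 else 0 :: int"
    have "fst v \<in> {1..r}" "\<not> irrelevant_ideal r n \<subseteq> P"
      using P v by (auto simp: points_def cox_vars_def)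
    then obtain j where j: "j \<le> n (fst v)" "cox_var (fst v, j) \<notin> P"
      using not_irrelevant_subset[OF primeideal_closed(1)[OF points_prime[OF P]]] by blast
    \<comment> \<open>The variable has degree e, so it acts on sections only through the fraction x / y of degree zero.\<close>
    define y where "y = (cox_var (fst v, j) :: 'k mpoly)"
    have yv: "(fst v, j) \<in> cox_vars r n" using v j by (auto simp: cox_vars_def)
    have e: "?e \<in> degrees r" using v by (auto simp: cox_vars_def degrees_def)
    have x: "?x \<in> cox_part r n ?e" by (rule cox_part_closed(5)[OF v])
    have y: "y \<in> cox_part r n ?e" unfolding y_def using cox_part_closed(5)[OF yv] by simp
    have yh: "y \<in> homogeneous r n" unfolding y_def by (rule homogeneous_closed(4)[OF yv])
    have C: "?x \<in> ?C" "y \<in> ?C" "t \<in> ?C" using x y t cox_part_closed(1) homogeneous_closed(1) by blast+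
    define V where "V = W \<inter> {P \<in> points r n. y \<notin> P} \<inter> {P \<in> points r n. t \<notin> P}"
    have V: "openin ?T V" "P \<in> V" "V \<subseteq> W" "V \<subseteq> points r n" "\<And>P. P \<in> V \<Longrightarrow> y \<notin> P \<and> t \<notin> P"
      using W t P j openin_zariski_basic[OF yh] openin_zariski_basic[of t r n] by (auto simp: V_def y_def)
    define q where "q = (\<lambda>P\<in>V. hfrac r n (cox_module r n) P ?x y)"
    define s where "s = (\<lambda>P\<in>V. hfrac r n N P u f)"
    interpret O: graded_scaling r n "cox_module r n :: ('k mpoly, 'k mpoly) graded_module"
      by (rule cox_module_graded_scaling)
    have q: "q \<in> carrier (structure_sheaf r n V)"
      unfolding q_def using V x y by (intro O.frac_section[OF V(1) e]) (auto simp: cox_module_simps)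
    have s: "s \<in> carrier (tilde r n N V)" unfolding s_def by (rule sec[OF V(1,3)])
    have ea: "(\<lambda>k. ?e k + a k) \<in> degrees r" by (rule degrees_closed(2)[OF e a(1)])
    have xu: "?x \<odot>\<^bsub>N\<^esub> u \<in> hpart N (\<lambda>k. ?e k + a k)" by (rule N.smult_hpart[OF x a(2)])
    have yf: "y * f \<in> cox_part r n (\<lambda>k. ?e k + a k)" by (rule cox_part_closed(4)[OF y a(3)])
    have yfP: "y * f \<notin> P" if "P \<in> V" for P
      using primeideal_closed(3)[OF points_prime _ _, of P r n y f] that V f C fC by blast
    have qs: "q \<odot>\<^bsub>tilde r n N V\<^esub> s = (\<lambda>P\<in>V. hfrac r n N P (?x \<odot>\<^bsub>N\<^esub> u) (y * f))"
    proof (rule ext)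
      fix P
      show "(q \<odot>\<^bsub>tilde r n N V\<^esub> s) P = (\<lambda>P\<in>V. hfrac r n N P (?x \<odot>\<^bsub>N\<^esub> u) (y * f)) P"
      proof (cases "P \<in> V")
        case True
        then have "primeideal P (cox_ring r n)" "y \<in> cox_part r n ?e - P" "N.frac P u f"
          using V y fr points_prime by blast+
        from smult_frac[OF N this(1) e x this(2,3)] show ?thesis
          using True by (simp add: tilde_def q_def s_def)
      qed (simp add: tilde_def)
    qed
    have "\<epsilon> V (q \<odot>\<^bsub>tilde r n N V\<^esub> s) = q \<odot>\<^bsub>tilde r n ?Q V\<^esub> \<epsilon> V s"
      using hom V(1) q s unfolding sheaf_hom_def by blast
    also have "\<epsilon> V s = one V" unfolding s_def by (rule lift[OF V(1,3)])
    also have "q \<odot>\<^bsub>tilde r n ?Q V\<^esub> one V = \<zero>\<^bsub>tilde r n ?Q V\<^esub>"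
    proof (rule ext)
      fix P
      show "(q \<odot>\<^bsub>tilde r n ?Q V\<^esub> one V) P = \<zero>\<^bsub>tilde r n ?Q V\<^esub> P"
      proof (cases "P \<in> V")
        case True
        then have prime: "primeideal P (cox_ring r n)" and yP: "y \<in> cox_part r n ?e - P"
          using V y points_prime by blast+
        have fr1: "Q.frac P (?cl 1) 1"
          by (rule Q.fracI[OF degrees_closed(1) cl_hpart[OF cox_part_closed(3)] cox_part_closed(3)
              primeideal_closed(2)[OF prime]])
        have "hfrac r n ?Q P (?x \<odot>\<^bsub>?Q\<^esub> ?cl 1) (y * 1) = hfrac r n ?Q P \<zero>\<^bsub>?Q\<^esub> 1"
        proof (rule Q.hfrac_eqI[OF prime])
          have "?x \<odot>\<^bsub>?Q\<^esub> ?cl 1 = ?cl ?x" using Q_smult[of ?x 1] C by (simp add: cox_ring_closed)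
          then show "Q.frac P (?x \<odot>\<^bsub>?Q\<^esub> ?cl 1) (y * 1)"
            using yP cl_hpart[OF x] by (intro Q.fracI[OF e]) auto
          show "Q.frac P \<zero>\<^bsub>?Q\<^esub> 1"
            by (rule Q.fracI[OF degrees_closed(1) Q.zero_hpart cox_part_closed(3) primeideal_closed(2)[OF prime]])
          show "t \<in> homogeneous r n - P" using t V True by blast
          have "?cl (t * ?x) = ?cl 0" using cl_zero[of "t * ?x"] t C by (simp add: cox_ring_closed)
          then show "t \<odot>\<^bsub>?Q\<^esub> (1 \<odot>\<^bsub>?Q\<^esub> (?x \<odot>\<^bsub>?Q\<^esub> ?cl 1)) = t \<odot>\<^bsub>?Q\<^esub> ((y * 1) \<odot>\<^bsub>?Q\<^esub> \<zero>\<^bsub>?Q\<^esub>)"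
            using C by (simp add: Q_zero Q_smult cox_ring_closed)
        qed
        with smult_frac[OF Q.graded_scaling_axioms prime e x yP fr1] show ?thesis
          using True unfolding zero_tilde by (simp add: tilde_def q_def one_def)
      qed (simp add: tilde_def)
    qed
    finally have "\<epsilon> V (\<lambda>P\<in>V. hfrac r n N P (?x \<odot>\<^bsub>N\<^esub> u) (y * f)) = \<zero>\<^bsub>tilde r n ?Q V\<^esub>"
      unfolding qs .
    moreover have "(\<lambda>P\<in>V. hfrac r n N P (?x \<odot>\<^bsub>N\<^esub> u) (y * f)) \<in> carrier (tilde r n N V)"
      by (rule N.frac_section[OF V(1) ea xu yf yfP])
    ultimately have "locally_in_image ?T (tilde r n M) (tilde_map r n N \<phi>) V
        (\<lambda>P\<in>V. hfrac r n N P (?x \<odot>\<^bsub>N\<^esub> u) (y * f))"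
      using exact V(1) unfolding sheaf_exact_def by blast
    from germ_in_image[OF M N \<phi> P V(2) N.fracI[OF ea xu yf yfP[OF V(2)]] _ this] show ?thesis
      using V(2) by simp
  qed
  show ?thesis using a(1,2) not_image killed by blast
qed

section \<open>Homogeneous components in free modules\<close>

text \<open>The elements of the form on the right-hand side constitute an ideal that contains the generators.\<close>

lemma var_ideal_insert_split:
  fixes f :: "'k::field mpoly"
  assumes "f \<in> var_ideal r n (insert v V)" "insert v V \<subseteq> cox_vars r n"
  shows "\<exists>g\<in>carrier (cox_ring r n). \<exists>j\<in>var_ideal r n V. f = cox_var v * g + j"
proof -
  define K where "K = {cox_var v * g + j | g j :: 'k mpoly. g \<in> carrier (cox_ring r n) \<and> j \<in> var_ideal r n V}"
  note V = ideal_closed[OF ideal_var_ideal[of r n V]]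
  have KI: "cox_var v * g + j \<in> K" if "g \<in> carrier (cox_ring r n)" "j \<in> var_ideal r n V" for g j
    using that by (auto simp: K_def)
  have K: "ideal K (cox_ring r n)"
  proof (rule cox_ring_idealI)
    show "K \<subseteq> carrier (cox_ring r n)"
      using V(1) assms(2) by (auto simp: K_def intro!: cox_ring_closed cox_var_closed)
    show "0 \<in> K" using KI[OF cox_ring_closed(1) V(2)] by simp
  next
    fix x y :: "'k mpoly" assume "x \<in> K" "y \<in> K"
    then obtain g j g' j' where g: "g \<in> carrier (cox_ring r n)" "g' \<in> carrier (cox_ring r n)"
      and j: "j \<in> var_ideal r n V" "j' \<in> var_ideal r n V"
      and xy: "x = cox_var v * g + j" "y = cox_var v * g' + j'" unfolding K_def by blast
    have "x + y = cox_var v * (g + g') + (j + j')" by (simp add: xy distrib_left)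
    then show "x + y \<in> K" using KI[OF cox_ring_closed(3)[OF g] V(3)[OF j]] by simp
  next
    fix h y :: "'k mpoly" assume h: "h \<in> carrier (cox_ring r n)" and "y \<in> K"
    then obtain g j where g: "g \<in> carrier (cox_ring r n)" and j: "j \<in> var_ideal r n V"
      and y: "y = cox_var v * g + j" unfolding K_def by blast
    have "h * y = cox_var v * (h * g) + h * j" by (simp add: y distrib_left mult.left_commute)
    then show "h * y \<in> K" using KI[OF cox_ring_closed(4)[OF h g] V(4)[OF j h]] by simp
  qed
  have "cox_var w \<in> K" if w: "w \<in> insert v V" for w
  proof (cases "w = v")
    case True
    then show ?thesis using KI[OF cox_ring_closed(2) V(2)] by simp
  next
    case False
    then have "cox_var w \<in> (var_ideal r n V :: 'k mpoly set)"
      using w assms(2) var_ideal_subset_iff[OF ideal_var_ideal, of V r n] by blast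
    then show ?thesis using KI[OF cox_ring_closed(1)] by fastforce
  qed
  then have "f \<in> K" using var_ideal_subset_iff[OF K assms(2)] assms(1) by blast
  then show ?thesis unfolding K_def by blast
qed

lemma free_module_simps:
  "carrier (free_module r n as) = {..<length as} \<rightarrow>\<^sub>E carrier (cox_ring r n)"
  "\<zero>\<^bsub>free_module r n as\<^esub> = (\<lambda>k\<in>{..<length as}. 0)"
  "u \<oplus>\<^bsub>free_module r n as\<^esub> v = (\<lambda>k\<in>{..<length as}. u k + v k)"
  "f \<odot>\<^bsub>free_module r n as\<^esub> u = (\<lambda>k\<in>{..<length as}. f * u k)"
  "hpart (free_module r n as) b = (\<Pi>\<^sub>E k\<in>{..<length as}. cox_part r n (\<lambda>i. b i - (as ! k) i))"
  by (simp_all add: free_module_def)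

lemma free_module_closed:
  "\<zero>\<^bsub>free_module r n as\<^esub> \<in> carrier (free_module r n as)"
  "u \<in> carrier (free_module r n as) \<Longrightarrow> v \<in> carrier (free_module r n as) \<Longrightarrow>
    u \<oplus>\<^bsub>free_module r n as\<^esub> v \<in> carrier (free_module r n as)"
  "f \<in> carrier (cox_ring r n) \<Longrightarrow> u \<in> carrier (free_module r n as) \<Longrightarrow>
    f \<odot>\<^bsub>free_module r n as\<^esub> u \<in> carrier (free_module r n as)"
  by (auto simp: free_module_simps cox_ring_closed PiE_iff)

definition hom_component :: "(nat \<Rightarrow> nat) \<Rightarrow> (nat \<Rightarrow> int) list \<Rightarrow> (nat \<Rightarrow> int) \<Rightarrow> (nat \<Rightarrow> 'k::field mpoly) \<Rightarrow> nat \<Rightarrow> 'k mpoly" where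
  "hom_component n as b u = (\<lambda>k\<in>{..<length as}. mon_part {m. mdeg n m = (\<lambda>i. b i - (as ! k) i)} (u k))"

lemma hom_component_hpart:
  "u \<in> carrier (free_module r n as) \<Longrightarrow> hom_component n as b u \<in> hpart (free_module r n as) b"
  by (auto simp: hom_component_def free_module_simps cox_part_def cox_ring_closed keys_mon_part PiE_iff)

lemma hom_component_closed:
  "u \<in> carrier (free_module r n as) \<Longrightarrow> hom_component n as b u \<in> carrier (free_module r n as)"
  by (auto simp: hom_component_def free_module_simps cox_ring_closed PiE_iff)

lemma hom_component_hom:
  assumes "u \<in> hpart (free_module r n as) b"
  shows "hom_component n as c u = (if c = b then u else \<zero>\<^bsub>free_module r n as\<^esub>)"
proof -
  have u: "u k \<in> cox_part r n (\<lambda>i. b i - (as ! k) i)" if "k < length as" for k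
    using assms that by (auto simp: free_module_simps PiE_iff)
  have "mon_part {m. mdeg n m = (\<lambda>i. c i - (as ! k) i)} (u k) = (if c = b then u k else 0)"
    if "k < length as" for k
  proof (rule poly_mapping_eqI)
    fix m
    have "mdeg n m = (\<lambda>i. b i - (as ! k) i)" if "Poly_Mapping.lookup (u k) m \<noteq> 0"
      using u[OF \<open>k < length as\<close>] that by (auto simp: cox_part_def in_keys_iff)
    moreover have "(\<lambda>i. b i - (as ! k) i) = (\<lambda>i. c i - (as ! k) i) \<longleftrightarrow> c = b"
      by (auto simp: fun_eq_iff)
    ultimately show "Poly_Mapping.lookup (mon_part {m. mdeg n m = (\<lambda>i. c i - (as ! k) i)} (u k)) m
      = Poly_Mapping.lookup (if c = b then u k else 0) m"
      by (cases "Poly_Mapping.lookup (u k) m = 0") (simp_all add: lookup_mon_part)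
  qed
  moreover have "u \<in> extensional {..<length as}" using assms by (simp add: free_module_simps PiE_iff)
  ultimately show ?thesis by (auto simp: hom_component_def free_module_simps fun_eq_iff extensional_def)
qed

lemma hom_component_add:
  "hom_component n as b (u \<oplus>\<^bsub>free_module r n as\<^esub> v) = hom_component n as b u \<oplus>\<^bsub>free_module r n as\<^esub> hom_component n as b v"
  by (auto simp: hom_component_def free_module_simps mon_part_add fun_eq_iff)

lemma hom_component_zero: "hom_component n as b \<zero>\<^bsub>free_module r n as\<^esub> = \<zero>\<^bsub>free_module r n as\<^esub>"
  by (auto simp: hom_component_def free_module_simps mon_part_0 fun_eq_iff)

text \<open>An element of a free module is the sum of its homogeneous components of finitely many degrees, so a
  property that passes to sums with such a component can be proved for it.\<close>

lemma hom_component_induct: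
  fixes u :: "nat \<Rightarrow> 'k::field mpoly"
  assumes as: "set as \<subseteq> degrees r" and u: "u \<in> carrier (free_module r n as)"
    and zero: "Pr \<zero>\<^bsub>free_module r n as\<^esub>"
    and step: "\<And>b v. b \<in> degrees r \<Longrightarrow> v \<in> carrier (free_module r n as) \<Longrightarrow> Pr v \<Longrightarrow>
      Pr (hom_component n as b u \<oplus>\<^bsub>free_module r n as\<^esub> v)"
  shows "Pr u"
proof -
  define D where "D = (\<Union>k<length as. (\<lambda>m i. mdeg n m i + (as ! k) i) ` Poly_Mapping.keys (u k))"
  have fin: "finite D" by (simp add: D_def)
  have "mdeg n m \<in> degrees r" if "k < length as" "m \<in> Poly_Mapping.keys (u k)" for k m
    using u that by (intro mdeg_degrees) (auto simp: free_module_simps PiE_iff in_cox_ring)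
  then have D: "D \<subseteq> degrees r" using as by (auto simp: D_def intro!: degrees_closed dest: nth_mem)
  define \<sigma> where "\<sigma> D = (\<lambda>k\<in>{..<length as}. \<Sum>b\<in>D. hom_component n as b u k)" for D
  have "\<sigma> E \<in> carrier (free_module r n as) \<and> Pr (\<sigma> E)" if "finite E" "E \<subseteq> degrees r" for E
    using that
  proof (induction E)
    case empty
    have "\<sigma> {} = \<zero>\<^bsub>free_module r n as\<^esub>" by (simp add: \<sigma>_def free_module_simps)
    then show ?case using zero free_module_closed(1) by metis
  next
    case (insert b E)
    have "\<sigma> (insert b E) = hom_component n as b u \<oplus>\<^bsub>free_module r n as\<^esub> \<sigma> E"
      using insert by (auto simp: \<sigma>_def free_module_simps fun_eq_iff)
    then show ?case
      using insert step[of b "\<sigma> E"] free_module_closed(2)[OF hom_component_closed[OF u]] by simp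
  qed
  moreover have "\<sigma> D = u"
  proof
    fix k
    show "\<sigma> D k = u k"
    proof (cases "k < length as")
      case True
      have "(\<Sum>b\<in>D. hom_component n as b u k) = u k"
      proof (rule poly_mapping_eqI)
        fix m
        let ?b = "\<lambda>i. mdeg n m i + (as ! k) i"
        have *: "mdeg n m = (\<lambda>i. b i - (as ! k) i) \<longleftrightarrow> b = ?b" for b
          by (auto simp: fun_eq_iff)
        have "Poly_Mapping.lookup (\<Sum>b\<in>D. hom_component n as b u k) m
          = (\<Sum>b\<in>D. if b = ?b then Poly_Mapping.lookup (u k) m else 0)"
          using True by (simp add: lookup_sum hom_component_def lookup_mon_part *)
        also have "\<dots> = (if ?b \<in> D then Poly_Mapping.lookup (u k) m else 0)"
          using fin by simp
        also have "\<dots> = Poly_Mapping.lookup (u k) m"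
        proof -
          have "?b \<in> D" if "m \<in> Poly_Mapping.keys (u k)" using that True unfolding D_def by blast
          then show ?thesis by (auto simp: in_keys_iff)
        qed
        finally show "Poly_Mapping.lookup (\<Sum>b\<in>D. hom_component n as b u k) m = Poly_Mapping.lookup (u k) m" .
      qed
      then show ?thesis using True by (simp add: \<sigma>_def)
    next
      case False
      then show ?thesis using u by (auto simp: \<sigma>_def free_module_simps PiE_iff extensional_def)
    qed
  qed
  ultimately show ?thesis using fin D by metis
qed

lemma graded_homD:
  assumes "graded_hom r n (free_module r n as) (free_module r n bs) \<phi>"
  shows "u \<in> carrier (free_module r n as) \<Longrightarrow> \<phi> u \<in> carrier (free_module r n bs)"
    "u \<in> carrier (free_module r n as) \<Longrightarrow> v \<in> carrier (free_module r n as) \<Longrightarrow>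
      \<phi> (u \<oplus>\<^bsub>free_module r n as\<^esub> v) = \<phi> u \<oplus>\<^bsub>free_module r n bs\<^esub> \<phi> v"
    "f \<in> carrier (cox_ring r n) \<Longrightarrow> u \<in> carrier (free_module r n as) \<Longrightarrow>
      \<phi> (f \<odot>\<^bsub>free_module r n as\<^esub> u) = f \<odot>\<^bsub>free_module r n bs\<^esub> \<phi> u"
    "b \<in> degrees r \<Longrightarrow> u \<in> hpart (free_module r n as) b \<Longrightarrow> \<phi> u \<in> hpart (free_module r n bs) b"
    "\<phi> \<zero>\<^bsub>free_module r n as\<^esub> = \<zero>\<^bsub>free_module r n bs\<^esub>"
proof -
  show lin: "\<phi> (f \<odot>\<^bsub>free_module r n as\<^esub> u) = f \<odot>\<^bsub>free_module r n bs\<^esub> \<phi> u"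
    if "f \<in> carrier (cox_ring r n)" "u \<in> carrier (free_module r n as)" for f u
    using assms that unfolding graded_hom_def by blast
  have "\<phi> (0 \<odot>\<^bsub>free_module r n as\<^esub> \<zero>\<^bsub>free_module r n as\<^esub>)
      = 0 \<odot>\<^bsub>free_module r n bs\<^esub> \<phi> \<zero>\<^bsub>free_module r n as\<^esub>"
    by (rule lin[OF cox_ring_closed(1) free_module_closed(1)])
  then show "\<phi> \<zero>\<^bsub>free_module r n as\<^esub> = \<zero>\<^bsub>free_module r n bs\<^esub>"
    by (simp add: free_module_simps cong: restrict_cong)
qed (use assms in \<open>unfold graded_hom_def, blast+\<close>)

lemma hom_component_graded_hom:
  fixes u :: "nat \<Rightarrow> 'k::field mpoly"
  assumes \<phi>: "graded_hom r n (free_module r n as) (free_module r n bs) \<phi>" and as: "set as \<subseteq> degrees r"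
    and u: "u \<in> carrier (free_module r n as)" and b: "b \<in> degrees r"
  shows "hom_component n bs b (\<phi> u) = \<phi> (hom_component n as b u)"
proof (rule hom_component_induct[OF as u])
  note \<phi> = graded_homD[OF \<phi>]
  show "hom_component n bs b (\<phi> \<zero>\<^bsub>free_module r n as\<^esub>) = \<phi> (hom_component n as b \<zero>\<^bsub>free_module r n as\<^esub>)"
    by (simp only: \<phi>(5) hom_component_zero)
  fix c v assume c: "c \<in> degrees r" and v: "v \<in> carrier (free_module r n as)"
    and IH: "hom_component n bs b (\<phi> v) = \<phi> (hom_component n as b v)"
  have h: "hom_component n bs b (\<phi> (hom_component n as c u)) = \<phi> (hom_component n as b (hom_component n as c u))"
    using hom_component_hom[OF \<phi>(4)[OF c hom_component_hpart[OF u]], of b] hom_component_hom[OF hom_component_hpart[OF u], of b c]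
    by (simp add: \<phi>(5))
  show "hom_component n bs b (\<phi> (hom_component n as c u \<oplus>\<^bsub>free_module r n as\<^esub> v))
    = \<phi> (hom_component n as b (hom_component n as c u \<oplus>\<^bsub>free_module r n as\<^esub> v))"
    by (simp only: \<phi>(2)[OF hom_component_closed[OF u] v] hom_component_add h IH
        \<phi>(2)[OF hom_component_closed[OF hom_component_closed[OF u]] hom_component_closed[OF v]])
qed


section \<open>The bound on the length of a virtual resolution\<close>

text \<open>Both statements hold for homogeneous elements by the lemmas about stalks. The differentials commute with
  taking homogeneous components, so the first one extends to sums of homogeneous elements, and in the
  second one a preimage of the homogeneous element \<open>t u\<close> may be replaced by its component of the same degree.\<close>

lemma virtual_resolution_stalk:
  fixes I P :: "'k::field mpoly set" and a :: "nat \<Rightarrow> (nat \<Rightarrow> int) list"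
    and d :: "nat \<Rightarrow> (nat \<Rightarrow> 'k mpoly) \<Rightarrow> (nat \<Rightarrow> 'k mpoly)"
  assumes res: "virtual_resolution r n I p a d"
    and I: "ideal I (cox_ring r n)" "I \<subseteq> P" and P: "P \<in> points r n"
  defines "F \<equiv> \<lambda>i. free_module r n (a i) :: ('k mpoly, nat \<Rightarrow> 'k mpoly) graded_module"
  shows "\<And>i u. u \<in> carrier (F (Suc i)) \<Longrightarrow> d i u = \<zero>\<^bsub>F i\<^esub> \<Longrightarrow>
      \<exists>t\<in>homogeneous r n - P. \<exists>w\<in>carrier (F (Suc (Suc i))). t \<odot>\<^bsub>F (Suc i)\<^esub> u = d (Suc i) w"
    "\<exists>u\<in>carrier (F 0). (\<forall>t\<in>homogeneous r n - P. \<forall>w\<in>carrier (F (Suc 0)). t \<odot>\<^bsub>F 0\<^esub> u \<noteq> d 0 w) \<and>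
      (\<forall>v\<in>cox_vars r n. (\<exists>t\<in>homogeneous r n - P. t * cox_var v \<in> I) \<longrightarrow>
        (\<exists>t\<in>homogeneous r n - P. \<exists>w\<in>carrier (F (Suc 0)). t \<odot>\<^bsub>F 0\<^esub> (cox_var v \<odot>\<^bsub>F 0\<^esub> u) = d 0 w))"
proof -
  have as: "set (a i) \<subseteq> degrees r" and d: "graded_hom r n (F (Suc i)) (F i) (d i)"
    and exact: "sheaf_exact (zariski r n) (tilde r n (F (Suc (Suc i)))) (tilde r n (F (Suc i)))
      (tilde r n (F i)) (tilde_map r n (F (Suc i)) (d (Suc i))) (tilde_map r n (F i) (d i))" for i
    using res unfolding virtual_resolution_def Let_def F_def by blast+
  obtain \<epsilon> where \<epsilon>: "sheaf_hom (zariski r n) (structure_sheaf r n) (tilde r n (F 0)) (tilde r n (quotient_module r n I)) \<epsilon>"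
    "sheaf_surjective (zariski r n) (tilde r n (F 0)) (tilde r n (quotient_module r n I)) \<epsilon>"
    "sheaf_exact (zariski r n) (tilde r n (F (Suc 0))) (tilde r n (F 0)) (tilde r n (quotient_module r n I))
      (tilde_map r n (F 0) (d 0)) \<epsilon>"
    using res unfolding virtual_resolution_def Let_def F_def by blast
  have F_fold: "free_module r n (a i) = F i" for i by (simp add: F_def)
  have F: "graded_scaling r n (F i)" for i unfolding F_def by (rule free_module_graded_scaling)
  note prime = points_prime[OF P]
  note dD = graded_homD[OF d[unfolded F_def], unfolded F_fold]
  have closed: "\<zero>\<^bsub>F i\<^esub> \<in> carrier (F i)"
    "u \<in> carrier (F i) \<Longrightarrow> v \<in> carrier (F i) \<Longrightarrow> u \<oplus>\<^bsub>F i\<^esub> v \<in> carrier (F i)"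
    "f \<in> carrier (cox_ring r n) \<Longrightarrow> u \<in> carrier (F i) \<Longrightarrow> f \<odot>\<^bsub>F i\<^esub> u \<in> carrier (F i)" for i f u v
    unfolding F_def by (fact free_module_closed)+
  show "\<exists>t\<in>homogeneous r n - P. \<exists>w\<in>carrier (F (Suc (Suc i))). t \<odot>\<^bsub>F (Suc i)\<^esub> u = d (Suc i) w"
    if u: "u \<in> carrier (F (Suc i))" "d i u = \<zero>\<^bsub>F i\<^esub>" for i u
  proof (rule hom_component_induct[OF as u(1)[unfolded F_def], unfolded F_fold])
    interpret graded_scaling r n "F (Suc i)" by (rule F)
    have "1 \<odot>\<^bsub>F (Suc i)\<^esub> \<zero>\<^bsub>F (Suc i)\<^esub> = d (Suc i) \<zero>\<^bsub>F (Suc (Suc i))\<^esub>"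
      by (simp only: smult_zero cox_ring_closed dD(5))
    then show "\<exists>t\<in>homogeneous r n - P. \<exists>w\<in>carrier (F (Suc (Suc i))).
        t \<odot>\<^bsub>F (Suc i)\<^esub> \<zero>\<^bsub>F (Suc i)\<^esub> = d (Suc i) w"
      using homogeneous_diff_one[OF prime] closed(1) by blast
    fix b v assume b: "b \<in> degrees r" and v: "v \<in> carrier (F (Suc i))"
      and "\<exists>t\<in>homogeneous r n - P. \<exists>w\<in>carrier (F (Suc (Suc i))). t \<odot>\<^bsub>F (Suc i)\<^esub> v = d (Suc i) w"
    then obtain t w where t: "t \<in> homogeneous r n - P" "w \<in> carrier (F (Suc (Suc i)))"
      "t \<odot>\<^bsub>F (Suc i)\<^esub> v = d (Suc i) w" by blast
    let ?u = "hom_component n (a (Suc i)) b u"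
    have "d i ?u = \<zero>\<^bsub>F i\<^esub>"
      using hom_component_graded_hom[OF d[unfolded F_def] as u(1)[unfolded F_def] b] u(2)
      by (simp add: F_def hom_component_zero)
    moreover have "?u \<in> hpart (F (Suc i)) b"
      unfolding F_def by (rule hom_component_hpart[OF u(1)[unfolded F_def]])
    ultimately obtain t' w' where t': "t' \<in> homogeneous r n - P" "w' \<in> carrier (F (Suc (Suc i)))"
      "t' \<odot>\<^bsub>F (Suc i)\<^esub> ?u = d (Suc i) w'"
      using stalk_exact[OF F F F d d exact P b] by blast
    have C: "t \<in> carrier (cox_ring r n)" "t' \<in> carrier (cox_ring r n)"
      using t t' homogeneous_closed(1) by blast+
    have "(t * t') \<odot>\<^bsub>F (Suc i)\<^esub> (?u \<oplus>\<^bsub>F (Suc i)\<^esub> v)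
        = (t \<odot>\<^bsub>F (Suc i)\<^esub> (t' \<odot>\<^bsub>F (Suc i)\<^esub> ?u)) \<oplus>\<^bsub>F (Suc i)\<^esub> (t' \<odot>\<^bsub>F (Suc i)\<^esub> (t \<odot>\<^bsub>F (Suc i)\<^esub> v))"
      by (auto simp: F_def free_module_simps fun_eq_iff algebra_simps)
    also have "\<dots> = d (Suc i) (t \<odot>\<^bsub>F (Suc (Suc i))\<^esub> w' \<oplus>\<^bsub>F (Suc (Suc i))\<^esub> t' \<odot>\<^bsub>F (Suc (Suc i))\<^esub> w)"
      by (simp only: t(3) t'(3) dD(2,3) C t(2) t'(2) closed)
    finally show "\<exists>t\<in>homogeneous r n - P. \<exists>w\<in>carrier (F (Suc (Suc i))).
        t \<odot>\<^bsub>F (Suc i)\<^esub> (?u \<oplus>\<^bsub>F (Suc i)\<^esub> v) = d (Suc i) w"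
      using homogeneous_diff_mult[OF prime t(1) t'(1)] closed(2)[OF closed(3)[OF C(1) t'(2)] closed(3)[OF C(2) t(2)]]
      by blast
  qed
  interpret F0: graded_scaling r n "F 0" by (rule F)
  obtain e u where e: "e \<in> degrees r" and u: "u \<in> hpart (F 0) e"
    and not_image: "\<And>c t w. c \<in> degrees r \<Longrightarrow> t \<in> cox_part r n c - P \<Longrightarrow> w \<in> hpart (F (Suc 0)) (\<lambda>i. c i + e i) \<Longrightarrow>
      t \<odot>\<^bsub>F 0\<^esub> u \<noteq> d 0 w"
    and killed: "\<forall>v\<in>cox_vars r n. (\<exists>t\<in>homogeneous r n - P. t * cox_var v \<in> I) \<longrightarrow>
      (\<exists>t\<in>homogeneous r n - P. \<exists>w\<in>carrier (F (Suc 0)). t \<odot>\<^bsub>F 0\<^esub> (cox_var v \<odot>\<^bsub>F 0\<^esub> u) = d 0 w)"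
    using augmentation_generator[OF F F d I P \<epsilon>] by blast
  have "t \<odot>\<^bsub>F 0\<^esub> u \<noteq> d 0 w" if t: "t \<in> homogeneous r n - P" and w: "w \<in> carrier (F (Suc 0))" for t w
  proof
    assume eq: "t \<odot>\<^bsub>F 0\<^esub> u = d 0 w"
    obtain c where c: "c \<in> degrees r" "t \<in> cox_part r n c - P" using t by (auto simp: homogeneous_def)
    let ?b = "\<lambda>i. c i + e i"
    have b: "?b \<in> degrees r" by (rule degrees_closed(2)[OF c(1) e])
    have "t \<odot>\<^bsub>F 0\<^esub> u \<in> hpart (F 0) ?b" using c u by (intro F0.smult_hpart) auto
    then have "hom_component n (a 0) ?b (t \<odot>\<^bsub>F 0\<^esub> u) = t \<odot>\<^bsub>F 0\<^esub> u"
      using hom_component_hom[where r = r and n = n and as = "a 0" and b = ?b and c = ?b] unfolding F_def by simp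
    moreover have "hom_component n (a 0) ?b (d 0 w) = d 0 (hom_component n (a (Suc 0)) ?b w)"
      by (rule hom_component_graded_hom[OF d[unfolded F_def] as w[unfolded F_def] b])
    ultimately have "t \<odot>\<^bsub>F 0\<^esub> u = d 0 (hom_component n (a (Suc 0)) ?b w)" by (simp only: eq)
    moreover have "hom_component n (a (Suc 0)) ?b w \<in> hpart (F (Suc 0)) ?b"
      unfolding F_def by (rule hom_component_hpart[OF w[unfolded F_def]])
    ultimately show False using not_image[OF c] by blast
  qed
  then show "\<exists>u\<in>carrier (F 0). (\<forall>t\<in>homogeneous r n - P. \<forall>w\<in>carrier (F (Suc 0)). t \<odot>\<^bsub>F 0\<^esub> u \<noteq> d 0 w) \<and>
      (\<forall>v\<in>cox_vars r n. (\<exists>t\<in>homogeneous r n - P. t * cox_var v \<in> I) \<longrightarrow>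
        (\<exists>t\<in>homogeneous r n - P. \<exists>w\<in>carrier (F (Suc 0)). t \<odot>\<^bsub>F 0\<^esub> (cox_var v \<odot>\<^bsub>F 0\<^esub> u) = d 0 w))"
    using killed u F0.hpart_carrier by blast
qed

text \<open>The complex is free and the variables in \<open>X\<close> are a regular sequence on \<open>S\<close>, since each of them lies outside
  the prime ideal generated by the previous ones. So \<open>length_ge\<close> applies to the complex.\<close>

lemma card_le_length:
  fixes I P :: "'k::field mpoly set" and a :: "nat \<Rightarrow> (nat \<Rightarrow> int) list"
    and d :: "nat \<Rightarrow> (nat \<Rightarrow> 'k mpoly) \<Rightarrow> (nat \<Rightarrow> 'k mpoly)"
  assumes res: "virtual_resolution r n I p a d"
    and I: "ideal I (cox_ring r n)" "I \<subseteq> P" and P: "P \<in> points r n"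
    and X: "X \<subseteq> cox_vars r n"
    and killed: "\<And>v. v \<in> X \<Longrightarrow> \<exists>t\<in>homogeneous r n - P. t * cox_var v \<in> I"
  shows "card X \<le> p"
proof -
  define C where "C = (carrier (cox_ring r n) :: 'k mpoly set)"
  define F where "F = (\<lambda>i. free_module r n (a i) :: ('k mpoly, nat \<Rightarrow> 'k mpoly) graded_module)"
  \<comment> \<open>The elements of the free modules are undefined outside a finite set of indices. The sets G i contain the same vectors with the value 0 there, so that they are closed under addition of functions.\<close>
  define G where "G = (\<lambda>i. {u :: nat \<Rightarrow> 'k mpoly. (\<forall>k<length (a i). u k \<in> C) \<and> (\<forall>k\<ge>length (a i). u k = 0)})"
  define extend where "extend = (\<lambda>i (u :: nat \<Rightarrow> 'k mpoly) k. if k < length (a i) then u k else 0)"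
  define shrink where "shrink = (\<lambda>i (u :: nat \<Rightarrow> 'k mpoly). \<lambda>k\<in>{..<length (a i)}. u k)"
  define scale where "scale = (\<lambda>(f :: 'k mpoly) (u :: nat \<Rightarrow> 'k mpoly) k. f * u k)"
  define D where "D = (\<lambda>i u. extend i (d i (shrink (Suc i) u)))"
  define S where "S = homogeneous r n - P"
  have bounded: "a i = []" if "i > p" for i
    using res that unfolding virtual_resolution_def Let_def by blast
  have d: "graded_hom r n (F (Suc i)) (F i) (d i)" for i
    using res unfolding virtual_resolution_def Let_def F_def by blast
  have dd: "d i (d (Suc i) v) = \<zero>\<^bsub>F i\<^esub>" if "v \<in> carrier (F (Suc (Suc i)))" for i v
    using res that unfolding virtual_resolution_def Let_def F_def by blast
  have F_fold: "free_module r n (a i) = F i" for i by (simp add: F_def)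
  note dD = graded_homD[OF d[unfolded F_def], unfolded F_fold]
  note stalk = virtual_resolution_stalk[OF res I P, unfolded F_fold]
  note prime = points_prime[OF P]
  have shrink: "shrink i u \<in> carrier (F i)" if "u \<in> G i" for i u
    using that by (auto simp: shrink_def F_def G_def free_module_simps C_def)
  have extend: "extend i u \<in> G i" if "u \<in> carrier (F i)" for i u
    using that by (auto simp: extend_def F_def G_def free_module_simps C_def)
  have shrink_extend: "shrink i (extend i u) = u" if "u \<in> carrier (F i)" for i u
    using that by (auto simp: shrink_def extend_def F_def free_module_simps PiE_iff extensional_def fun_eq_iff)
  have extend_shrink: "extend i (shrink i u) = u" if "u \<in> G i" for i u
    using that by (auto simp: shrink_def extend_def G_def fun_eq_iff)
  have shrink_add: "shrink i (u + v) = shrink i u \<oplus>\<^bsub>F i\<^esub> shrink i v" for i u v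
    by (auto simp: shrink_def F_def free_module_simps fun_eq_iff)
  have shrink_scale: "shrink i (scale f u) = f \<odot>\<^bsub>F i\<^esub> shrink i u" for i f u
    by (auto simp: shrink_def F_def free_module_simps scale_def fun_eq_iff)
  have extend_add: "extend i (u \<oplus>\<^bsub>F i\<^esub> v) = extend i u + extend i v" for i u v
    by (auto simp: extend_def F_def free_module_simps fun_eq_iff)
  have extend_scale: "extend i (f \<odot>\<^bsub>F i\<^esub> u) = scale f (extend i u)" for i f u
    by (auto simp: extend_def F_def free_module_simps scale_def fun_eq_iff)
  have extend_zero: "extend i \<zero>\<^bsub>F i\<^esub> = 0" for i
    by (auto simp: extend_def F_def free_module_simps fun_eq_iff)
  have shrink_D: "shrink i (D i u) = d i (shrink (Suc i) u)" if "u \<in> G (Suc i)" for i u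
    unfolding D_def by (rule shrink_extend[OF dD(1)[OF shrink[OF that]]])
  have D_extend: "D i (extend (Suc i) w) = extend i (d i w)" if "w \<in> carrier (F (Suc i))" for i w
    unfolding D_def by (simp only: shrink_extend[OF that])
  obtain x where x: "bij_betw x {0..<card X} X"
    using ex_bij_betw_nat_finite[OF finite_subset[OF X finite_cox_vars]] by blast
  have xX: "x k \<in> X" if "k < card X" for k using x that by (auto simp: bij_betw_def)
  interpret localized_complex scale C S G D "card X" "\<lambda>k. cox_var (x k)"
  proof (unfold_locales, goal_cases)
    case (5 f g) then show ?case unfolding C_def by (rule cox_ring_closed(3))
  next
    case (6 f) then show ?case unfolding C_def by (rule cox_ring_closed(5))
  next
    case 7 show ?case unfolding S_def C_def using homogeneous_closed(1) by blast
  next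
    case 8
    show ?case unfolding S_def using homogeneous_closed(2) primeideal_closed(2)[OF prime] by blast
  next
    case (9 s t)
    then show ?case unfolding S_def by (rule homogeneous_diff_mult[OF prime])
  next
    case (10 k)
    then show ?case unfolding C_def using xX X by (blast intro: cox_var_closed)
  next
    case (11 i) then show ?case by (simp add: G_def C_def cox_ring_closed)
  next
    case (12 i u v) then show ?case by (simp add: G_def C_def cox_ring_closed)
  next
    case (13 i f u) then show ?case by (simp add: G_def scale_def C_def cox_ring_closed)
  next
    case (14 i u) then show ?case unfolding D_def by (intro extend dD(1) shrink)
  next
    case (15 i u v)
    then show ?case unfolding D_def by (simp only: shrink_add dD(2) shrink extend_add)
  next
    case (16 i f u)
    then show ?case unfolding D_def C_def by (simp only: shrink_scale dD(3) shrink extend_scale)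
  next
    case (17 i u)
    have "D (Suc i) u = extend (Suc i) (d (Suc i) (shrink (Suc (Suc i)) u))" by (simp add: D_def)
    then show ?case by (simp only: D_extend[OF dD(1)[OF shrink[OF 17]]] dd[OF shrink[OF 17]] extend_zero)
  qed (simp_all add: scale_def fun_eq_iff algebra_simps)
  define V where "V = (\<lambda>k. x ` {..<k})"
  have V_Suc: "V (Suc k) = insert (x k) (V k)" for k by (auto simp: V_def lessThan_Suc)
  have V_X: "V k \<subseteq> X" if "k \<le> card X" for k using that xX by (auto simp: V_def)
  have J_iff: "u \<in> J k i \<longleftrightarrow> u \<in> G i \<and> (\<forall>l<length (a i). u l \<in> var_ideal r n (V k))"
    if "k \<le> card X" for k i u
    using that
  proof (induction k arbitrary: u)
    case 0
    have V0: "f \<in> var_ideal r n (V 0) \<longleftrightarrow> f = 0" for f :: "'k mpoly"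
    proof
      assume "f \<in> var_ideal r n (V 0)"
      then have "Poly_Mapping.keys f = {}" by (auto simp: var_ideal_def V_def)
      then show "f = 0" by simp
    qed (simp add: var_ideal_def cox_ring_closed)
    show ?case
    proof
      assume "u \<in> J 0 i"
      then have "u = 0" by simp
      then show "u \<in> G i \<and> (\<forall>l<length (a i). u l \<in> var_ideal r n (V 0))"
        unfolding V0 using F_zero[of i] by simp
    next
      assume u: "u \<in> G i \<and> (\<forall>l<length (a i). u l \<in> var_ideal r n (V 0))"
      have "u l = 0" for l
      proof (cases "l < length (a i)")
        case True
        then show ?thesis using u unfolding V0 by blast
      next
        case False
        then show ?thesis using u by (simp add: G_def)
      qed
      then show "u \<in> J 0 i" by (simp add: fun_eq_iff)
    qed
  next
    case (Suc k)
    note idl = ideal_closed[OF ideal_var_ideal[of r n "V (Suc k)"]]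
    have k: "k < card X" "k \<le> card X" using Suc.prems by auto
    have cx: "insert (x k) (V k) \<subseteq> cox_vars r n" using V_X[OF Suc.prems] X unfolding V_Suc by blast
    show ?case
    proof
      assume u: "u \<in> J (Suc k) i"
      then obtain g j where g: "u = scale (cox_var (x k)) g + j" "g \<in> G i" "j \<in> J k i" by auto
      have "u l \<in> var_ideal r n (V (Suc k))" if l: "l < length (a i)" for l
      proof -
        have "cox_var (x k) \<in> (var_ideal r n (V (Suc k)) :: 'k mpoly set)"
          using var_ideal_subset_iff[OF ideal_var_ideal, of "V (Suc k)" r n] cx unfolding V_Suc by blast
        moreover have "g l \<in> carrier (cox_ring r n)" using g(2) l by (simp add: G_def C_def)
        moreover have "j l \<in> var_ideal r n (V (Suc k))"
          using Suc.IH[OF k(2)] g(3) l unfolding var_ideal_def V_Suc by blast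
        moreover have "u l = cox_var (x k) * g l + j l" by (simp add: g(1) scale_def)
        ultimately show ?thesis using idl(3,5) by metis
      qed
      then show "u \<in> G i \<and> (\<forall>l<length (a i). u l \<in> var_ideal r n (V (Suc k)))"
        using u J_subset[OF Suc.prems] by blast
    next
      assume u: "u \<in> G i \<and> (\<forall>l<length (a i). u l \<in> var_ideal r n (V (Suc k)))"
      then have "\<exists>g j. g \<in> C \<and> j \<in> var_ideal r n (V k) \<and> u l = cox_var (x k) * g + j"
        if "l < length (a i)" for l
        using that var_ideal_insert_split[OF _ cx] unfolding C_def V_Suc by blast
      then obtain g j where gj: "\<And>l. l < length (a i) \<Longrightarrow>
          g l \<in> C \<and> j l \<in> var_ideal r n (V k) \<and> u l = cox_var (x k) * g l + j l" by metis
      have "extend i g \<in> G i" using gj by (auto simp: extend_def G_def)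
      moreover have "extend i j \<in> J k i"
        unfolding Suc.IH[OF k(2)] using gj by (auto simp: extend_def G_def C_def var_ideal_def)
      moreover have "u = scale (cox_var (x k)) (extend i g) + extend i j"
        using u gj by (auto simp: fun_eq_iff scale_def extend_def G_def)
      ultimately show "u \<in> J (Suc k) i" by (intro J_SucI)
    qed
  qed
  have L0: "u \<in> L 0 i \<longleftrightarrow> (\<exists>t\<in>S. \<exists>w\<in>carrier (F (Suc i)). t \<odot>\<^bsub>F i\<^esub> shrink i u = d i w)"
    if u: "u \<in> G i" for u i
  proof
    assume "u \<in> L 0 i"
    then obtain s w where s: "s \<in> S" "w \<in> G (Suc i)" "scale s u = D i w" by (auto simp: L_def)
    have "s \<odot>\<^bsub>F i\<^esub> shrink i u = d i (shrink (Suc i) w)"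
      using shrink_D[OF s(2)] by (simp only: shrink_scale[symmetric] s(3))
    then show "\<exists>t\<in>S. \<exists>w\<in>carrier (F (Suc i)). t \<odot>\<^bsub>F i\<^esub> shrink i u = d i w"
      using s shrink by blast
  next
    assume "\<exists>t\<in>S. \<exists>w\<in>carrier (F (Suc i)). t \<odot>\<^bsub>F i\<^esub> shrink i u = d i w"
    then obtain t w where t: "t \<in> S" "w \<in> carrier (F (Suc i))" "t \<odot>\<^bsub>F i\<^esub> shrink i u = d i w" by blast
    have "scale t u = D i (extend (Suc i) w)"
      unfolding D_extend[OF t(2)] t(3)[symmetric] extend_scale extend_shrink[OF u] ..
    then show "u \<in> L 0 i" using t(1) extend[OF t(2)] by (intro L_I[of t _ _ 0]) auto
  qed
  obtain u where u: "u \<in> carrier (F 0)"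
    and not_image: "\<And>t w. t \<in> S \<Longrightarrow> w \<in> carrier (F (Suc 0)) \<Longrightarrow> t \<odot>\<^bsub>F 0\<^esub> u \<noteq> d 0 w"
    and image: "\<And>v. v \<in> cox_vars r n \<Longrightarrow> \<exists>t\<in>S. t * cox_var v \<in> I \<Longrightarrow>
      \<exists>t\<in>S. \<exists>w\<in>carrier (F (Suc 0)). t \<odot>\<^bsub>F 0\<^esub> (cox_var v \<odot>\<^bsub>F 0\<^esub> u) = d 0 w"
    using stalk(2) unfolding S_def by blast
  show ?thesis
  proof (rule length_ge)
    fix i k u assume k: "k < card X" and u: "u \<in> G i" "scale (cox_var (x k)) u \<in> J k i"
    have "x l \<noteq> x k" if "l < k" for l
      using inj_onD[OF bij_betw_imp_inj_on[OF x], of l k] that k by auto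
    then have "x k \<notin> V k" unfolding V_def by (metis imageE lessThan_iff)
    then have notin: "cox_var (x k) \<notin> (var_ideal r n (V k) :: 'k mpoly set)"
      by (simp add: var_ideal_def keys_cox_var)
    have xC: "cox_var (x k) \<in> carrier (cox_ring r n)" using xX[OF k] X by (blast intro: cox_var_closed)
    have prod: "cox_var (x k) * u l \<in> var_ideal r n (V k)" if "l < length (a i)" for l
    proof -
      have "scale (cox_var (x k)) u l \<in> var_ideal r n (V k)"
        using u(2) that unfolding J_iff[OF less_imp_le[OF k]] by blast
      then show ?thesis by (simp only: scale_def)
    qed
    have "u l \<in> var_ideal r n (V k)" if l: "l < length (a i)" for l
    proof -
      have "u l \<in> carrier (cox_ring r n)" using u(1) l by (simp add: G_def C_def)
      from primeideal_closed(3)[OF primeideal_var_ideal xC this prod[OF l]] notin show ?thesis by blast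
    qed
    then show "u \<in> J k i" using J_iff k u(1) by simp
  next
    fix i u assume u: "u \<in> G (Suc i)" "D i u = 0"
    have "d i (shrink (Suc i) u) = shrink i (D i u)" by (rule shrink_D[OF u(1), symmetric])
    also have "\<dots> = \<zero>\<^bsub>F i\<^esub>" unfolding u(2) by (simp add: shrink_def F_def free_module_simps fun_eq_iff)
    finally show "u \<in> L 0 (Suc i)" unfolding L0[OF u(1)] unfolding S_def by (rule stalk(1)[OF shrink[OF u(1)]])
  next
    show G: "extend 0 u \<in> G 0" by (rule extend[OF u])
    show "extend 0 u \<notin> L 0 0" unfolding L0[OF G] shrink_extend[OF u] using not_image by blast
    fix k assume k: "k < card X"
    have "cox_var (x k) \<in> C" unfolding C_def using xX[OF k] X by (blast intro: cox_var_closed)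
    from F_scale[OF this G] show "scale (cox_var (x k)) (extend 0 u) \<in> L 0 0"
      unfolding L0[OF F_scale[OF \<open>cox_var (x k) \<in> C\<close> G]] shrink_scale shrink_extend[OF u]
      using image[of "x k"] killed[OF xX[OF k]] xX[OF k] X unfolding S_def by blast
  next
    fix i assume "i > p"
    then show "G i = {0}" using bounded by (auto simp: G_def fun_eq_iff)
  qed
qed

section \<open>Dimension of coordinate subvarieties\<close>

lemma topspace_zariski: "topspace (zariski r n) = points r n"
proof
  show "topspace (zariski r n) \<subseteq> points r n" by (rule openin_zariski_subset) simp
  have "{P \<in> points r n. 1 \<notin> P} \<subseteq> topspace (zariski r n)"
    by (rule openin_subset[OF openin_zariski_basic[OF homogeneous_closed(2)]])
  then show "points r n \<subseteq> topspace (zariski r n)"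
    using primeideal_closed(2)[OF points_prime] by blast
qed

text \<open>The complement of the variety is the union of the basic open sets that belong to the generators.\<close>

lemma closedin_variety:
  fixes I :: "'k::field mpoly set"
  assumes G: "G \<subseteq> homogeneous r n" and I: "\<And>P. P \<in> points r n \<Longrightarrow> I \<subseteq> P \<longleftrightarrow> G \<subseteq> P"
  shows "closedin (zariski r n) (variety r n I)"
  unfolding closedin_def topspace_zariski
proof
  show "variety r n I \<subseteq> points r n" by (simp add: variety_def)
  have "P \<in> points r n - variety r n I \<longleftrightarrow> P \<in> (\<Union>f\<in>G. {P \<in> points r n. f \<notin> P})" for P
  proof (cases "P \<in> points r n")
    case True
    then have "P \<in> points r n - variety r n I \<longleftrightarrow> \<not> G \<subseteq> P" by (simp add: variety_def I)
    then show ?thesis using True by auto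
  qed simp
  then have "points r n - variety r n I = (\<Union>f\<in>G. {P \<in> points r n. f \<notin> P})" by (rule Set.set_eqI)
  moreover have "openin (zariski r n) (\<Union>f\<in>G. {P \<in> points r n. f \<notin> P})"
    by (intro openin_Union) (use G openin_zariski_basic in blast)
  ultimately show "openin (zariski r n) (points r n - variety r n I)" by simp
qed

lemma closedin_variety_var_ideal:
  assumes "X \<subseteq> cox_vars r n"
  shows "closedin (zariski r n) (variety r n (var_ideal r n X) :: 'k::field mpoly set set)"
proof (rule closedin_variety)
  show "cox_var ` X \<subseteq> (homogeneous r n :: 'k mpoly set)"
    using assms homogeneous_closed(4) by blast
  show "var_ideal r n X \<subseteq> P \<longleftrightarrow> cox_var ` X \<subseteq> P" if "P \<in> points r n" for P :: "'k mpoly set"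
    using var_ideal_subset_iff[OF primeideal_closed(1)[OF points_prime[OF that]] assms] by blast
qed

text \<open>Basic open sets have this property, and it is preserved by unions and intersections.\<close>

lemma openin_zariski_generize:
  assumes "openin (zariski r n) W" "P \<in> W" "P' \<in> points r n" "P' \<subseteq> P"
  shows "P' \<in> W"
proof -
  have "generate_topology_on {{P \<in> points r n. f \<notin> P} | f. f \<in> homogeneous r n} W"
    using assms(1) unfolding zariski_def openin_topology_generated_by_iff .
  then show ?thesis using assms(2)
    by (induction rule: generate_topology_on.induct) (use assms(3,4) in blast)+
qed

lemma closedin_zariski_specialize:
  assumes "closedin (zariski r n) Z" "P \<in> Z" "P' \<in> points r n" "P \<subseteq> P'"
  shows "P' \<in> Z"
proof (rule ccontr)
  assume "P' \<notin> Z"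
  then have "P' \<in> topspace (zariski r n) - Z" using assms(3) by (simp add: topspace_zariski)
  then have "P \<in> topspace (zariski r n) - Z"
    using openin_zariski_generize[of r n _ P' P] assms closedin_subset[OF assms(1)]
    unfolding closedin_def topspace_zariski by blast
  then show False using assms by blast
qed

text \<open>The product of one variable outside \<open>X\<close> from each factor lies in the irrelevant ideal, but not in the
  ideal generated by \<open>X\<close>.\<close>

lemma var_ideal_point:
  assumes "\<And>i. i \<in> {1..r} \<Longrightarrow> \<exists>j\<le>n i. (i, j) \<notin> X"
  shows "(var_ideal r n X :: 'k::field mpoly set) \<in> points r n"
proof -
  obtain y where y: "\<And>i. i \<in> {1..r} \<Longrightarrow> y i \<le> n i \<and> (i, y i) \<notin> X" using assms by metis
  let ?Y = "(\<lambda>i. (i, y i)) ` {1..r}"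
  have Y: "?Y \<subseteq> cox_vars r n" using y by (auto simp: cox_vars_def)
  let ?f = "Poly_Mapping.single (squarefree_exponent ?Y) 1 :: 'k mpoly"
  have "?f \<in> irrelevant_ideal r n"
    unfolding irrelevant_ideal_def
  proof
    fix i assume i: "i \<in> {1..r}"
    have gens: "(\<lambda>j. cox_var (i, j) :: 'k mpoly) ` {0..n i} \<subseteq> carrier (cox_ring r n)"
      using i by (auto intro!: cox_var_closed simp: cox_vars_def)
    have m: "(i, y i) \<in> Poly_Mapping.keys (squarefree_exponent ?Y)" using i by (simp add: keys_squarefree_exponent)
    have "cox_var (i, y i) \<in> Idl\<^bsub>cox_ring r n\<^esub> ((\<lambda>j. cox_var (i, j) :: 'k mpoly) ` {0..n i})"
      using y[OF i] by (intro Idl_self[OF gens]) auto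
    moreover have "Poly_Mapping.single (squarefree_exponent ?Y - Poly_Mapping.single (i, y i) 1) (1 :: 'k) \<in> carrier (cox_ring r n)"
      using keys_minus_nat[of "squarefree_exponent ?Y" "Poly_Mapping.single (i, y i) 1"] Y
      by (intro cox_ring_closed) (simp add: keys_squarefree_exponent)
    ultimately show "?f \<in> Idl\<^bsub>cox_ring r n\<^esub> ((\<lambda>j. cox_var (i, j) :: 'k mpoly) ` {0..n i})"
      unfolding single_split_var[OF m] by (rule ideal_closed(5)[OF ideal_Idl[OF gens]])
  qed
  moreover have "?f \<notin> var_ideal r n X" using y by (auto simp: var_ideal_def keys_squarefree_exponent)
  ultimately show ?thesis
    using primeideal_var_ideal homogeneous_var_ideal by (auto simp: points_def)
qed

lemma irreducible_closed_subtopology: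
  assumes "closedin T A"
  shows "irreducible_closed (subtopology T A) Z \<longleftrightarrow> irreducible_closed T Z \<and> Z \<subseteq> A"
proof (cases "Z \<subseteq> A")
  case True
  have "closedin (subtopology T A) Z1 \<and> closedin (subtopology T A) Z2 \<and> Z = Z1 \<union> Z2 \<longleftrightarrow>
      closedin T Z1 \<and> closedin T Z2 \<and> Z = Z1 \<union> Z2" for Z1 Z2
    using True unfolding closedin_closed_subtopology[OF assms] by blast
  moreover have "closedin (subtopology T A) Z \<longleftrightarrow> closedin T Z"
    using True unfolding closedin_closed_subtopology[OF assms] by blast
  ultimately show ?thesis using True unfolding irreducible_closed_def by presburger
next
  case False
  then show ?thesis by (simp add: irreducible_closed_def closedin_closed_subtopology[OF assms])
qed

lemma topological_dim_mono:
  assumes "closedin T A" "closedin T B" "A \<subseteq> B"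
  shows "topological_dim (subtopology T A) \<le> topological_dim (subtopology T B)"
  unfolding topological_dim_def irreducible_closed_subtopology[OF assms(1)]
    irreducible_closed_subtopology[OF assms(2)]
proof (rule Sup_subset_mono, rule subsetI)
  fix c assume "c \<in> {ereal (real l) | l. \<exists>Z. (\<forall>i\<le>l. irreducible_closed T (Z i) \<and> Z i \<subseteq> A) \<and> (\<forall>i<l. Z i \<subset> Z (Suc i))}"
  then obtain l Z where c: "c = ereal (real l)" and Z: "\<forall>i\<le>l. irreducible_closed T (Z i) \<and> Z i \<subseteq> A"
    "\<forall>i<l. Z i \<subset> Z (Suc i)" by blast
  have "\<forall>i\<le>l. irreducible_closed T (Z i) \<and> Z i \<subseteq> B" using Z(1) assms(3) by (meson subset_trans)
  with c Z(2) show "c \<in> {ereal (real l) | l. \<exists>Z. (\<forall>i\<le>l. irreducible_closed T (Z i) \<and> Z i \<subseteq> B) \<and> (\<forall>i<l. Z i \<subset> Z (Suc i))}"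
    by (intro CollectI exI[of _ l] conjI exI[of _ Z])
qed

text \<open>A closed set that contains the point \<open>P\<close> contains all of its variety: \<open>P\<close> is a generic point.\<close>

lemma irreducible_closed_variety:
  assumes P: "P \<in> points r n" and cl: "closedin (zariski r n) (variety r n P)"
  shows "irreducible_closed (zariski r n) (variety r n P)"
  unfolding irreducible_closed_def
proof (intro conjI allI impI cl)
  have self: "P \<in> variety r n P" using P by (simp add: variety_def)
  then show "variety r n P \<noteq> {}" by blast
  have sub: "variety r n P \<subseteq> Z" if "closedin (zariski r n) Z" "P \<in> Z" for Z
    using closedin_zariski_specialize[OF that] by (auto simp: variety_def)
  fix Z1 Z2
  assume "closedin (zariski r n) Z1 \<and> closedin (zariski r n) Z2 \<and> variety r n P = Z1 \<union> Z2"
  then show "variety r n P = Z1 \<or> variety r n P = Z2" using sub self by blast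
qed

lemma card_cox_vars: "card (cox_vars r n) = total_dim r n + r"
  by (simp add: cox_vars_def total_dim_def sum_Suc)

text \<open>Keep one variable outside \<open>X\<close> in each factor (the set \<open>Y\<close>), and adjoin the remaining variables \<open>R\<close> to \<open>X\<close> one after the
  other. The ideals generated by these sets are points, and their varieties form a strictly decreasing chain
  of irreducible closed sets. Its length is \<open>card R = |n| + r - card X - r\<close>.\<close>

lemma dim_V_var_ideal_ge:
  assumes X: "X \<subseteq> cox_vars r n" and rel: "\<And>i. i \<in> {1..r} \<Longrightarrow> \<exists>j\<le>n i. (i, j) \<notin> X"
  shows "dim_V r n (var_ideal r n X :: 'k::field mpoly set) \<ge> ereal (real (total_dim r n) - real (card X))"
proof -
  obtain y where y: "\<And>i. i \<in> {1..r} \<Longrightarrow> y i \<le> n i \<and> (i, y i) \<notin> X" using rel by metis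
  define Y where "Y = (\<lambda>i. (i, y i)) ` {1..r}"
  have cardY: "card Y = r" unfolding Y_def by (subst card_image) (auto simp: inj_on_def)
  have Y: "Y \<subseteq> cox_vars r n - X" using y by (auto simp: cox_vars_def Y_def)
  define R where "R = cox_vars r n - X - Y"
  define l where "l = card R"
  have finY: "finite Y" by (simp add: Y_def)
  have finX: "finite X" using X finite_cox_vars finite_subset by blast
  have finR: "finite R" using finite_cox_vars by (auto simp: R_def)
  have "card (X \<union> Y \<union> R) = card (X \<union> Y) + card R"
    using finX finY finR by (intro card_Un_disjoint) (auto simp: R_def)
  also have "card (X \<union> Y) = card X + card Y"
    using finX finY Y by (intro card_Un_disjoint) auto
  also have "X \<union> Y \<union> R = cox_vars r n" using X Y by (auto simp: R_def)
  finally have "card (cox_vars r n) = card X + card Y + card R" .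
  then have l: "total_dim r n = card X + l" by (simp add: card_cox_vars cardY l_def)
  obtain x where x: "bij_betw x {0..<l} R" using ex_bij_betw_nat_finite[OF finR] by (auto simp: l_def)
  \<comment> \<open>Chains are listed from the smallest set upwards, so E k loses the variable x k when k grows.\<close>
  define E where "E k = X \<union> x ` {k..<l}" for k
  have xR: "x k \<in> R" if "k < l" for k using x that by (auto simp: bij_betw_def)
  have E: "E k \<subseteq> cox_vars r n" "X \<subseteq> E k" "E k \<inter> Y = {}" for k
    using X Y xR by (auto simp: E_def R_def)
  define Z where "Z k = variety r n (var_ideal r n (E k) :: 'k mpoly set)" for k
  have pt: "(var_ideal r n (E k) :: 'k mpoly set) \<in> points r n" for k
  proof (rule var_ideal_point)
    fix i assume i: "i \<in> {1..r}"
    then have "(i, y i) \<in> Y" by (auto simp: Y_def)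
    then show "\<exists>j\<le>n i. (i, j) \<notin> E k" using y[OF i] E(3)[of k] by blast
  qed
  have sub: "var_ideal r n A \<subseteq> (var_ideal r n B :: 'k mpoly set)" if "A \<subseteq> B" for A B
    using that by (auto simp: var_ideal_def)
  have irr: "irreducible_closed (zariski r n) (Z k)" "Z k \<subseteq> variety r n (var_ideal r n X)" for k
    unfolding Z_def using irreducible_closed_variety[OF pt closedin_variety_var_ideal[OF E(1)]] sub[OF E(2)[of k]]
    by (auto simp: variety_def)
  have "Z k \<subset> Z (Suc k)" if k: "k < l" for k
  proof -
    have "E (Suc k) \<subseteq> E k" by (auto simp: E_def)
    then have "Z k \<subseteq> Z (Suc k)" unfolding Z_def variety_def using sub by blast
    moreover have "x k \<notin> E (Suc k)"
    proof -
      have "x m \<noteq> x k" if "m \<in> {Suc k..<l}" for m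
        using inj_onD[OF bij_betw_imp_inj_on[OF x], of m k] that k by auto
      then show ?thesis using xR[OF k] unfolding E_def R_def by (metis DiffD1 DiffD2 UnE imageE)
    qed
    then have "cox_var (x k) \<notin> (var_ideal r n (E (Suc k)) :: 'k mpoly set)"
      by (simp add: var_ideal_def keys_cox_var)
    moreover have "x k \<in> E k" using k by (auto simp: E_def)
    then have "cox_var (x k) \<in> (var_ideal r n (E k) :: 'k mpoly set)"
      using var_ideal_subset_iff[OF ideal_var_ideal E(1)] by blast
    ultimately have "var_ideal r n (E (Suc k)) \<notin> Z k" "var_ideal r n (E (Suc k)) \<in> Z (Suc k)"
      using pt unfolding Z_def variety_def by blast+
    with \<open>Z k \<subseteq> Z (Suc k)\<close> show ?thesis by blast
  qed
  then have "ereal (real l) \<le> dim_V r n (var_ideal r n X :: 'k mpoly set)"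
    unfolding dim_V_def topological_dim_def
      irreducible_closed_subtopology[OF closedin_variety_var_ideal[OF X]]
    using irr by (intro Sup_upper) blast
  then show ?thesis using l by simp
qed

lemma closedin_variety_stanley_reisner:
  assumes "simplicial_complex_on r n \<Delta>" "I = (stanley_reisner_ideal r n \<Delta> :: 'k::field mpoly set)"
  shows "closedin (zariski r n) (variety r n I)"
proof (rule closedin_variety)
  let ?G = "(\<lambda>\<sigma>. \<Prod>v\<in>\<sigma>. cox_var v) ` {\<sigma>. \<sigma> \<subseteq> cox_vars r n \<and> \<sigma> \<notin> \<Delta>} :: 'k mpoly set"
  show "?G \<subseteq> homogeneous r n"
    using finite_subset[OF _ finite_cox_vars]
    by (auto intro!: homogeneous_closed simp: prod_cox_var keys_squarefree_exponent)
  fix P :: "'k mpoly set" assume P: "P \<in> points r n"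
  show "I \<subseteq> P \<longleftrightarrow> ?G \<subseteq> P"
  proof
    have "?G \<subseteq> I"
      unfolding assms(2) stanley_reisner_ideal_def by (rule subsetI) (rule Idl_self[OF stanley_reisner_generators[OF assms]])
    then show "?G \<subseteq> P" if "I \<subseteq> P" using that by (rule subset_trans)
    show "I \<subseteq> P" if "?G \<subseteq> P"
      unfolding assms(2) stanley_reisner_ideal_def
      by (rule Idl_minimal[OF primeideal_closed(1)[OF points_prime[OF P]] that])
  qed
qed


theorem proposition2p3:
  fixes r p :: nat and n :: "nat \<Rightarrow> nat"
    and \<Delta> :: "(nat \<times> nat) set set"
    and I Q :: "'k::field mpoly set"
    and a :: "nat \<Rightarrow> (nat \<Rightarrow> int) list"
    and d :: "nat \<Rightarrow> (nat \<Rightarrow> 'k mpoly) \<Rightarrow> (nat \<Rightarrow> 'k mpoly)"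
  assumes "r \<ge> 1"
    and "simplicial_complex_on r n \<Delta>"
    and "I = stanley_reisner_ideal r n \<Delta>"
    and "virtual_resolution r n I p a d"
    and "ereal (real p) = ereal (real (total_dim r n)) - dim_V r n I"
    and "associated_prime r n I Q"
    and "\<not> irrelevant_ideal r n \<subseteq> Q"
  shows "codim r n Q = ereal (real p)"
proof -
  define X where "X = {v \<in> cox_vars r n. cox_var v \<in> Q}"
  note sr = associated_prime_stanley_reisner[OF assms(2,3,6), folded X_def]
  have Q: "Q = var_ideal r n X" "I \<subseteq> Q" by (rule sr)+
  have X: "X \<subseteq> cox_vars r n" by (auto simp: X_def)
  have prime: "primeideal Q (cox_ring r n)" unfolding Q(1) by (rule primeideal_var_ideal)
  have rel: "\<exists>j\<le>n i. (i, j) \<notin> X" if "i \<in> {1..r}" for i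
    using not_irrelevant_subset[OF primeideal_closed(1)[OF prime] assms(7) that] by (auto simp: X_def)
  have pt: "Q \<in> points r n" unfolding Q(1) by (rule var_ideal_point[OF rel])
  have "card X \<le> p"
  proof (rule card_le_length[OF assms(4) ideal_stanley_reisner[OF assms(2,3)] Q(2) pt X])
    fix v assume v: "v \<in> X"
    let ?t = "\<Prod>w\<in>cox_vars r n - X. cox_var w :: 'k mpoly"
    have "?t \<in> homogeneous r n"
      unfolding prod_cox_var using finite_cox_vars by (intro homogeneous_closed) (simp add: keys_squarefree_exponent)
    moreover have "?t \<notin> Q"
      unfolding Q(1) prod_cox_var using finite_cox_vars by (auto simp: var_ideal_def keys_squarefree_exponent)
    ultimately show "\<exists>t\<in>homogeneous r n - Q. t * cox_var v \<in> I" using sr(3)[OF v] by blast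
  qed
  then have "ereal (real (total_dim r n) - real p) \<le> ereal (real (total_dim r n) - real (card X))"
    by simp
  also have "\<dots> \<le> dim_V r n Q" unfolding Q(1) by (rule dim_V_var_ideal_ge[OF X rel])
  finally have lower: "ereal (real (total_dim r n) - real p) \<le> dim_V r n Q" .
  have "variety r n Q \<subseteq> variety r n I" using Q(2) by (auto simp: variety_def)
  moreover have "closedin (zariski r n) (variety r n Q)"
    unfolding Q(1) by (rule closedin_variety_var_ideal[OF X])
  ultimately have upper: "dim_V r n Q \<le> dim_V r n I"
    unfolding dim_V_def using closedin_variety_stanley_reisner[OF assms(2,3)] by (intro topological_dim_mono)
  have "dim_V r n I = ereal (real (total_dim r n) - real p)"
    using assms(5) by (cases "dim_V r n I") auto
  then have "dim_V r n Q = ereal (real (total_dim r n) - real p)" using lower upper by simp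
  then show ?thesis by (simp add: codim_def)
qed

end
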